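(* Let $R$ be a ring with unity and let $\mathcal{X}$ be a semibrick of left $R$-modules such that every $X\in\mathcal{X}$ has projective dimension at most one and $\mathcal{X}$ contains no $\mathcal{X}$-divisible objects. Let $Y\in\mathcal{X}$ and let $\bar{Y}=Y_{\mathcal{X}}(\infty)$ be its Prüfer module. Then the endomorphism ring $E=\mathrm{End}(\bar{Y})$ is local, and its Jacobson radical is $J=\{f\in E\mid f(Y)=0\}$. Moreover, every nonzero endomorphism of $\bar{Y}$ is surjective.
   Context: A brick is a finitely presented left $R$-module whose endomorphism ring is a division ring. A semibrick is a class $\mathcal{X}$ of pairwise non-isomorphic bricks with $\mathrm{Hom}(X,X')=0$ for distinct $X,X'\in\mathcal{X}$. A module $M$ is $\mathcal{X}$-divisible if $\mathrm{Ext}^1(X,M)=0$ for all $X\in\mathcal{X}$. $\mathcal{X}$-universal sequences: let $Y$ be a module. For each $X\in\mathcal{X}$, $\mathrm{Ext}^1(X,Y)$ is a left $\mathrm{End}(X)$-module (acting by pull-back; compositions written from left to right). Choose a basis $(0\to Y\to M_{X,i}\to X\to 0)_{i\in I_X}$ over the division ring $\mathrm{End}(X)$. The $\mathcal{X}$-universal short exact sequence $0\to Y\to M\to\bigoplus_{X\in\mathcal{X}}X^{(I_X)}\to 0$ starting from $Y$ is the push-out of $0\to\bigoplus_{X}Y^{(I_X)}\to\bigoplus_{X,i}M_{X,i}\to\bigoplus_{X}X^{(I_X)}\to 0$ along the summation map $\bigoplus_X Y^{(I_X)}\to Y$. Define $Y_{\mathcal{X}}(1)=Y$ and let $Y_{\mathcal{X}}(i)\to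 Y_{\mathcal{X}}(i+1)$ be the monomorphism of an $\mathcal{X}$-universal sequence starting from $Y_{\mathcal{X}}(i)$; $Y_{\mathcal{X}}(\infty)$ is the direct limit, and $Y$ is viewed as a submodule of it. For $Y\in\mathcal{X}$, $\bar{Y}=Y_{\mathcal{X}}(\infty)$ is called a Prüfer module. *)

theory Defs
  imports "HOL-Algebra.Ideal" "HOL-Algebra.Module"
begin

section \<open>Noncommutative rings\<close>

definition division_ring :: "('a, 'k) ring_scheme \<Rightarrow> bool" where
  "division_ring D \<longleftrightarrow>
     ring D \<and> \<one>\<^bsub>D\<^esub> \<noteq> \<zero>\<^bsub>D\<^esub> \<and> Units D = carrier D - {\<zero>\<^bsub>D\<^esub>}"

definition left_ideal :: "'a set \<Rightarrow> ('a, 'k) ring_scheme \<Rightarrow> bool" where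
  "left_ideal I S \<longleftrightarrow>
     additive_subgroup I S \<and> (\<forall>r\<in>carrier S. \<forall>x\<in>I. r \<otimes>\<^bsub>S\<^esub> x \<in> I)"

definition maximal_left_ideal :: "'a set \<Rightarrow> ('a, 'k) ring_scheme \<Rightarrow> bool" where
  "maximal_left_ideal I S \<longleftrightarrow>
     left_ideal I S \<and> I \<noteq> carrier S \<and>
     (\<forall>K. left_ideal K S \<and> I \<subseteq> K \<longrightarrow> K = I \<or> K = carrier S)"

definition local_ring :: "('a, 'k) ring_scheme \<Rightarrow> bool" where
  "local_ring S \<longleftrightarrow> ring S \<and> (\<exists>!I. maximal_left_ideal I S)"

definition jacobson_radical :: "('a, 'k) ring_scheme \<Rightarrow> 'a set" where
  "jacobson_radical S =
     {x \<in> carrier S. \<forall>I. maximal_left_ideal I S \<longrightarrow> x \<in> I}"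


section \<open>Left modules\<close>

text \<open>
  The library locale \<^locale>\<open>module\<close> requires a commutative ring of scalars.  We keep its record
  type (whose fields \<^const>\<open>mult\<close> and \<^const>\<open>one\<close> play no role for modules) and its axioms,
  over an arbitrary ring with unity.
\<close>

locale left_module = R?: ring R + M?: abelian_group M
  for R :: "('r, 'k) ring_scheme" (structure) and M :: "('r, 'm) module" (structure) +
  assumes smult_closed [simp, intro]:
      "\<lbrakk>a \<in> carrier R; x \<in> carrier M\<rbrakk> \<Longrightarrow> a \<odot>\<^bsub>M\<^esub> x \<in> carrier M"
    and smult_l_distr:
      "\<lbrakk>a \<in> carrier R; b \<in> carrier R; x \<in> carrier M\<rbrakk> \<Longrightarrow>
        (a \<oplus> b) \<odot>\<^bsub>M\<^esub> x = a \<odot>\<^bsub>M\<^esub> x \<oplus>\<^bsub>M\<^esub> b \<odot>\<^bsub>M\<^esub> x"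
    and smult_r_distr:
      "\<lbrakk>a \<in> carrier R; x \<in> carrier M; y \<in> carrier M\<rbrakk> \<Longrightarrow>
        a \<odot>\<^bsub>M\<^esub> (x \<oplus>\<^bsub>M\<^esub> y) = a \<odot>\<^bsub>M\<^esub> x \<oplus>\<^bsub>M\<^esub> a \<odot>\<^bsub>M\<^esub> y"
    and smult_assoc1:
      "\<lbrakk>a \<in> carrier R; b \<in> carrier R; x \<in> carrier M\<rbrakk> \<Longrightarrow>
        (a \<otimes> b) \<odot>\<^bsub>M\<^esub> x = a \<odot>\<^bsub>M\<^esub> (b \<odot>\<^bsub>M\<^esub> x)"
    and smult_one [simp]:
      "x \<in> carrier M \<Longrightarrow> \<one> \<odot>\<^bsub>M\<^esub> x = x"

definition linear_map ::
  "('r, 'k) ring_scheme \<Rightarrow> ('r, 'm) module \<Rightarrow> ('r, 'n) module \<Rightarrow> ('m \<Rightarrow> 'n) \<Rightarrow> bool" where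
  "linear_map R M N f \<longleftrightarrow>
     f \<in> carrier M \<rightarrow> carrier N \<and>
     (\<forall>x\<in>carrier M. \<forall>y\<in>carrier M. f (x \<oplus>\<^bsub>M\<^esub> y) = f x \<oplus>\<^bsub>N\<^esub> f y) \<and>
     (\<forall>r\<in>carrier R. \<forall>x\<in>carrier M. f (r \<odot>\<^bsub>M\<^esub> x) = r \<odot>\<^bsub>N\<^esub> f x)"

definition Hom ::
  "('r, 'k) ring_scheme \<Rightarrow> ('r, 'm) module \<Rightarrow> ('r, 'n) module \<Rightarrow> ('m \<Rightarrow> 'n) set" where
  "Hom R M N = {f \<in> extensional (carrier M). linear_map R M N f}"

definition zero_map :: "('r, 'm) module \<Rightarrow> ('r, 'n) module \<Rightarrow> 'm \<Rightarrow> 'n" where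
  "zero_map M N = (\<lambda>x\<in>carrier M. \<zero>\<^bsub>N\<^esub>)"

definition module_iso ::
  "('r, 'k) ring_scheme \<Rightarrow> ('r, 'm) module \<Rightarrow> ('r, 'n) module \<Rightarrow> ('m \<Rightarrow> 'n) \<Rightarrow> bool" where
  "module_iso R M N f \<longleftrightarrow> linear_map R M N f \<and> bij_betw f (carrier M) (carrier N)"

text \<open>Endomorphism rings; the product \<open>f g\<close> means first \<open>f\<close>, then \<open>g\<close>.\<close>

definition End :: "('r, 'k) ring_scheme \<Rightarrow> ('r, 'm) module \<Rightarrow> ('m \<Rightarrow> 'm) ring" where
  "End R M =
     \<lparr>carrier = Hom R M M,
      mult = (\<lambda>f g. compose (carrier M) g f),
      one = (\<lambda>x\<in>carrier M. x),
      zero = zero_map M M,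
      add = (\<lambda>f g. \<lambda>x\<in>carrier M. f x \<oplus>\<^bsub>M\<^esub> g x)\<rparr>"

definition regular_module :: "('r, 'k) ring_scheme \<Rightarrow> ('r, 'r) module" where
  "regular_module R =
     \<lparr>carrier = carrier R, mult = undefined, one = undefined, zero = \<zero>\<^bsub>R\<^esub>,
      add = (\<lambda>x y. x \<oplus>\<^bsub>R\<^esub> y), smult = (\<lambda>r x. r \<otimes>\<^bsub>R\<^esub> x)\<rparr>"

definition prod_module :: "('r, 'm) module \<Rightarrow> ('r, 'n) module \<Rightarrow> ('r, 'm \<times> 'n) module" where
  "prod_module M N =
     \<lparr>carrier = carrier M \<times> carrier N, mult = undefined, one = undefined,
      zero = (\<zero>\<^bsub>M\<^esub>, \<zero>\<^bsub>N\<^esub>),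
      add = (\<lambda>(x, y) (x', y'). (x \<oplus>\<^bsub>M\<^esub> x', y \<oplus>\<^bsub>N\<^esub> y')),
      smult = (\<lambda>r (x, y). (r \<odot>\<^bsub>M\<^esub> x, r \<odot>\<^bsub>N\<^esub> y))\<rparr>"

definition direct_sum :: "'i set \<Rightarrow> ('i \<Rightarrow> ('r, 'm) module) \<Rightarrow> ('r, 'i \<Rightarrow> 'm) module" where
  "direct_sum I M =
     \<lparr>carrier = {x \<in> (\<Pi>\<^sub>E i\<in>I. carrier (M i)). finite {i \<in> I. x i \<noteq> \<zero>\<^bsub>M i\<^esub>}},
      mult = undefined, one = undefined,
      zero = (\<lambda>i\<in>I. \<zero>\<^bsub>M i\<^esub>),
      add = (\<lambda>x y. \<lambda>i\<in>I. x i \<oplus>\<^bsub>M i\<^esub> y i),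
      smult = (\<lambda>r x. \<lambda>i\<in>I. r \<odot>\<^bsub>M i\<^esub> x i)\<rparr>"

definition quotient_module :: "('r, 'm) module \<Rightarrow> 'm set \<Rightarrow> ('r, 'm set) module" where
  "quotient_module M U =
     \<lparr>carrier = a_rcosets\<^bsub>M\<^esub> U, mult = undefined, one = undefined,
      zero = U,
      add = (\<lambda>C D. C <+>\<^bsub>M\<^esub> D),
      smult = (\<lambda>r C. \<Union>x\<in>C. U +>\<^bsub>M\<^esub> (r \<odot>\<^bsub>M\<^esub> x))\<rparr>"

text \<open>\<open>B\<close> is a basis of the left module \<open>V\<close> over the division ring \<open>K\<close>.\<close>

definition module_basis :: "('c, 'k) ring_scheme \<Rightarrow> ('c, 'v) module \<Rightarrow> 'v set \<Rightarrow> bool" where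
  "module_basis K V B \<longleftrightarrow>
     B \<subseteq> carrier V \<and>
     (\<forall>v\<in>carrier V. \<exists>!c. c \<in> (\<Pi>\<^sub>E b\<in>B. carrier K) \<and> finite {b \<in> B. c b \<noteq> \<zero>\<^bsub>K\<^esub>} \<and>
        v = (\<Oplus>\<^bsub>V\<^esub>b\<in>{b \<in> B. c b \<noteq> \<zero>\<^bsub>K\<^esub>}. c b \<odot>\<^bsub>V\<^esub> b))"


section \<open>Short exact sequences\<close>

text \<open>
  A record \<open>e\<close> of the following type encodes a sequence \<open>0 \<rightarrow> A \<rightarrow> E \<rightarrow> B \<rightarrow> 0\<close>; the outer
  terms are separate arguments of the notions below.
\<close>

record ('r, 'a, 'e, 'b) ses =
  ses_in :: "'a \<Rightarrow> 'e"
  ses_mid :: "('r, 'e) module"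
  ses_out :: "'e \<Rightarrow> 'b"

definition short_exact ::
  "('r, 'k) ring_scheme \<Rightarrow> ('r, 'a) module \<Rightarrow> ('r, 'b) module \<Rightarrow> ('r, 'a, 'e, 'b) ses \<Rightarrow> bool" where
  "short_exact R A B e \<longleftrightarrow>
     left_module R A \<and> left_module R (ses_mid e) \<and> left_module R B \<and>
     linear_map R A (ses_mid e) (ses_in e) \<and>
     linear_map R (ses_mid e) B (ses_out e) \<and>
     inj_on (ses_in e) (carrier A) \<and>
     ses_out e ` carrier (ses_mid e) = carrier B \<and>
     ses_in e ` carrier A = {m \<in> carrier (ses_mid e). ses_out e m = \<zero>\<^bsub>B\<^esub>}"

text \<open>Equivalence of sequences with the same end terms; the middle terms may live in different
  types.\<close>

definition ses_equiv ::
  "('r, 'k) ring_scheme \<Rightarrow> ('r, 'a) module \<Rightarrow> ('r, 'a, 'e, 'b) ses \<Rightarrow> ('r, 'a, 'f, 'b) ses \<Rightarrow> bool"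
  where
  "ses_equiv R A e e' \<longleftrightarrow>
     (\<exists>h. linear_map R (ses_mid e) (ses_mid e') h \<and>
        (\<forall>a\<in>carrier A. h (ses_in e a) = ses_in e' a) \<and>
        (\<forall>m\<in>carrier (ses_mid e). ses_out e' (h m) = ses_out e m))"

definition split_ses :: "('r, 'a) module \<Rightarrow> ('r, 'b) module \<Rightarrow> ('r, 'a, 'a \<times> 'b, 'b) ses" where
  "split_ses A B = \<lparr>ses_in = (\<lambda>a. (a, \<zero>\<^bsub>B\<^esub>)), ses_mid = prod_module A B, ses_out = snd\<rparr>"

text \<open>Pull-back of a sequence ending in \<open>B\<close> along \<open>f : B' \<rightarrow> B\<close>.\<close>

definition pullback_ses ::
  "('r, 'b') module \<Rightarrow> ('b' \<Rightarrow> 'b) \<Rightarrow> ('r, 'a, 'e, 'b) ses \<Rightarrow> ('r, 'a, 'e \<times> 'b', 'b') ses" where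
  "pullback_ses B' f e =
     \<lparr>ses_in = (\<lambda>a. (ses_in e a, \<zero>\<^bsub>B'\<^esub>)),
      ses_mid = (prod_module (ses_mid e) B')
        \<lparr>carrier := {(m, b) \<in> carrier (ses_mid e) \<times> carrier B'. ses_out e m = f b}\<rparr>,
      ses_out = snd\<rparr>"

text \<open>Push-out of a sequence starting in \<open>A\<close> along \<open>g : A \<rightarrow> A'\<close>.\<close>

definition pushout_ses ::
  "('r, 'a) module \<Rightarrow> ('r, 'a') module \<Rightarrow> ('a \<Rightarrow> 'a') \<Rightarrow> ('r, 'a, 'e, 'b) ses \<Rightarrow>
   ('r, 'a', ('a' \<times> 'e) set, 'b) ses" where
  "pushout_ses A A' g e =
     (let P = prod_module A' (ses_mid e);
          U = (\<lambda>a. (g a, \<ominus>\<^bsub>ses_mid e\<^esub> ses_in e a)) ` carrier A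
      in \<lparr>ses_in = (\<lambda>a'. U +>\<^bsub>P\<^esub> (a', \<zero>\<^bsub>ses_mid e\<^esub>)),
          ses_mid = quotient_module P U,
          ses_out = (\<lambda>C. the_elem ((\<lambda>(a', m). ses_out e m) ` C))\<rparr>)"

definition prod_ses ::
  "('r, 'a, 'e, 'b) ses \<Rightarrow> ('r, 'a', 'e', 'b') ses \<Rightarrow>
   ('r, 'a \<times> 'a', 'e \<times> 'e', 'b \<times> 'b') ses" where
  "prod_ses e e' =
     \<lparr>ses_in = map_prod (ses_in e) (ses_in e'),
      ses_mid = prod_module (ses_mid e) (ses_mid e'),
      ses_out = map_prod (ses_out e) (ses_out e')\<rparr>"

definition direct_sum_ses ::
  "'i set \<Rightarrow> ('i \<Rightarrow> ('r, 'a, 'e, 'b) ses) \<Rightarrow> ('r, 'i \<Rightarrow> 'a, 'i \<Rightarrow> 'e, 'i \<Rightarrow> 'b) ses" where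
  "direct_sum_ses I e =
     \<lparr>ses_in = (\<lambda>x. \<lambda>i\<in>I. ses_in (e i) (x i)),
      ses_mid = direct_sum I (\<lambda>i. ses_mid (e i)),
      ses_out = (\<lambda>x. \<lambda>i\<in>I. ses_out (e i) (x i))\<rparr>"


section \<open>The group of extensions\<close>

text \<open>
  \<open>Ext\<^sup>1(X, Y)\<close> consists of the equivalence classes of sequences \<open>0 \<rightarrow> Y \<rightarrow> E \<rightarrow> X \<rightarrow> 0\<close>.
  The middle terms range over the type \<open>'y \<times> 'x\<close>: every extension is equivalent to one whose
  middle term has the underlying set \<open>Y \<times> X\<close>, so no class is lost.  Sequences obtained by
  pull-back and push-out have middle terms in other types; they determine the class of all
  extensions (with middle term in \<open>'y \<times> 'x\<close>) equivalent to them.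
\<close>

type_synonym ('r, 'y, 'x) extension = "('r, 'y, 'y \<times> 'x, 'x) ses"

definition ext_class ::
  "('r, 'k) ring_scheme \<Rightarrow> ('r, 'x) module \<Rightarrow> ('r, 'y) module \<Rightarrow> ('r, 'y, 'e, 'x) ses \<Rightarrow>
   ('r, 'y, 'x) extension set" where
  "ext_class R X Y e = {e'. short_exact R Y X e' \<and> ses_equiv R Y e' e}"

text \<open>The Baer sum: push-out along the codiagonal \<open>Y \<oplus> Y \<rightarrow> Y\<close> of the pull-back along the
  diagonal \<open>X \<rightarrow> X \<oplus> X\<close> of the direct sum of both sequences.\<close>

definition baer_sum ::
  "('r, 'x) module \<Rightarrow> ('r, 'y) module \<Rightarrow> ('r, 'y, 'e, 'x) ses \<Rightarrow> ('r, 'y, 'f, 'x) ses \<Rightarrow>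
   ('r, 'y, ('y \<times> ('e \<times> 'f) \<times> 'x) set, 'x) ses" where
  "baer_sum X Y e e' =
     pushout_ses (prod_module Y Y) Y (\<lambda>(y, y'). y \<oplus>\<^bsub>Y\<^esub> y')
       (pullback_ses X (\<lambda>x. (x, x)) (prod_ses e e'))"

text \<open>\<open>Ext\<^sup>1(X, Y)\<close> as a left \<open>End(X)\<close>-module, with \<open>End(X)\<close> acting by pull-back.\<close>

definition Ext1 ::
  "('r, 'k) ring_scheme \<Rightarrow> ('r, 'x) module \<Rightarrow> ('r, 'y) module \<Rightarrow>
   ('x \<Rightarrow> 'x, ('r, 'y, 'x) extension set) module" where
  "Ext1 R X Y =
     \<lparr>carrier = {ext_class R X Y e | e :: ('r, 'y, 'x) extension. short_exact R Y X e},
      mult = undefined, one = undefined,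
      zero = ext_class R X Y (split_ses Y X),
      add = (\<lambda>c d. \<Union>e\<in>c. \<Union>e'\<in>d. ext_class R X Y (baer_sum X Y e e')),
      smult = (\<lambda>f c. \<Union>e\<in>c. ext_class R X Y (pullback_ses X f e))\<rparr>"


section \<open>Finiteness and projectivity\<close>

definition finitely_presented :: "('r, 'k) ring_scheme \<Rightarrow> ('r, 'm) module \<Rightarrow> bool" where
  "finitely_presented R M \<longleftrightarrow>
     left_module R M \<and>
     (\<exists>(k::nat) (n::nat) f p.
        let F = direct_sum {..<k} (\<lambda>_. regular_module R);
            G = direct_sum {..<n} (\<lambda>_. regular_module R)
        in linear_map R F G f \<and> linear_map R G M p \<and>
           p ` carrier G = carrier M \<and>
           f ` carrier F = {x \<in> carrier G. p x = \<zero>\<^bsub>M\<^esub>})"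

text \<open>
  The lifting property is tested against epimorphisms \<open>A \<rightarrow> B\<close> with \<open>A\<close> in the type \<open>'p \<Rightarrow> 'r\<close> and
  \<open>B\<close> in the type \<open>'p\<close>.  This includes the epimorphism onto \<open>P\<close> from the free module on the
  underlying set of \<open>P\<close>, and lifting the identity of \<open>P\<close> along the latter yields the lifting
  property for all epimorphisms in all types.
\<close>

definition projective :: "('r, 'k) ring_scheme \<Rightarrow> ('r, 'p) module \<Rightarrow> bool" where
  "projective R P \<longleftrightarrow>
     left_module R P \<and>
     (\<forall>(A :: ('r, 'p \<Rightarrow> 'r) module) (B :: ('r, 'p) module) g h.
        left_module R A \<and> left_module R B \<and>
        linear_map R A B g \<and> g ` carrier A = carrier B \<and> linear_map R P B h \<longrightarrow>
        (\<exists>l. linear_map R P A l \<and> (\<forall>x\<in>carrier P. g (l x) = h x)))"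

text \<open>
  Existence of a projective resolution \<open>0 \<rightarrow> P\<^sub>1 \<rightarrow> P\<^sub>0 \<rightarrow> X \<rightarrow> 0\<close>.  The type \<open>'x \<Rightarrow> 'r\<close> contains the free
  module on the underlying set of \<open>X\<close>, which by Schanuel's lemma can serve as \<open>P\<^sub>0\<close> whenever
  there is any such resolution.
\<close>

definition proj_dim_le_one :: "('r, 'k) ring_scheme \<Rightarrow> ('r, 'x) module \<Rightarrow> bool" where
  "proj_dim_le_one R X \<longleftrightarrow>
     (\<exists>(P\<^sub>1 :: ('r, 'x \<Rightarrow> 'r) module) (e :: ('r, 'x \<Rightarrow> 'r, 'x \<Rightarrow> 'r, 'x) ses).
        projective R P\<^sub>1 \<and> projective R (ses_mid e) \<and> short_exact R P\<^sub>1 X e)"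


section \<open>Semibricks and Pruefer modules\<close>

definition brick :: "('r, 'k) ring_scheme \<Rightarrow> ('r, 'x) module \<Rightarrow> bool" where
  "brick R X \<longleftrightarrow> finitely_presented R X \<and> division_ring (End R X)"

definition semibrick :: "('r, 'k) ring_scheme \<Rightarrow> ('r, 'x) module set \<Rightarrow> bool" where
  "semibrick R \<X> \<longleftrightarrow>
     (\<forall>X\<in>\<X>. brick R X) \<and>
     (\<forall>X\<in>\<X>. \<forall>X'\<in>\<X>. X \<noteq> X' \<longrightarrow>
        \<not> (\<exists>f. module_iso R X X' f) \<and> Hom R X X' = {zero_map X X'})"

definition divisible ::
  "('r, 'k) ring_scheme \<Rightarrow> ('r, 'x) module set \<Rightarrow> ('r, 'm) module \<Rightarrow> bool" where
  "divisible R \<X> M \<longleftrightarrow>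
     left_module R M \<and> (\<forall>X\<in>\<X>. carrier (Ext1 R X M) = {\<zero>\<^bsub>Ext1 R X M\<^esub>})"

definition summation_map :: "'i set \<Rightarrow> ('r, 'm) module \<Rightarrow> ('i \<Rightarrow> 'm) \<Rightarrow> 'm" where
  "summation_map I Y x = (\<Oplus>\<^bsub>Y\<^esub>i\<in>{i \<in> I. x i \<noteq> \<zero>\<^bsub>Y\<^esub>}. x i)"

text \<open>
  \<open>e\<close> is an \<open>\<X>\<close>-universal sequence starting from \<open>Y\<close>.  For every \<open>X \<in> \<X>\<close> the set \<open>B X\<close> is a
  basis of \<open>Ext\<^sup>1(X, Y)\<close>, which also serves as the index set \<open>I\<^sub>X\<close>, and \<open>\<xi>\<close> selects a sequence
  \<open>0 \<rightarrow> Y \<rightarrow> M\<^bsub>X,b\<^esub> \<rightarrow> X \<rightarrow> 0\<close> from each basis element.  The push-out is taken up to equivalence.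
\<close>

definition universal_ses ::
  "('r, 'k) ring_scheme \<Rightarrow> ('r, 'x) module set \<Rightarrow> ('r, 'y) module \<Rightarrow>
   (('r, 'x) module \<Rightarrow> ('r, 'y, 'x) extension set set) \<Rightarrow>
   ('r, 'y, 'e, ('r, 'x) module \<times> ('r, 'y, 'x) extension set \<Rightarrow> 'x) ses \<Rightarrow> bool" where
  "universal_ses R \<X> Y B e \<longleftrightarrow>
     (\<forall>X\<in>\<X>. module_basis (End R X) (Ext1 R X Y) (B X)) \<and>
     short_exact R Y (direct_sum (Sigma \<X> B) fst) e \<and>
     (\<exists>\<xi>. (\<forall>X\<in>\<X>. \<forall>b\<in>B X. \<xi> (X, b) \<in> b) \<and>
        ses_equiv R Y e
          (pushout_ses (direct_sum (Sigma \<X> B) (\<lambda>_. Y)) Y (summation_map (Sigma \<X> B) Y)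
            (direct_sum_ses (Sigma \<X> B) \<xi>)))"

text \<open>
  The term \<open>N n\<close> is \<open>Y\<^bsub>\<X>\<^esub>(n + 1)\<close>, with \<open>\<phi> n\<close> the monomorphism from \<open>N n\<close> to \<open>N (n + 1)\<close>.
  Since the terms of the sequence need a larger type than \<open>Y\<close> in general, the equality
  \<open>Y\<^bsub>\<X>\<^esub>(1) = Y\<close> becomes an isomorphism \<open>\<iota>\<close> from \<open>Y\<close> to \<open>N 0\<close>.
\<close>

definition universal_chain ::
  "('r, 'k) ring_scheme \<Rightarrow> ('r, 'x) module set \<Rightarrow> ('r, 'y) module \<Rightarrow>
   ('y \<Rightarrow> 'm) \<Rightarrow> (nat \<Rightarrow> ('r, 'm) module) \<Rightarrow> (nat \<Rightarrow> 'm \<Rightarrow> 'm) \<Rightarrow> bool" where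
  "universal_chain R \<X> Y \<iota> N \<phi> \<longleftrightarrow>
     module_iso R Y (N 0) \<iota> \<and>
     (\<forall>n. \<exists>B p. universal_ses R \<X> (N n) B
        \<lparr>ses_in = \<phi> n, ses_mid = N (Suc n), ses_out = p\<rparr>)"

primrec chain_map :: "(nat \<Rightarrow> 'm \<Rightarrow> 'm) \<Rightarrow> nat \<Rightarrow> nat \<Rightarrow> 'm \<Rightarrow> 'm" where
  "chain_map \<phi> n 0 x = x"
| "chain_map \<phi> n (Suc k) x = \<phi> (n + k) (chain_map \<phi> n k x)"

text \<open>The element of the direct limit represented by \<open>x \<in> N n\<close>, as a class of pairs.\<close>

definition limit_elem ::
  "(nat \<Rightarrow> ('r, 'm) module) \<Rightarrow> (nat \<Rightarrow> 'm \<Rightarrow> 'm) \<Rightarrow> nat \<Rightarrow> 'm \<Rightarrow> (nat \<times> 'm) set" where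
  "limit_elem N \<phi> n x =
     {(m, y). y \<in> carrier (N m) \<and>
        (\<exists>k l. n + k = m + l \<and> chain_map \<phi> n k x = chain_map \<phi> m l y)}"

definition direct_limit ::
  "(nat \<Rightarrow> ('r, 'm) module) \<Rightarrow> (nat \<Rightarrow> 'm \<Rightarrow> 'm) \<Rightarrow> ('r, (nat \<times> 'm) set) module" where
  "direct_limit N \<phi> =
     \<lparr>carrier = {limit_elem N \<phi> n x | n x. x \<in> carrier (N n)},
      mult = undefined, one = undefined,
      zero = limit_elem N \<phi> 0 \<zero>\<^bsub>N 0\<^esub>,
      add = (\<lambda>C D. \<Union>{limit_elem N \<phi> n (x \<oplus>\<^bsub>N n\<^esub> y) | n x y. (n, x) \<in> C \<and> (n, y) \<in> D}),
      smult = (\<lambda>r C. \<Union>(n, x)\<in>C. limit_elem N \<phi> n (r \<odot>\<^bsub>N n\<^esub> x))\<rparr>"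

end

theory Submission
  imports Defs
begin

text \<open>
  Two facts about the chain \<open>Y = Y(1) \<rightarrow> Y(2) \<rightarrow> \<dots>\<close> drive the argument.  Let \<open>X \<in> \<X>\<close>, and let \<open>K \<subseteq> G\<close> be the
  kernel of an epimorphism \<open>\<pi> : G \<rightarrow> X\<close> from a finitely generated free module.  Since the classes in
  \<open>B X\<close> span \<open>Ext\<^sup>1(X, Y(i))\<close>, every linear map \<open>K \<rightarrow> Y(i)\<close> extends to \<open>G \<rightarrow> Y(i + 1)\<close>; since
  they are linearly independent and \<open>\<X>\<close> is Hom-orthogonal, every linear map \<open>X \<rightarrow> Y(i + 1)\<close> lands
  in \<open>Y(i)\<close>.  As \<open>X\<close> is finitely generated, every linear map from \<open>X\<close> to the limit \<open>V\<close> lands in \<open>Y\<close>.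
  Consequently two maps \<open>G \<rightarrow> V\<close> that agree on \<open>K\<close> differ by a map into \<open>Y\<close>.

  A nonzero endomorphism \<open>f\<close> of \<open>V\<close> has \<open>Y\<close> in its image: if \<open>i\<close> is least with \<open>f(Y(i)) \<noteq> 0\<close>, then \<open>f\<close>
  induces a nonzero map from some \<open>X \<in> \<X>\<close> to \<open>Y\<close>, so \<open>X = Y\<close> and this map is invertible.  The image then
  contains every \<open>Y(i)\<close>: lift a summand \<open>X\<close> of \<open>Y(i + 1)/Y(i)\<close> to \<open>l : G \<rightarrow> Y(i + 1)\<close>; as \<open>K\<close> is
  projective, \<open>l\<close> restricted to \<open>K\<close> lifts along \<open>f\<close>, the lift extends to \<open>\<nu> : G \<rightarrow> V\<close> because \<open>K\<close> is finitely
  generated, and \<open>l\<close> and \<open>f \<nu>\<close> agree on \<open>K\<close>.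

  If \<open>f\<close> does not vanish on \<open>Y\<close>, it is bijective on \<open>Y\<close>, and by induction on every \<open>Y(i)\<close>: the
  induced endomorphism of \<open>Y(i + 1)/Y(i)\<close> is bijective on maps from the objects of \<open>\<X>\<close>, hence bijective.
  So the endomorphisms vanishing on \<open>Y\<close> are exactly the non-units.
\<close>

section \<open>Linear maps and submodules\<close>

text \<open>The main obstacle is that \<open>Ext1\<close> consists of classes of sequences whereas
  the argument is about maps. Restricting a lift of \<pi> to \<open>K\<close> identifies Ext^1(X, Y)
  with Hom(K, Y) modulo the restrictions of maps G -> Y, and a universal sequence then says the
  following: pulled back along the map from X to the direct sum with coordinates f_b in End(X), it
  represents the combination of the b with coefficients f_b. So the extension property is existence
  of coordinates. For the landing property, a map X -> Y(i+1) yields coordinates whose pull-back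
  splits, because the map to the direct sum lifts; the combination vanishes, and uniqueness of
  coordinates makes them zero. Finite generation enters at three places: X has bounded image in the
  limit, so has K, and a map from X to a direct sum meets finitely many summands. Projectivity of K
  is used only as the possibility to lift along a given map. To keep all maps in one module, the
  terms of the chain are replaced by their images \<open>W n\<close> in the limit. Two maps that
  agree on K are equal only up to \<open>W 0\<close>, which does no harm: \<open>W 0\<close> lies in
  every submodule to which the comparison is applied.\<close>

lemma left_moduleI:
  assumes "ring R" "abelian_group M"
    and "\<And>a x. \<lbrakk>a \<in> carrier R; x \<in> carrier M\<rbrakk> \<Longrightarrow> a \<odot>\<^bsub>M\<^esub> x \<in> carrier M"
    and "\<And>a b x. \<lbrakk>a \<in> carrier R; b \<in> carrier R; x \<in> carrier M\<rbrakk> \<Longrightarrow>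
        (a \<oplus>\<^bsub>R\<^esub> b) \<odot>\<^bsub>M\<^esub> x = a \<odot>\<^bsub>M\<^esub> x \<oplus>\<^bsub>M\<^esub> b \<odot>\<^bsub>M\<^esub> x"
    and "\<And>a x y. \<lbrakk>a \<in> carrier R; x \<in> carrier M; y \<in> carrier M\<rbrakk> \<Longrightarrow>
        a \<odot>\<^bsub>M\<^esub> (x \<oplus>\<^bsub>M\<^esub> y) = a \<odot>\<^bsub>M\<^esub> x \<oplus>\<^bsub>M\<^esub> a \<odot>\<^bsub>M\<^esub> y"
    and "\<And>a b x. \<lbrakk>a \<in> carrier R; b \<in> carrier R; x \<in> carrier M\<rbrakk> \<Longrightarrow>
        (a \<otimes>\<^bsub>R\<^esub> b) \<odot>\<^bsub>M\<^esub> x = a \<odot>\<^bsub>M\<^esub> (b \<odot>\<^bsub>M\<^esub> x)"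
    and "\<And>x. x \<in> carrier M \<Longrightarrow> \<one>\<^bsub>R\<^esub> \<odot>\<^bsub>M\<^esub> x = x"
  shows "left_module R M"
  using assms by (simp add: left_module_def left_module_axioms_def)

lemma left_module_ring: "left_module R M \<Longrightarrow> ring R"
  and left_module_group: "left_module R M \<Longrightarrow> abelian_group M"
  by (simp_all add: left_module_def)

lemma (in left_module) smult_zero [simp]:
  assumes "a \<in> carrier R" shows "a \<odot>\<^bsub>M\<^esub> \<zero>\<^bsub>M\<^esub> = \<zero>\<^bsub>M\<^esub>"
proof -
  have "a \<odot>\<^bsub>M\<^esub> \<zero>\<^bsub>M\<^esub> \<oplus>\<^bsub>M\<^esub> a \<odot>\<^bsub>M\<^esub> \<zero>\<^bsub>M\<^esub> = a \<odot>\<^bsub>M\<^esub> \<zero>\<^bsub>M\<^esub>"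
    using smult_r_distr[OF assms M.zero_closed M.zero_closed] by simp
  with assms show ?thesis by (metis M.add.l_cancel_one' M.zero_closed smult_closed)
qed

lemma (in left_module) zero_smult [simp]:
  assumes "x \<in> carrier M" shows "\<zero> \<odot>\<^bsub>M\<^esub> x = \<zero>\<^bsub>M\<^esub>"
proof -
  have "\<zero> \<odot>\<^bsub>M\<^esub> x \<oplus>\<^bsub>M\<^esub> \<zero> \<odot>\<^bsub>M\<^esub> x = \<zero> \<odot>\<^bsub>M\<^esub> x"
    using smult_l_distr[OF R.zero_closed R.zero_closed assms] by simp
  with assms show ?thesis by (metis M.add.l_cancel_one' R.zero_closed smult_closed)
qed

lemma (in left_module) smult_uminus_one:
  assumes "x \<in> carrier M" shows "(\<ominus> \<one>) \<odot>\<^bsub>M\<^esub> x = \<ominus>\<^bsub>M\<^esub> x"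
proof -
  have "(\<ominus> \<one>) \<odot>\<^bsub>M\<^esub> x \<oplus>\<^bsub>M\<^esub> x = \<zero>\<^bsub>M\<^esub>"
    using smult_l_distr[of "\<ominus> \<one>" \<one> x] assms by (simp add: R.l_neg)
  then show ?thesis using assms by (simp add: M.minus_equality)
qed

lemma (in left_module) smult_uminus:
  assumes "a \<in> carrier R" "x \<in> carrier M"
  shows "a \<odot>\<^bsub>M\<^esub> (\<ominus>\<^bsub>M\<^esub> x) = \<ominus>\<^bsub>M\<^esub> (a \<odot>\<^bsub>M\<^esub> x)"
proof -
  have "a \<odot>\<^bsub>M\<^esub> (\<ominus>\<^bsub>M\<^esub> x) \<oplus>\<^bsub>M\<^esub> a \<odot>\<^bsub>M\<^esub> x = \<zero>\<^bsub>M\<^esub>"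
    using smult_r_distr[of a "\<ominus>\<^bsub>M\<^esub> x" x] assms by (simp add: M.l_neg)
  then show ?thesis using assms by (simp add: M.minus_equality)
qed

lemma linear_mapI:
  assumes "\<And>x. x \<in> carrier M \<Longrightarrow> f x \<in> carrier N"
    and "\<And>x y. \<lbrakk>x \<in> carrier M; y \<in> carrier M\<rbrakk> \<Longrightarrow> f (x \<oplus>\<^bsub>M\<^esub> y) = f x \<oplus>\<^bsub>N\<^esub> f y"
    and "\<And>r x. \<lbrakk>r \<in> carrier R; x \<in> carrier M\<rbrakk> \<Longrightarrow> f (r \<odot>\<^bsub>M\<^esub> x) = r \<odot>\<^bsub>N\<^esub> f x"
  shows "linear_map R M N f"
  using assms by (auto simp: linear_map_def)

lemma linear_map_closed: "\<lbrakk>linear_map R M N f; x \<in> carrier M\<rbrakk> \<Longrightarrow> f x \<in> carrier N"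
  and linear_map_add: "\<lbrakk>linear_map R M N f; x \<in> carrier M; y \<in> carrier M\<rbrakk> \<Longrightarrow>
        f (x \<oplus>\<^bsub>M\<^esub> y) = f x \<oplus>\<^bsub>N\<^esub> f y"
  and linear_map_smult: "\<lbrakk>linear_map R M N f; r \<in> carrier R; x \<in> carrier M\<rbrakk> \<Longrightarrow>
        f (r \<odot>\<^bsub>M\<^esub> x) = r \<odot>\<^bsub>N\<^esub> f x"
  by (auto simp: linear_map_def)

lemma linear_map_zero:
  assumes "left_module R M" "left_module R N" "linear_map R M N f"
  shows "f \<zero>\<^bsub>M\<^esub> = \<zero>\<^bsub>N\<^esub>"
proof -
  interpret M: left_module R M by fact
  interpret N: left_module R N by fact
  have "f \<zero>\<^bsub>M\<^esub> \<oplus>\<^bsub>N\<^esub> f \<zero>\<^bsub>M\<^esub> = f \<zero>\<^bsub>M\<^esub>"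
    using linear_map_add[OF assms(3), of "\<zero>\<^bsub>M\<^esub>" "\<zero>\<^bsub>M\<^esub>"] by simp
  then show ?thesis
    by (metis M.zero_closed N.M.add.l_cancel_one' assms(3) linear_map_closed)
qed

lemma linear_map_uminus:
  assumes "left_module R M" "left_module R N" "linear_map R M N f" "x \<in> carrier M"
  shows "f (\<ominus>\<^bsub>M\<^esub> x) = \<ominus>\<^bsub>N\<^esub> f x"
proof -
  interpret M: left_module R M by fact
  interpret N: left_module R N by fact
  have "f (\<ominus>\<^bsub>M\<^esub> x) \<oplus>\<^bsub>N\<^esub> f x = \<zero>\<^bsub>N\<^esub>"
    using linear_map_add[OF assms(3), of "\<ominus>\<^bsub>M\<^esub> x" x] assms linear_map_zero[OF assms(1-3)]
    by (simp add: M.M.l_neg)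
  then show ?thesis using assms by (simp add: N.M.minus_equality linear_map_closed)
qed

lemma linear_map_minus:
  assumes "left_module R M" "left_module R N" "linear_map R M N f" "x \<in> carrier M" "y \<in> carrier M"
  shows "f (x \<ominus>\<^bsub>M\<^esub> y) = f x \<ominus>\<^bsub>N\<^esub> f y"
proof -
  interpret M: left_module R M by fact
  show ?thesis using assms
    by (simp add: a_minus_def linear_map_add linear_map_uminus[OF assms(1-3)])
qed

text \<open>\<open>linear_map\<close> constrains values on the carrier only, so a function may be
  altered outside it. This is how restricted functions enter \<open>Hom\<close>.\<close>

lemma linear_map_cong:
  assumes "left_module R M" "linear_map R M N f" "\<And>x. x \<in> carrier M \<Longrightarrow> g x = f x"
  shows "linear_map R M N g"
proof -
  interpret M: left_module R M by fact
  show ?thesis using assms(2,3) by (auto simp: linear_map_def Pi_def)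
qed

lemma linear_map_comp:
  "linear_map R L M f \<Longrightarrow> linear_map R M N g \<Longrightarrow> linear_map R L N (\<lambda>x. g (f x))"
  by (rule linear_mapI) (simp_all add: linear_map_closed linear_map_add linear_map_smult)

lemma linear_map_ident: "linear_map R M M (\<lambda>x. x)"
  by (rule linear_mapI) simp_all

lemma linear_map_const_zero: "left_module R N \<Longrightarrow> linear_map R M N (\<lambda>x. \<zero>\<^bsub>N\<^esub>)"
proof -
  assume "left_module R N"
  then interpret N: left_module R N .
  show ?thesis by (rule linear_mapI) simp_all
qed

lemma linear_map_plus:
  assumes "left_module R N" "linear_map R M N f" "linear_map R M N g"
  shows "linear_map R M N (\<lambda>x. f x \<oplus>\<^bsub>N\<^esub> g x)"
proof -
  interpret N: left_module R N by fact
  show ?thesis using assms(2,3)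
    by (intro linear_mapI)
      (simp_all add: linear_map_closed linear_map_add linear_map_smult N.smult_r_distr N.M.a_ac)
qed

lemma linear_map_neg:
  assumes "left_module R N" "linear_map R M N f"
  shows "linear_map R M N (\<lambda>x. \<ominus>\<^bsub>N\<^esub> f x)"
proof -
  interpret N: left_module R N by fact
  show ?thesis using assms(2)
    by (intro linear_mapI)
      (simp_all add: linear_map_closed linear_map_add linear_map_smult N.smult_uminus N.M.minus_add)
qed

lemma linear_map_diff:
  assumes "left_module R N" "linear_map R M N f" "linear_map R M N g"
  shows "linear_map R M N (\<lambda>x. f x \<ominus>\<^bsub>N\<^esub> g x)"
  unfolding a_minus_def by (intro linear_map_plus linear_map_neg assms)

lemma linear_map_finsum_fun:
  assumes "left_module R M" "left_module R N" "\<And>i. i \<in> F \<Longrightarrow> linear_map R M N (f i)"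
  shows "linear_map R M N (\<lambda>x. \<Oplus>\<^bsub>N\<^esub>i\<in>F. f i x)"
proof -
  interpret N: left_module R N by fact
  show ?thesis
  proof (cases "finite F")
    case True
    then show ?thesis using assms(3)
    proof (induction F)
      case empty
      show ?case by (simp add: linear_map_const_zero assms(2))
    next
      case (insert i F)
      have "linear_map R M N (\<lambda>x. f i x \<oplus>\<^bsub>N\<^esub> (\<Oplus>\<^bsub>N\<^esub>i\<in>F. f i x))"
        using insert by (intro linear_map_plus[OF assms(2)]) auto
      then show ?case
      proof (rule linear_map_cong[OF assms(1)])
        fix x assume "x \<in> carrier M"
        then have "f j x \<in> carrier N" if "j \<in> insert i F" for j
          using insert.prems[OF that] by (simp add: linear_map_closed)
        then show "(\<Oplus>\<^bsub>N\<^esub>j\<in>insert i F. f j x) = f i x \<oplus>\<^bsub>N\<^esub> (\<Oplus>\<^bsub>N\<^esub>j\<in>F. f j x)"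
          using insert.hyps by (intro N.M.finsum_insert) auto
      qed
    qed
  next
    case False
    then show ?thesis by (simp add: linear_map_const_zero assms(2) N.M.finsum_infinite)
  qed
qed

lemma (in abelian_group) minus_eq_zero_iff:
  "\<lbrakk>x \<in> carrier G; y \<in> carrier G\<rbrakk> \<Longrightarrow> x \<ominus> y = \<zero> \<longleftrightarrow> x = y"
  by (metis a_minus_def minus_equality minus_minus r_neg a_inv_closed)

lemma (in abelian_group) minus_add_cancel:
  "\<lbrakk>x \<in> carrier G; y \<in> carrier G\<rbrakk> \<Longrightarrow> x \<ominus> y \<oplus> y = x"
  by (simp add: a_minus_def a_assoc l_neg)

lemma linear_map_inj_on_iff:
  assumes "left_module R M" "left_module R N" "linear_map R M N f"
  shows "inj_on f (carrier M) \<longleftrightarrow> (\<forall>x\<in>carrier M. f x = \<zero>\<^bsub>N\<^esub> \<longrightarrow> x = \<zero>\<^bsub>M\<^esub>)"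
proof -
  interpret M: left_module R M by fact
  interpret N: left_module R N by fact
  have z: "f \<zero>\<^bsub>M\<^esub> = \<zero>\<^bsub>N\<^esub>" by (rule linear_map_zero[OF assms])
  show ?thesis
  proof
    assume "inj_on f (carrier M)"
    with z show "\<forall>x\<in>carrier M. f x = \<zero>\<^bsub>N\<^esub> \<longrightarrow> x = \<zero>\<^bsub>M\<^esub>" by (metis M.zero_closed inj_onD)
  next
    assume *: "\<forall>x\<in>carrier M. f x = \<zero>\<^bsub>N\<^esub> \<longrightarrow> x = \<zero>\<^bsub>M\<^esub>"
    show "inj_on f (carrier M)"
    proof (rule inj_onI)
      fix x y assume xy: "x \<in> carrier M" "y \<in> carrier M" "f x = f y"
      then have "f (x \<ominus>\<^bsub>M\<^esub> y) = \<zero>\<^bsub>N\<^esub>"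
        using assms(3) by (simp add: linear_map_minus[OF assms] linear_map_closed N.M.minus_eq_zero_iff)
      with * xy show "x = y" by (metis M.M.minus_closed M.M.minus_eq_zero_iff)
    qed
  qed
qed

text \<open>\<open>N\<close> is a mere record here: every law is pulled back along the surjection
  \<open>p\<close>. The zero needs a hypothesis of its own because \<open>linear_map\<close> speaks
  of addition and scalars only. Serves quotients and a structure copied onto another type.\<close>

lemma left_module_image:
  assumes "left_module R M" "linear_map R M N p" "p ` carrier M = carrier N"
    and "p \<zero>\<^bsub>M\<^esub> = \<zero>\<^bsub>N\<^esub>"
  shows "left_module R N"
proof -
  interpret M: left_module R M by fact
  have ex: "\<exists>a\<in>carrier M. x = p a" if "x \<in> carrier N" for x
    using assms(3) that by blast
  note p = linear_map_closed[OF assms(2)] linear_map_add[OF assms(2), symmetric]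
    linear_map_smult[OF assms(2), symmetric]
  show ?thesis
  proof (rule left_moduleI)
    show "ring R" by (rule M.R.ring_axioms)
    show "abelian_group N"
    proof (rule abelian_groupI)
      show "\<zero>\<^bsub>N\<^esub> \<in> carrier N" using assms(4) p(1) by (metis M.zero_closed)
    next
      fix x y assume "x \<in> carrier N" "y \<in> carrier N"
      then show "x \<oplus>\<^bsub>N\<^esub> y \<in> carrier N" by (auto dest!: ex simp: p)
    next
      fix x y z assume "x \<in> carrier N" "y \<in> carrier N" "z \<in> carrier N"
      then show "x \<oplus>\<^bsub>N\<^esub> y \<oplus>\<^bsub>N\<^esub> z = x \<oplus>\<^bsub>N\<^esub> (y \<oplus>\<^bsub>N\<^esub> z)"
        by (auto dest!: ex simp: p M.M.a_assoc)
    next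
      fix x y assume "x \<in> carrier N" "y \<in> carrier N"
      then show "x \<oplus>\<^bsub>N\<^esub> y = y \<oplus>\<^bsub>N\<^esub> x" by (auto dest!: ex simp: p M.M.a_comm)
    next
      fix x assume "x \<in> carrier N"
      then show "\<zero>\<^bsub>N\<^esub> \<oplus>\<^bsub>N\<^esub> x = x"
        by (auto dest!: ex simp: p assms(4)[symmetric])
    next
      fix x assume "x \<in> carrier N"
      then obtain a where a: "a \<in> carrier M" "x = p a" using ex by blast
      have "p (\<ominus>\<^bsub>M\<^esub> a) \<oplus>\<^bsub>N\<^esub> x = \<zero>\<^bsub>N\<^esub>"
        using a by (simp add: p assms(4)[symmetric] M.M.l_neg)
      then show "\<exists>y\<in>carrier N. y \<oplus>\<^bsub>N\<^esub> x = \<zero>\<^bsub>N\<^esub>" using a p(1) by (metis M.M.a_inv_closed)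
    qed
  next
    fix a x assume "a \<in> carrier R" "x \<in> carrier N"
    then show "a \<odot>\<^bsub>N\<^esub> x \<in> carrier N" by (auto dest!: ex simp: p)
  next
    fix a b x assume "a \<in> carrier R" "b \<in> carrier R" "x \<in> carrier N"
    then show "(a \<oplus>\<^bsub>R\<^esub> b) \<odot>\<^bsub>N\<^esub> x = a \<odot>\<^bsub>N\<^esub> x \<oplus>\<^bsub>N\<^esub> b \<odot>\<^bsub>N\<^esub> x"
      by (auto dest!: ex simp: p M.smult_l_distr)
  next
    fix a x y assume "a \<in> carrier R" "x \<in> carrier N" "y \<in> carrier N"
    then show "a \<odot>\<^bsub>N\<^esub> (x \<oplus>\<^bsub>N\<^esub> y) = a \<odot>\<^bsub>N\<^esub> x \<oplus>\<^bsub>N\<^esub> a \<odot>\<^bsub>N\<^esub> y"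
      by (auto dest!: ex simp: p M.smult_r_distr)
  next
    fix a b x assume "a \<in> carrier R" "b \<in> carrier R" "x \<in> carrier N"
    then show "(a \<otimes>\<^bsub>R\<^esub> b) \<odot>\<^bsub>N\<^esub> x = a \<odot>\<^bsub>N\<^esub> (b \<odot>\<^bsub>N\<^esub> x)"
      by (auto dest!: ex simp: p M.smult_assoc1)
  next
    fix x assume "x \<in> carrier N"
    then show "\<one>\<^bsub>R\<^esub> \<odot>\<^bsub>N\<^esub> x = x" by (auto dest!: ex simp: p)
  qed
qed

lemma linear_map_factor:
  assumes "left_module R P" "left_module R E" "left_module R E'"
    and p: "linear_map R P E p" "p ` carrier P = carrier E"
    and q: "linear_map R P E' q"
    and ker: "\<And>x. \<lbrakk>x \<in> carrier P; p x = \<zero>\<^bsub>E\<^esub>\<rbrakk> \<Longrightarrow> q x = \<zero>\<^bsub>E'\<^esub>"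
  obtains h where "linear_map R E E' h" "\<And>x. x \<in> carrier P \<Longrightarrow> h (p x) = q x"
proof -
  interpret P: left_module R P by fact
  interpret E: left_module R E by fact
  interpret E': left_module R E' by fact
  \<comment> \<open>The value of \<open>q\<close> at an arbitrary preimage. Two preimages differ by
    an element killed by \<open>p\<close>, hence by \<open>q\<close>.\<close>
  define h where "h = (\<lambda>z. q (SOME x. x \<in> carrier P \<and> p x = z))"
  have h: "h (p x) = q x" if x: "x \<in> carrier P" for x
  proof -
    define y where "y = (SOME y. y \<in> carrier P \<and> p y = p x)"
    have y: "y \<in> carrier P" "p y = p x"
      using someI[of "\<lambda>y. y \<in> carrier P \<and> p y = p x" x] x by (auto simp: y_def)
    have "p (y \<ominus>\<^bsub>P\<^esub> x) = \<zero>\<^bsub>E\<^esub>"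
      using x y p(1) by (simp add: linear_map_minus[OF assms(1,2)] linear_map_closed E.M.minus_eq_zero_iff)
    then have "q (y \<ominus>\<^bsub>P\<^esub> x) = \<zero>\<^bsub>E'\<^esub>" using ker x y by simp
    then have "q y = q x"
      using x y q by (simp add: linear_map_minus[OF assms(1,3)] linear_map_closed E'.M.minus_eq_zero_iff)
    then show ?thesis by (simp add: h_def y_def)
  qed
  have ex: "\<exists>x\<in>carrier P. z = p x" if "z \<in> carrier E" for z using p(2) that by blast
  have "linear_map R E E' h"
  proof (rule linear_mapI)
    fix x assume "x \<in> carrier E"
    then show "h x \<in> carrier E'" using q by (auto dest!: ex simp: h linear_map_closed)
  next
    fix x y assume "x \<in> carrier E" "y \<in> carrier E"
    then show "h (x \<oplus>\<^bsub>E\<^esub> y) = h x \<oplus>\<^bsub>E'\<^esub> h y"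
      using q p by (auto dest!: ex simp: h linear_map_add[OF p(1), symmetric] linear_map_add[OF q])
  next
    fix r x assume "r \<in> carrier R" "x \<in> carrier E"
    then show "h (r \<odot>\<^bsub>E\<^esub> x) = r \<odot>\<^bsub>E'\<^esub> h x"
      using q p by (auto dest!: ex simp: h linear_map_smult[OF p(1), symmetric] linear_map_smult[OF q])
  qed
  then show thesis using h that by blast
qed

lemma linear_map_inverse:
  assumes "left_module R M" "left_module R N" "linear_map R M N f" "bij_betw f (carrier M) (carrier N)"
  obtains g where "linear_map R N M g" "\<And>x. x \<in> carrier M \<Longrightarrow> g (f x) = x"
    "\<And>y. y \<in> carrier N \<Longrightarrow> f (g y) = y"
proof -
  have inj: "\<forall>x\<in>carrier M. f x = \<zero>\<^bsub>N\<^esub> \<longrightarrow> x = \<zero>\<^bsub>M\<^esub>"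
    using assms(4) linear_map_inj_on_iff[OF assms(1-3)] by (simp add: bij_betw_def)
  have im: "f ` carrier M = carrier N" using assms(4) by (simp add: bij_betw_def)
  \<comment> \<open>The inverse is the identity of \<open>M\<close> factored through
    \<open>f\<close>; the kernel condition of the factorization is injectivity.\<close>
  obtain g where g: "linear_map R N M g" "\<And>x. x \<in> carrier M \<Longrightarrow> g (f x) = x"
    using linear_map_factor[OF assms(1,2,1,3) im linear_map_ident] inj by blast
  moreover have "f (g y) = y" if "y \<in> carrier N" for y
    using that g(2) unfolding im[symmetric] by auto
  ultimately show thesis using that by blast
qed

text \<open>Closure under negation comes from multiplication by minus one.\<close>

definition submod :: "('r, 'k) ring_scheme \<Rightarrow> ('r, 'm) module \<Rightarrow> 'm set \<Rightarrow> bool" where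
  "submod R M H \<longleftrightarrow> H \<subseteq> carrier M \<and> \<zero>\<^bsub>M\<^esub> \<in> H \<and> (\<forall>x\<in>H. \<forall>y\<in>H. x \<oplus>\<^bsub>M\<^esub> y \<in> H) \<and>
     (\<forall>r\<in>carrier R. \<forall>x\<in>H. r \<odot>\<^bsub>M\<^esub> x \<in> H)"

text \<open>Only the carrier changes, so the operations of the submodule simplify to those of
  \<open>M\<close>.\<close>

abbreviation sub :: "('r, 'm) module \<Rightarrow> 'm set \<Rightarrow> ('r, 'm) module" where
  "sub M H \<equiv> M\<lparr>carrier := H\<rparr>"

lemma submodI:
  assumes "H \<subseteq> carrier M" "\<zero>\<^bsub>M\<^esub> \<in> H" "\<And>x y. x \<in> H \<Longrightarrow> y \<in> H \<Longrightarrow> x \<oplus>\<^bsub>M\<^esub> y \<in> H"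
    "\<And>r x. r \<in> carrier R \<Longrightarrow> x \<in> H \<Longrightarrow> r \<odot>\<^bsub>M\<^esub> x \<in> H"
  shows "submod R M H"
  using assms by (simp add: submod_def)

lemma submod_subset: "submod R M H \<Longrightarrow> H \<subseteq> carrier M"
  and submod_mem: "submod R M H \<Longrightarrow> x \<in> H \<Longrightarrow> x \<in> carrier M"
  and submod_zero: "submod R M H \<Longrightarrow> \<zero>\<^bsub>M\<^esub> \<in> H"
  and submod_add: "submod R M H \<Longrightarrow> x \<in> H \<Longrightarrow> y \<in> H \<Longrightarrow> x \<oplus>\<^bsub>M\<^esub> y \<in> H"
  and submod_smult: "submod R M H \<Longrightarrow> r \<in> carrier R \<Longrightarrow> x \<in> H \<Longrightarrow> r \<odot>\<^bsub>M\<^esub> x \<in> H"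
  by (auto simp: submod_def)

lemma submod_uminus:
  assumes "left_module R M" "submod R M H" "x \<in> H" shows "\<ominus>\<^bsub>M\<^esub> x \<in> H"
proof -
  interpret M: left_module R M by fact
  show ?thesis using assms(2,3)
    by (metis M.R.add.inv_closed M.R.one_closed M.smult_uminus_one submod_mem submod_smult)
qed

lemma submod_minus:
  assumes "left_module R M" "submod R M H" "x \<in> H" "y \<in> H" shows "x \<ominus>\<^bsub>M\<^esub> y \<in> H"
  using assms by (simp add: a_minus_def submod_add submod_uminus)

lemma left_module_sub:
  assumes "left_module R M" "submod R M H" shows "left_module R (sub M H)"
proof -
  interpret M: left_module R M by fact
  note mem = submod_mem[OF assms(2)]
  show ?thesis
  proof (rule left_moduleI[OF M.R.ring_axioms])
    show "abelian_group (sub M H)"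
    proof (rule abelian_groupI)
      fix x assume "x \<in> carrier (sub M H)"
      then show "\<exists>y\<in>carrier (sub M H). y \<oplus>\<^bsub>sub M H\<^esub> x = \<zero>\<^bsub>sub M H\<^esub>"
        using submod_uminus[OF assms] mem by (auto intro!: bexI[of _ "\<ominus>\<^bsub>M\<^esub> x"] simp: M.M.l_neg)
    qed (use assms(2) mem in \<open>auto simp: submod_def M.M.a_ac\<close>)
  qed (use assms(2) mem in \<open>auto simp: submod_def M.smult_l_distr M.smult_r_distr M.smult_assoc1\<close>)
qed

lemma linear_map_to_sub:
  "linear_map R L (sub M H) f \<longleftrightarrow> linear_map R L M f \<and> f ` carrier L \<subseteq> H"
  if "H \<subseteq> carrier M"
  using that by (auto simp: linear_map_def)

lemma linear_map_restrict:
  "linear_map R M N f \<Longrightarrow> submod R M H \<Longrightarrow> linear_map R (sub M H) N f"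
  by (intro linear_mapI) (simp_all add: linear_map_closed linear_map_add linear_map_smult submod_mem)

lemma submod_vimage:
  assumes "left_module R M" "left_module R N" "linear_map R M N f" "submod R N H"
  shows "submod R M {x \<in> carrier M. f x \<in> H}"
proof -
  interpret M: left_module R M by fact
  show ?thesis using assms
    by (intro submodI)
      (auto simp: linear_map_add linear_map_smult submod_add submod_smult
        linear_map_zero[OF assms(1-3)] submod_zero)
qed

lemma submod_singleton_zero: "left_module R M \<Longrightarrow> submod R M {\<zero>\<^bsub>M\<^esub>}"
proof -
  assume "left_module R M"
  then interpret M: left_module R M .
  show ?thesis by (rule submodI) auto
qed

lemma submod_kernel:
  assumes "left_module R M" "left_module R N" "linear_map R M N f"
  shows "submod R M {x \<in> carrier M. f x = \<zero>\<^bsub>N\<^esub>}"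
  using submod_vimage[OF assms submod_singleton_zero[OF assms(2)]] by simp

lemma submod_image:
  assumes "left_module R M" "left_module R N" "linear_map R M N f" "submod R M H"
  shows "submod R N (f ` H)"
proof (rule submodI)
  show "f ` H \<subseteq> carrier N" using assms by (auto simp: linear_map_closed submod_mem)
  show "\<zero>\<^bsub>N\<^esub> \<in> f ` H" using linear_map_zero[OF assms(1-3)] submod_zero[OF assms(4)] by (metis imageI)
  show "x \<oplus>\<^bsub>N\<^esub> y \<in> f ` H" if "x \<in> f ` H" "y \<in> f ` H" for x y
    using that submod_add[OF assms(4)] submod_mem[OF assms(4)]
    by (auto simp: linear_map_add[OF assms(3), symmetric])
  show "r \<odot>\<^bsub>N\<^esub> x \<in> f ` H" if "r \<in> carrier R" "x \<in> f ` H" for r x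
    using that submod_smult[OF assms(4)] submod_mem[OF assms(4)]
    by (auto simp: linear_map_smult[OF assms(3), symmetric])
qed

lemma submod_carrier: "left_module R M \<Longrightarrow> submod R M (carrier M)"
proof -
  assume "left_module R M"
  then interpret M: left_module R M .
  show ?thesis by (rule submodI) auto
qed

section \<open>Products, direct sums and free modules\<close>

lemma (in abelian_group) uminus_zero: "\<ominus> \<zero> = \<zero>"
  by (simp add: minus_equality)

lemma (in left_module) finsum_smult:
  assumes "r \<in> carrier R" "g \<in> F \<rightarrow> carrier M"
  shows "r \<odot>\<^bsub>M\<^esub> (\<Oplus>\<^bsub>M\<^esub>i\<in>F. g i) = (\<Oplus>\<^bsub>M\<^esub>i\<in>F. r \<odot>\<^bsub>M\<^esub> g i)"
proof (cases "finite F")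
  case True
  then show ?thesis using assms(2)
  proof (induction F)
    case empty
    show ?case using assms(1) by simp
  next
    case (insert i F)
    then have "g i \<in> carrier M" "g \<in> F \<rightarrow> carrier M" "(\<lambda>i. r \<odot>\<^bsub>M\<^esub> g i) \<in> F \<rightarrow> carrier M"
      using assms(1) by (auto simp: Pi_def)
    with insert assms(1) show ?case
      by (simp add: M.finsum_insert smult_r_distr M.finsum_closed)
  qed
next
  case False
  then show ?thesis using assms(1) by (simp add: M.finsum_infinite)
qed

lemma prod_module_simps [simp]:
  "carrier (prod_module M N) = carrier M \<times> carrier N"
  "\<zero>\<^bsub>prod_module M N\<^esub> = (\<zero>\<^bsub>M\<^esub>, \<zero>\<^bsub>N\<^esub>)"
  "(x, y) \<oplus>\<^bsub>prod_module M N\<^esub> (x', y') = (x \<oplus>\<^bsub>M\<^esub> x', y \<oplus>\<^bsub>N\<^esub> y')"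
  "r \<odot>\<^bsub>prod_module M N\<^esub> (x, y) = (r \<odot>\<^bsub>M\<^esub> x, r \<odot>\<^bsub>N\<^esub> y)"
  by (simp_all add: prod_module_def)

lemma left_module_prod:
  assumes "left_module R M" "left_module R N"
  shows "left_module R (prod_module M N)"
proof -
  interpret M: left_module R M by fact
  interpret N: left_module R N by fact
  show ?thesis
  proof (rule left_moduleI[OF M.R.ring_axioms])
    show "abelian_group (prod_module M N)"
    proof (rule abelian_groupI)
      fix z assume "z \<in> carrier (prod_module M N)"
      then show "\<exists>w\<in>carrier (prod_module M N). w \<oplus>\<^bsub>prod_module M N\<^esub> z = \<zero>\<^bsub>prod_module M N\<^esub>"
        by (intro bexI[of _ "(\<ominus>\<^bsub>M\<^esub> fst z, \<ominus>\<^bsub>N\<^esub> snd z)"]) (auto simp: M.M.l_neg N.M.l_neg)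
    qed (auto simp: M.M.a_ac N.M.a_ac)
  qed (auto simp: M.smult_l_distr M.smult_r_distr M.smult_assoc1
      N.smult_l_distr N.smult_r_distr N.smult_assoc1)
qed

lemma linear_map_fst: "linear_map R (prod_module M N) M fst"
  and linear_map_snd: "linear_map R (prod_module M N) N snd"
  by (auto intro!: linear_mapI)

lemma linear_map_pair:
  "linear_map R L M f \<Longrightarrow> linear_map R L N g \<Longrightarrow> linear_map R L (prod_module M N) (\<lambda>x. (f x, g x))"
  by (intro linear_mapI) (simp_all add: linear_map_closed linear_map_add linear_map_smult)

lemma linear_map_pairI:
  assumes "left_module R L" "linear_map R M L f" "linear_map R N L g"
  shows "linear_map R (prod_module M N) L (\<lambda>z. f (fst z) \<oplus>\<^bsub>L\<^esub> g (snd z))"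
  by (intro linear_map_plus assms(1) linear_map_comp[OF linear_map_fst assms(2)]
      linear_map_comp[OF linear_map_snd assms(3)])

lemma direct_sum_carrier:
  "x \<in> carrier (direct_sum I M) \<longleftrightarrow>
     x \<in> (\<Pi>\<^sub>E i\<in>I. carrier (M i)) \<and> finite {i \<in> I. x i \<noteq> \<zero>\<^bsub>M i\<^esub>}"
  by (simp add: direct_sum_def)

lemma direct_sum_simps [simp]:
  "\<zero>\<^bsub>direct_sum I M\<^esub> = (\<lambda>i\<in>I. \<zero>\<^bsub>M i\<^esub>)"
  "x \<oplus>\<^bsub>direct_sum I M\<^esub> y = (\<lambda>i\<in>I. x i \<oplus>\<^bsub>M i\<^esub> y i)"
  "r \<odot>\<^bsub>direct_sum I M\<^esub> x = (\<lambda>i\<in>I. r \<odot>\<^bsub>M i\<^esub> x i)"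
  by (simp_all add: direct_sum_def)

lemma direct_sum_memI:
  assumes "\<And>i. i \<in> I \<Longrightarrow> f i \<in> carrier (M i)" "finite F" "\<And>i. i \<in> I \<Longrightarrow> i \<notin> F \<Longrightarrow> f i = \<zero>\<^bsub>M i\<^esub>"
  shows "(\<lambda>i\<in>I. f i) \<in> carrier (direct_sum I M)"
proof -
  have "{i \<in> I. (\<lambda>i\<in>I. f i) i \<noteq> \<zero>\<^bsub>M i\<^esub>} \<subseteq> F" using assms(3) by auto
  then have "finite {i \<in> I. (\<lambda>i\<in>I. f i) i \<noteq> \<zero>\<^bsub>M i\<^esub>}" using assms(2) by (rule finite_subset)
  moreover have "(\<lambda>i\<in>I. f i) \<in> (\<Pi>\<^sub>E i\<in>I. carrier (M i))" using assms(1) by auto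
  ultimately show ?thesis unfolding direct_sum_carrier by blast
qed

lemma direct_sum_eqI:
  assumes "x \<in> carrier (direct_sum I M)" "y \<in> carrier (direct_sum I M)" "\<And>i. i \<in> I \<Longrightarrow> x i = y i"
  shows "x = y"
  using assms by (auto simp: direct_sum_carrier intro: PiE_ext)

lemma direct_sum_proj:
  "x \<in> carrier (direct_sum I M) \<Longrightarrow> i \<in> I \<Longrightarrow> x i \<in> carrier (M i)"
  by (auto simp: direct_sum_carrier)

lemma linear_map_proj: "i \<in> I \<Longrightarrow> linear_map R (direct_sum I M) (M i) (\<lambda>x. x i)"
  by (rule linear_mapI) (auto simp: direct_sum_proj)

lemma left_module_direct_sum:
  assumes "ring R" "\<And>i. i \<in> I \<Longrightarrow> left_module R (M i)"
  shows "left_module R (direct_sum I M)"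
proof -
  have ag: "abelian_group (M i)" if "i \<in> I" for i using assms(2)[OF that] by (rule left_module_group)
  have am: "abelian_monoid (M i)" if "i \<in> I" for i using ag[OF that] by (rule abelian_group.axioms)
  let ?D = "direct_sum I M"
  have supp: "(\<lambda>i\<in>I. f i) \<in> carrier ?D"
    if "\<And>i. i \<in> I \<Longrightarrow> f i \<in> carrier (M i)" "x \<in> carrier ?D" "y \<in> carrier ?D"
       "\<And>i. i \<in> I \<Longrightarrow> x i = \<zero>\<^bsub>M i\<^esub> \<Longrightarrow> y i = \<zero>\<^bsub>M i\<^esub> \<Longrightarrow> f i = \<zero>\<^bsub>M i\<^esub>" for f x y
    using that by (intro direct_sum_memI[where F = "{i \<in> I. x i \<noteq> \<zero>\<^bsub>M i\<^esub>} \<union> {i \<in> I. y i \<noteq> \<zero>\<^bsub>M i\<^esub>}"])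
      (auto simp: direct_sum_carrier)
  have zero: "\<zero>\<^bsub>?D\<^esub> \<in> carrier ?D"
    unfolding direct_sum_simps
    by (rule direct_sum_memI[where F = "{}"]) (auto intro: abelian_monoid.zero_closed am)
  have add: "x \<oplus>\<^bsub>?D\<^esub> y \<in> carrier ?D" if "x \<in> carrier ?D" "y \<in> carrier ?D" for x y
    unfolding direct_sum_simps
    by (rule supp[OF _ that])
      (use that in \<open>auto simp: direct_sum_proj abelian_monoid.l_zero[OF am] abelian_monoid.zero_closed[OF am]
        intro!: abelian_monoid.a_closed am\<close>)
  have smult: "r \<odot>\<^bsub>?D\<^esub> x \<in> carrier ?D" if "r \<in> carrier R" "x \<in> carrier ?D" for r x
    unfolding direct_sum_simps
    by (rule supp[OF _ that(2,2)])
      (use that in \<open>auto simp: direct_sum_proj left_module.smult_zero[OF assms(2)]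
        intro!: left_module.smult_closed assms(2)\<close>)
  have uminus: "(\<lambda>i\<in>I. \<ominus>\<^bsub>M i\<^esub> x i) \<in> carrier ?D" if "x \<in> carrier ?D" for x
    by (rule supp[OF _ that that])
      (use that in \<open>auto simp: direct_sum_proj abelian_group.uminus_zero[OF ag]
        intro!: abelian_group.a_inv_closed ag\<close>)
  show ?thesis
  proof (rule left_moduleI[OF assms(1)])
    show "abelian_group ?D"
    proof (rule abelian_groupI)
      fix x y z assume xyz: "x \<in> carrier ?D" "y \<in> carrier ?D" "z \<in> carrier ?D"
      show "x \<oplus>\<^bsub>?D\<^esub> y \<oplus>\<^bsub>?D\<^esub> z = x \<oplus>\<^bsub>?D\<^esub> (y \<oplus>\<^bsub>?D\<^esub> z)"
        by (rule direct_sum_eqI) (use xyz in \<open>auto simp del: direct_sum_simps intro!: add,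
            auto simp: direct_sum_proj abelian_monoid.a_assoc[OF am]\<close>)
    next
      fix x y assume xy: "x \<in> carrier ?D" "y \<in> carrier ?D"
      show "x \<oplus>\<^bsub>?D\<^esub> y = y \<oplus>\<^bsub>?D\<^esub> x"
        by (rule direct_sum_eqI) (use xy in \<open>auto simp del: direct_sum_simps intro!: add,
            auto simp: direct_sum_proj abelian_monoid.a_comm[OF am]\<close>)
    next
      fix x assume x: "x \<in> carrier ?D"
      show "\<zero>\<^bsub>?D\<^esub> \<oplus>\<^bsub>?D\<^esub> x = x"
        by (rule direct_sum_eqI) (use x zero in \<open>auto simp del: direct_sum_simps intro!: add,
            auto simp: direct_sum_proj abelian_monoid.l_zero[OF am]\<close>)
      have "(\<lambda>i\<in>I. \<ominus>\<^bsub>M i\<^esub> x i) \<oplus>\<^bsub>?D\<^esub> x = \<zero>\<^bsub>?D\<^esub>"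
        by (rule direct_sum_eqI) (use x zero uminus[OF x] in \<open>auto simp del: direct_sum_simps intro!: add,
            auto simp: direct_sum_proj abelian_group.l_neg[OF ag]\<close>)
      then show "\<exists>y\<in>carrier ?D. y \<oplus>\<^bsub>?D\<^esub> x = \<zero>\<^bsub>?D\<^esub>" using uminus[OF x] by blast
    qed (fact add zero)+
  next
    fix a b x assume "a \<in> carrier R" "b \<in> carrier R" "x \<in> carrier ?D"
    then show "(a \<oplus>\<^bsub>R\<^esub> b) \<odot>\<^bsub>?D\<^esub> x = a \<odot>\<^bsub>?D\<^esub> x \<oplus>\<^bsub>?D\<^esub> b \<odot>\<^bsub>?D\<^esub> x"
      by (auto simp: direct_sum_proj left_module.smult_l_distr[OF assms(2)] intro!: restrict_ext)
  next
    fix a x y assume "a \<in> carrier R" "x \<in> carrier ?D" "y \<in> carrier ?D"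
    then show "a \<odot>\<^bsub>?D\<^esub> (x \<oplus>\<^bsub>?D\<^esub> y) = a \<odot>\<^bsub>?D\<^esub> x \<oplus>\<^bsub>?D\<^esub> a \<odot>\<^bsub>?D\<^esub> y"
      by (auto simp: direct_sum_proj left_module.smult_r_distr[OF assms(2)] intro!: restrict_ext)
  next
    fix a b x assume "a \<in> carrier R" "b \<in> carrier R" "x \<in> carrier ?D"
    then show "(a \<otimes>\<^bsub>R\<^esub> b) \<odot>\<^bsub>?D\<^esub> x = a \<odot>\<^bsub>?D\<^esub> (b \<odot>\<^bsub>?D\<^esub> x)"
      by (auto simp: direct_sum_proj left_module.smult_assoc1[OF assms(2)] intro!: restrict_ext)
  next
    fix x assume x: "x \<in> carrier ?D"
    show "\<one>\<^bsub>R\<^esub> \<odot>\<^bsub>?D\<^esub> x = x"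
      by (rule direct_sum_eqI) (use x ring.ring_simprules(6)[OF assms(1)] in \<open>auto simp del: direct_sum_simps intro!: smult,
            auto simp: direct_sum_proj left_module.smult_one[OF assms(2)]\<close>)
  qed (fact smult)
qed

text \<open>The canonical injection of a summand, restricted to \<open>I\<close> because elements of
  \<open>direct_sum\<close> are extensional.\<close>

definition ds_in :: "'i set \<Rightarrow> ('i \<Rightarrow> ('r, 'm) module) \<Rightarrow> 'i \<Rightarrow> 'm \<Rightarrow> 'i \<Rightarrow> 'm" where
  "ds_in I M i x = (\<lambda>j\<in>I. if j = i then x else \<zero>\<^bsub>M j\<^esub>)"

lemma linear_map_ds_in:
  assumes "ring R" "\<And>i. i \<in> I \<Longrightarrow> left_module R (M i)" "i \<in> I"
  shows "linear_map R (M i) (direct_sum I M) (ds_in I M i)"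
proof -
  have am: "abelian_monoid (M i)" if "i \<in> I" for i
    using left_module_group[OF assms(2)[OF that]] by (rule abelian_group.axioms)
  show ?thesis
  proof (rule linear_mapI)
    fix x assume "x \<in> carrier (M i)"
    then show "ds_in I M i x \<in> carrier (direct_sum I M)"
      unfolding ds_in_def
      by (intro direct_sum_memI[where F = "{i}"]) (auto intro: abelian_monoid.zero_closed am)
  next
    fix x y assume "x \<in> carrier (M i)" "y \<in> carrier (M i)"
    then show "ds_in I M i (x \<oplus>\<^bsub>M i\<^esub> y) = ds_in I M i x \<oplus>\<^bsub>direct_sum I M\<^esub> ds_in I M i y"
      by (auto simp: ds_in_def abelian_monoid.l_zero[OF am] abelian_monoid.zero_closed[OF am]
          intro!: restrict_ext)
  next
    fix r x assume "r \<in> carrier R" "x \<in> carrier (M i)"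
    then show "ds_in I M i (r \<odot>\<^bsub>M i\<^esub> x) = r \<odot>\<^bsub>direct_sum I M\<^esub> ds_in I M i x"
      by (auto simp: ds_in_def left_module.smult_zero[OF assms(2)] intro!: restrict_ext)
  qed
qed

lemma direct_sum_induct:
  assumes "ring R" and M: "\<And>i. i \<in> I \<Longrightarrow> left_module R (M i)" and x: "x \<in> carrier (direct_sum I M)"
    and H: "submod R (direct_sum I M) H"
    and "\<And>i y. \<lbrakk>i \<in> I; y \<in> carrier (M i)\<rbrakk> \<Longrightarrow> ds_in I M i y \<in> H"
  shows "x \<in> H"
proof -
  let ?D = "direct_sum I M"
  interpret D: left_module R ?D by (rule left_module_direct_sum[OF assms(1) M])
  \<comment> \<open>The induction runs over a finite set containing the support rather than over the
    support itself: subtracting the component at \<open>j\<close> only has to make the remaining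
    support fit into \<open>F\<close>.\<close>
  have "finite F \<Longrightarrow> \<forall>x\<in>carrier ?D. {i \<in> I. x i \<noteq> \<zero>\<^bsub>M i\<^esub>} \<subseteq> F \<longrightarrow> x \<in> H" for F
  proof (induction F rule: finite_induct)
    case empty
    show ?case
    proof (intro ballI impI)
      fix x assume x: "x \<in> carrier ?D" "{i \<in> I. x i \<noteq> \<zero>\<^bsub>M i\<^esub>} \<subseteq> {}"
      then have "x = \<zero>\<^bsub>?D\<^esub>"
        using D.M.zero_closed by (intro direct_sum_eqI[of x I M]) auto
      then show "x \<in> H" using submod_zero[OF H] by simp
    qed
  next
    case (insert j F)
    show ?case
    proof (intro ballI impI)
      fix x assume x: "x \<in> carrier ?D" "{i \<in> I. x i \<noteq> \<zero>\<^bsub>M i\<^esub>} \<subseteq> insert j F"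
      show "x \<in> H"
      proof (cases "j \<in> I")
        case False
        with x insert show ?thesis by blast
      next
        case True
        interpret Mj: left_module R "M j" by (rule M[OF True])
        define d where "d = ds_in I M j (x j)"
        have d: "d \<in> carrier ?D" "d \<in> H"
          using True x(1) assms(5) linear_map_closed[OF linear_map_ds_in[where M = M, OF assms(1) M True]]
          by (auto simp: d_def direct_sum_proj)
        have "x \<ominus>\<^bsub>?D\<^esub> d \<in> H"
        proof (rule insert.IH[rule_format])
          show "x \<ominus>\<^bsub>?D\<^esub> d \<in> carrier ?D" using x(1) d by simp
          have *: "(x \<ominus>\<^bsub>?D\<^esub> d) i = x i \<ominus>\<^bsub>M i\<^esub> d i" if "i \<in> I" for i
            using linear_map_minus[OF D.left_module_axioms M[OF that] linear_map_proj[OF that] x(1) d(1)]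
            by simp
          show "{i \<in> I. (x \<ominus>\<^bsub>?D\<^esub> d) i \<noteq> \<zero>\<^bsub>M i\<^esub>} \<subseteq> F"
          proof (intro subsetI, clarify)
            fix i assume i: "i \<in> I" "(x \<ominus>\<^bsub>?D\<^esub> d) i \<noteq> \<zero>\<^bsub>M i\<^esub>"
            interpret Mi: left_module R "M i" by (rule M[OF i(1)])
            have xi: "x i \<in> carrier (M i)" using x(1) i(1) by (rule direct_sum_proj)
            have di: "d i = (if i = j then x i else \<zero>\<^bsub>M i\<^esub>)" using i(1) by (simp add: d_def ds_in_def)
            have "i \<noteq> j"
              using i *[OF i(1)] di Mi.M.minus_eq_zero_iff[OF xi xi] by auto
            moreover have "x i \<noteq> \<zero>\<^bsub>M i\<^esub>"
              using i xi \<open>i \<noteq> j\<close> *[OF i(1)] di by (auto simp: Mi.M.minus_eq_zero_iff)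
            ultimately show "i \<in> F" using x(2) i(1) by blast
          qed
        qed
        then have "(x \<ominus>\<^bsub>?D\<^esub> d) \<oplus>\<^bsub>?D\<^esub> d \<in> H" using d H by (blast intro: submod_add)
        moreover have "(x \<ominus>\<^bsub>?D\<^esub> d) \<oplus>\<^bsub>?D\<^esub> d = x" using x(1) d by (intro D.M.minus_add_cancel)
        ultimately show ?thesis by (simp only:)
      qed
    qed
  qed
  with x show ?thesis by (auto simp: direct_sum_carrier)
qed

lemma direct_sum_map_ext:
  assumes "ring R" and M: "\<And>i. i \<in> I \<Longrightarrow> left_module R (M i)" and N: "left_module R N"
    and f: "linear_map R (direct_sum I M) N f" and g: "linear_map R (direct_sum I M) N g"
    and eq: "\<And>i y. \<lbrakk>i \<in> I; y \<in> carrier (M i)\<rbrakk> \<Longrightarrow> f (ds_in I M i y) = g (ds_in I M i y)"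
    and x: "x \<in> carrier (direct_sum I M)"
  shows "f x = g x"
proof -
  let ?D = "direct_sum I M"
  interpret N: left_module R N by fact
  have D: "left_module R ?D" by (rule left_module_direct_sum[OF assms(1) M])
  have "x \<in> {x \<in> carrier ?D. f x \<ominus>\<^bsub>N\<^esub> g x = \<zero>\<^bsub>N\<^esub>}"
  proof (rule direct_sum_induct[OF assms(1) M x])
    show "submod R ?D {x \<in> carrier ?D. f x \<ominus>\<^bsub>N\<^esub> g x = \<zero>\<^bsub>N\<^esub>}"
      by (rule submod_kernel[OF D N linear_map_diff[OF N f g]])
    show "ds_in I M i y \<in> {x \<in> carrier ?D. f x \<ominus>\<^bsub>N\<^esub> g x = \<zero>\<^bsub>N\<^esub>}" if "i \<in> I" "y \<in> carrier (M i)" for i y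
      using linear_map_closed[OF linear_map_ds_in[where M = M, OF assms(1) M that(1)] that(2)] eq[OF that] g
      by (simp add: N.M.minus_eq_zero_iff linear_map_closed)
  qed
  then show ?thesis using x f g by (simp add: N.M.minus_eq_zero_iff linear_map_closed)
qed

text \<open>The support of a sum or multiple need not be determined by the supports of its parts.
  Enlarging all supports to one finite \<open>F\<close> allows termwise comparison.\<close>

lemma direct_sum_finsum_support:
  assumes N: "left_module R N"
    and g: "\<And>i. i \<in> I \<Longrightarrow> g i \<in> carrier (M i) \<rightarrow> carrier N" "\<And>i. i \<in> I \<Longrightarrow> g i \<zero>\<^bsub>M i\<^esub> = \<zero>\<^bsub>N\<^esub>"
    and x: "x \<in> carrier (direct_sum I M)"
    and F: "finite F" "F \<subseteq> I" "{i \<in> I. x i \<noteq> \<zero>\<^bsub>M i\<^esub>} \<subseteq> F"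
  shows "(\<Oplus>\<^bsub>N\<^esub>i\<in>{i \<in> I. x i \<noteq> \<zero>\<^bsub>M i\<^esub>}. g i (x i)) = (\<Oplus>\<^bsub>N\<^esub>i\<in>F. g i (x i))"
proof -
  interpret N: left_module R N by fact
  show ?thesis
  proof (rule N.M.add.finprod_mono_neutral_cong_left[OF F(1,3)])
    show "g i (x i) = \<zero>\<^bsub>N\<^esub>" if "i \<in> F - {i \<in> I. x i \<noteq> \<zero>\<^bsub>M i\<^esub>}" for i
      using that F(2) g(2)[of i] by auto
    show "(\<lambda>i. g i (x i)) \<in> F \<rightarrow> carrier N"
      using F(2) g(1) direct_sum_proj[OF x] by blast
  qed simp
qed

text \<open>The universal map is given by its formula and not merely asserted to exist, because
  \<open>summation_map\<close> is this formula for identity maps.\<close>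

lemma linear_map_direct_sum:
  assumes "ring R" and M: "\<And>i. i \<in> I \<Longrightarrow> left_module R (M i)" and N: "left_module R N"
    and g: "\<And>i. i \<in> I \<Longrightarrow> linear_map R (M i) N (g i)"
  shows "linear_map R (direct_sum I M) N (\<lambda>x. \<Oplus>\<^bsub>N\<^esub>i\<in>{i \<in> I. x i \<noteq> \<zero>\<^bsub>M i\<^esub>}. g i (x i))" (is ?lin)
    and "\<And>i y. \<lbrakk>i \<in> I; y \<in> carrier (M i)\<rbrakk> \<Longrightarrow>
      (\<Oplus>\<^bsub>N\<^esub>j\<in>{j \<in> I. ds_in I M i y j \<noteq> \<zero>\<^bsub>M j\<^esub>}. g j (ds_in I M i y j)) = g i y"
proof -
  let ?D = "direct_sum I M"
  interpret N: left_module R N by fact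
  interpret D: left_module R ?D by (rule left_module_direct_sum[OF assms(1) M])
  have gz: "g i \<zero>\<^bsub>M i\<^esub> = \<zero>\<^bsub>N\<^esub>" if "i \<in> I" for i
    using that by (intro linear_map_zero[OF M N g])
  have gc: "g i \<in> carrier (M i) \<rightarrow> carrier N" if "i \<in> I" for i
    using g[OF that] by (simp add: linear_map_def)
  note supp = direct_sum_finsum_support[where M = M and I = I and g = g, OF N gc gz]
  show ?lin
  proof (rule linear_mapI)
    fix x assume x: "x \<in> carrier ?D"
    show "(\<Oplus>\<^bsub>N\<^esub>i\<in>{i \<in> I. x i \<noteq> \<zero>\<^bsub>M i\<^esub>}. g i (x i)) \<in> carrier N"
      using gc direct_sum_proj[OF x] by (intro N.M.finsum_closed) blast
  next
    fix x y assume xy: "x \<in> carrier ?D" "y \<in> carrier ?D"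
    let ?S = "\<lambda>x. {i \<in> I. x i \<noteq> \<zero>\<^bsub>M i\<^esub>}"
    let ?F = "?S x \<union> ?S y \<union> ?S (x \<oplus>\<^bsub>?D\<^esub> y)"
    have xyc: "x \<oplus>\<^bsub>?D\<^esub> y \<in> carrier ?D" using xy by (rule D.M.a_closed)
    have F: "finite ?F" "?F \<subseteq> I" "?S x \<subseteq> ?F" "?S y \<subseteq> ?F" "?S (x \<oplus>\<^bsub>?D\<^esub> y) \<subseteq> ?F"
      using xy xyc unfolding direct_sum_carrier by auto
    have mem: "(\<lambda>i. g i (z i)) \<in> ?F \<rightarrow> carrier N" if "z \<in> carrier ?D" for z
      using gc direct_sum_proj[OF that] F(2) by blast
    have "(\<Oplus>\<^bsub>N\<^esub>i\<in>?S (x \<oplus>\<^bsub>?D\<^esub> y). g i ((x \<oplus>\<^bsub>?D\<^esub> y) i)) = (\<Oplus>\<^bsub>N\<^esub>i\<in>?F. g i ((x \<oplus>\<^bsub>?D\<^esub> y) i))"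
      by (rule supp[OF _ _ xyc F(1,2,5)]) auto
    also have "\<dots> = (\<Oplus>\<^bsub>N\<^esub>i\<in>?F. g i (x i) \<oplus>\<^bsub>N\<^esub> g i (y i))"
    proof (rule N.M.finsum_cong')
      show "(\<lambda>i. g i (x i) \<oplus>\<^bsub>N\<^esub> g i (y i)) \<in> ?F \<rightarrow> carrier N"
        using mem[OF xy(1)] mem[OF xy(2)] by (auto simp: Pi_def)
      fix i assume "i \<in> ?F"
      then have "i \<in> I" using F(2) by blast
      then show "g i ((x \<oplus>\<^bsub>?D\<^esub> y) i) = g i (x i) \<oplus>\<^bsub>N\<^esub> g i (y i)"
        using linear_map_add[OF g] xy by (simp add: direct_sum_proj)
    qed simp
    also have "\<dots> = (\<Oplus>\<^bsub>N\<^esub>i\<in>?F. g i (x i)) \<oplus>\<^bsub>N\<^esub> (\<Oplus>\<^bsub>N\<^esub>i\<in>?F. g i (y i))"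
      by (rule N.M.finsum_addf[OF mem[OF xy(1)] mem[OF xy(2)]])
    also have "(\<Oplus>\<^bsub>N\<^esub>i\<in>?F. g i (x i)) = (\<Oplus>\<^bsub>N\<^esub>i\<in>?S x. g i (x i))"
      by (rule supp[OF _ _ xy(1) F(1,2,3), symmetric]) auto
    also have "(\<Oplus>\<^bsub>N\<^esub>i\<in>?F. g i (y i)) = (\<Oplus>\<^bsub>N\<^esub>i\<in>?S y. g i (y i))"
      by (rule supp[OF _ _ xy(2) F(1,2,4), symmetric]) auto
    finally show "(\<Oplus>\<^bsub>N\<^esub>i\<in>?S (x \<oplus>\<^bsub>?D\<^esub> y). g i ((x \<oplus>\<^bsub>?D\<^esub> y) i)) =
      (\<Oplus>\<^bsub>N\<^esub>i\<in>?S x. g i (x i)) \<oplus>\<^bsub>N\<^esub> (\<Oplus>\<^bsub>N\<^esub>i\<in>?S y. g i (y i))" .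
  next
    fix r x assume r: "r \<in> carrier R" and x: "x \<in> carrier ?D"
    let ?S = "\<lambda>x. {i \<in> I. x i \<noteq> \<zero>\<^bsub>M i\<^esub>}"
    let ?F = "?S x \<union> ?S (r \<odot>\<^bsub>?D\<^esub> x)"
    have rxc: "r \<odot>\<^bsub>?D\<^esub> x \<in> carrier ?D" using r x by (rule D.smult_closed)
    have F: "finite ?F" "?F \<subseteq> I" "?S x \<subseteq> ?F" "?S (r \<odot>\<^bsub>?D\<^esub> x) \<subseteq> ?F"
      using x rxc unfolding direct_sum_carrier by auto
    have mem: "(\<lambda>i. g i (z i)) \<in> ?F \<rightarrow> carrier N" if "z \<in> carrier ?D" for z
      using gc direct_sum_proj[OF that] F(2) by blast
    have "(\<Oplus>\<^bsub>N\<^esub>i\<in>?S (r \<odot>\<^bsub>?D\<^esub> x). g i ((r \<odot>\<^bsub>?D\<^esub> x) i)) = (\<Oplus>\<^bsub>N\<^esub>i\<in>?F. g i ((r \<odot>\<^bsub>?D\<^esub> x) i))"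
      by (rule supp[OF _ _ rxc F(1,2,4)]) auto
    also have "\<dots> = (\<Oplus>\<^bsub>N\<^esub>i\<in>?F. r \<odot>\<^bsub>N\<^esub> g i (x i))"
    proof (rule N.M.finsum_cong')
      show "(\<lambda>i. r \<odot>\<^bsub>N\<^esub> g i (x i)) \<in> ?F \<rightarrow> carrier N"
        using mem[OF x] r by (auto simp: Pi_def)
      fix i assume "i \<in> ?F"
      then have "i \<in> I" using F(2) by blast
      then show "g i ((r \<odot>\<^bsub>?D\<^esub> x) i) = r \<odot>\<^bsub>N\<^esub> g i (x i)"
        using linear_map_smult[OF g r] x by (simp add: direct_sum_proj)
    qed simp
    also have "\<dots> = r \<odot>\<^bsub>N\<^esub> (\<Oplus>\<^bsub>N\<^esub>i\<in>?F. g i (x i))"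
      by (rule N.finsum_smult[OF r mem[OF x], symmetric])
    also have "(\<Oplus>\<^bsub>N\<^esub>i\<in>?F. g i (x i)) = (\<Oplus>\<^bsub>N\<^esub>i\<in>?S x. g i (x i))"
      by (rule supp[OF _ _ x F(1,2,3), symmetric]) auto
    finally show "(\<Oplus>\<^bsub>N\<^esub>i\<in>?S (r \<odot>\<^bsub>?D\<^esub> x). g i ((r \<odot>\<^bsub>?D\<^esub> x) i)) = r \<odot>\<^bsub>N\<^esub> (\<Oplus>\<^bsub>N\<^esub>i\<in>?S x. g i (x i))" .
  qed
  fix i y assume i: "i \<in> I" and y: "y \<in> carrier (M i)"
  have d: "ds_in I M i y \<in> carrier ?D" by (rule linear_map_closed[OF linear_map_ds_in[where M = M, OF assms(1) M i] y])
  have "(\<Oplus>\<^bsub>N\<^esub>j\<in>{j \<in> I. ds_in I M i y j \<noteq> \<zero>\<^bsub>M j\<^esub>}. g j (ds_in I M i y j)) =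
      (\<Oplus>\<^bsub>N\<^esub>j\<in>{i}. g j (ds_in I M i y j))"
    by (rule supp[OF _ _ d]) (use i in \<open>auto simp: ds_in_def\<close>)
  also have "\<dots> = g i y"
    using i y gc by (subst N.M.finsum_insert) (auto simp: ds_in_def Pi_def)
  finally show "(\<Oplus>\<^bsub>N\<^esub>j\<in>{j \<in> I. ds_in I M i y j \<noteq> \<zero>\<^bsub>M j\<^esub>}. g j (ds_in I M i y j)) = g i y" .
qed

lemma direct_sum_universal:
  assumes "ring R" and M: "\<And>i. i \<in> I \<Longrightarrow> left_module R (M i)" and N: "left_module R N"
    and g: "\<And>i. i \<in> I \<Longrightarrow> linear_map R (M i) N (g i)"
  obtains h where "linear_map R (direct_sum I M) N h"
    "\<And>i y. \<lbrakk>i \<in> I; y \<in> carrier (M i)\<rbrakk> \<Longrightarrow> h (ds_in I M i y) = g i y"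
proof (rule that)
  show "linear_map R (direct_sum I M) N (\<lambda>x. \<Oplus>\<^bsub>N\<^esub>i\<in>{i \<in> I. x i \<noteq> \<zero>\<^bsub>M i\<^esub>}. g i (x i))"
    by (rule linear_map_direct_sum(1)[OF assms])
qed (rule linear_map_direct_sum(2)[OF assms])

section \<open>Free modules and lifting problems\<close>

lemma left_module_regular: "ring R \<Longrightarrow> left_module R (regular_module R)"
proof -
  assume "ring R"
  then interpret ring R .
  show ?thesis
  proof (rule left_moduleI[OF \<open>ring R\<close>])
    show "abelian_group (regular_module R)"
    proof (rule abelian_groupI)
      fix x assume "x \<in> carrier (regular_module R)"
      then show "\<exists>y\<in>carrier (regular_module R). y \<oplus>\<^bsub>regular_module R\<^esub> x = \<zero>\<^bsub>regular_module R\<^esub>"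
        by (intro bexI[of _ "\<ominus>\<^bsub>R\<^esub> x"]) (simp_all add: regular_module_def l_neg)
    qed (simp_all add: regular_module_def a_ac)
  qed (simp_all add: regular_module_def l_distr r_distr m_assoc)
qed

abbreviation free :: "('r, 'k) ring_scheme \<Rightarrow> 'i set \<Rightarrow> ('r, 'i \<Rightarrow> 'r) module" where
  "free R I \<equiv> direct_sum I (\<lambda>_. regular_module R)"

definition free_gen :: "('r, 'k) ring_scheme \<Rightarrow> 'i set \<Rightarrow> 'i \<Rightarrow> 'i \<Rightarrow> 'r" where
  "free_gen R I i = ds_in I (\<lambda>_. regular_module R) i \<one>\<^bsub>R\<^esub>"

lemma left_module_free: "ring R \<Longrightarrow> left_module R (free R I)"
  by (intro left_module_direct_sum left_module_regular)

lemma free_gen_closed: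
  assumes "ring R" "i \<in> I"
  shows "free_gen R I i \<in> carrier (free R I)"
proof -
  interpret ring R by fact
  have "\<one>\<^bsub>R\<^esub> \<in> carrier (regular_module R)" by (simp add: regular_module_def)
  then show ?thesis
    unfolding free_gen_def
    using linear_map_ds_in[where M = "\<lambda>_. regular_module R", OF assms(1) left_module_regular[OF assms(1)] assms(2)]
    by (rule linear_map_closed[rotated])
qed

lemma ds_in_regular:
  assumes "ring R" "i \<in> I" "r \<in> carrier R"
  shows "ds_in I (\<lambda>_. regular_module R) i r = r \<odot>\<^bsub>free R I\<^esub> free_gen R I i"
proof -
  interpret ring R by fact
  show ?thesis
    using assms(3) by (auto simp: free_gen_def ds_in_def regular_module_def intro!: restrict_ext)
qed

lemma free_map_ext:
  assumes "ring R" "left_module R N" "linear_map R (free R I) N f" "linear_map R (free R I) N g"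
    and "\<And>i. i \<in> I \<Longrightarrow> f (free_gen R I i) = g (free_gen R I i)"
    and "x \<in> carrier (free R I)"
  shows "f x = g x"
proof (rule direct_sum_map_ext[OF assms(1) left_module_regular[OF assms(1)] assms(2-4) _ assms(6)])
  fix i y assume "i \<in> I" "y \<in> carrier (regular_module R)"
  then have "i \<in> I" "y \<in> carrier R" by (simp_all add: regular_module_def)
  then show "f (ds_in I (\<lambda>_. regular_module R) i y) = g (ds_in I (\<lambda>_. regular_module R) i y)"
    using assms(1,5)
    by (simp add: ds_in_regular free_gen_closed linear_map_smult[OF assms(3)] linear_map_smult[OF assms(4)]
        del: direct_sum_simps)
qed

lemma free_map_image:
  assumes "ring R" "left_module R N" "linear_map R (free R I) N f" "submod R N H"
    and "\<And>i. i \<in> I \<Longrightarrow> f (free_gen R I i) \<in> H"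
    and "x \<in> carrier (free R I)"
  shows "f x \<in> H"
proof -
  note L = left_module_regular[OF assms(1)] and F = left_module_free[OF assms(1)]
  have "x \<in> {x \<in> carrier (free R I). f x \<in> H}"
  proof (rule direct_sum_induct[OF assms(1) L assms(6)])
    show "submod R (free R I) {x \<in> carrier (free R I). f x \<in> H}"
      by (rule submod_vimage[OF F assms(2-4)])
    fix i y assume "i \<in> I" "y \<in> carrier (regular_module R)"
    then have "i \<in> I" "y \<in> carrier R" by (simp_all add: regular_module_def)
    then show "ds_in I (\<lambda>_. regular_module R) i y \<in> {x \<in> carrier (free R I). f x \<in> H}"
      using assms(1,5)
      by (simp add: ds_in_regular free_gen_closed left_module.smult_closed[OF F] linear_map_smult[OF assms(3)] submod_smult[OF assms(4)]
          del: direct_sum_simps)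
  qed
  then show ?thesis by simp
qed

lemma free_universal:
  assumes "ring R" "left_module R N" "\<And>i. i \<in> I \<Longrightarrow> a i \<in> carrier N"
  obtains h where "linear_map R (free R I) N h" "\<And>i. i \<in> I \<Longrightarrow> h (free_gen R I i) = a i"
proof -
  interpret N: left_module R N by fact
  have lin: "linear_map R (regular_module R) N (\<lambda>r. r \<odot>\<^bsub>N\<^esub> a i)" if "i \<in> I" for i
    using assms(3)[OF that]
    by (intro linear_mapI) (auto simp: regular_module_def N.smult_l_distr N.smult_assoc1)
  have mem: "\<one>\<^bsub>R\<^esub> \<in> carrier (regular_module R)" by (simp add: regular_module_def)
  obtain h where h: "linear_map R (free R I) N h"
    "\<And>i y. \<lbrakk>i \<in> I; y \<in> carrier (regular_module R)\<rbrakk> \<Longrightarrow>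
      h (ds_in I (\<lambda>_. regular_module R) i y) = y \<odot>\<^bsub>N\<^esub> a i"
    using direct_sum_universal[OF assms(1) left_module_regular[OF assms(1)] assms(2),
        of I "\<lambda>i r. r \<odot>\<^bsub>N\<^esub> a i", OF lin] by blast
  show thesis
    using h mem assms(3) by (intro that[of h]) (auto simp: free_gen_def)
qed

lemma free_lift:
  assumes "ring R" "left_module R A" "left_module R B"
    and g: "linear_map R A B g" and h: "linear_map R (free R I) B h"
    and im: "\<And>i. i \<in> I \<Longrightarrow> h (free_gen R I i) \<in> g ` carrier A"
  obtains l where "linear_map R (free R I) A l" "\<And>x. x \<in> carrier (free R I) \<Longrightarrow> g (l x) = h x"
proof -
  have "\<forall>i\<in>I. \<exists>a. a \<in> carrier A \<and> g a = h (free_gen R I i)" using im by (metis imageE)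
  then obtain a where a: "\<forall>i\<in>I. a i \<in> carrier A \<and> g (a i) = h (free_gen R I i)" by metis
  obtain l where l: "linear_map R (free R I) A l" "\<And>i. i \<in> I \<Longrightarrow> l (free_gen R I i) = a i"
    using free_universal[OF assms(1,2), of I a] a by blast
  show thesis
  proof (rule that[OF l(1)])
    fix x assume "x \<in> carrier (free R I)"
    then show "g (l x) = h x"
      by (rule free_map_ext[OF assms(1,3) linear_map_comp[OF l(1) g] h, rotated]) (simp add: a l(2))
  qed
qed

text \<open>\<open>projective\<close> tests maps in two particular types only. Its instance at the
  identity of \<open>P\<close> splits the free module on the set \<open>P\<close>; any other lifting
  problem is solved on the generators of that free module and pulled back along the splitting. Hence
  it is enough that the image of \<open>g\<close> contains that of \<open>h\<close>.\<close>

lemma projective_lift: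
  assumes P: "projective R P" and "left_module R A" "left_module R B"
    and g: "linear_map R A B g" and h: "linear_map R P B h"
    and im: "h ` carrier P \<subseteq> g ` carrier A"
  obtains l where "linear_map R P A l" "\<And>x. x \<in> carrier P \<Longrightarrow> g (l x) = h x"
proof -
  have PM: "left_module R P" using P by (simp add: projective_def)
  note R = left_module_ring[OF PM]
  note FM = left_module_free[OF R, of "carrier P"]
  obtain q where q: "linear_map R (free R (carrier P)) P q"
    "\<And>x. x \<in> carrier P \<Longrightarrow> q (free_gen R (carrier P) x) = x"
    using free_universal[OF R PM, of "carrier P" "\<lambda>x. x"] by blast
  have surj: "q ` carrier (free R (carrier P)) = carrier P"
  proof
    show "carrier P \<subseteq> q ` carrier (free R (carrier P))"
      using q(2) free_gen_closed[OF R] by (metis imageI subsetI)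
  qed (use q(1) in \<open>auto simp: linear_map_closed\<close>)
  have "\<exists>s. linear_map R P (free R (carrier P)) s \<and> (\<forall>x\<in>carrier P. q (s x) = x)"
    using P unfolding projective_def
    by (elim conjE allE[of _ "free R (carrier P)"] allE[of _ P] allE[of _ q] allE[of _ "\<lambda>x. x"] mp)
      (intro conjI FM PM q(1) surj linear_map_ident)
  then obtain s where s: "linear_map R P (free R (carrier P)) s" "\<forall>x\<in>carrier P. q (s x) = x" by blast
  have hq: "linear_map R (free R (carrier P)) B (\<lambda>x. h (q x))" by (rule linear_map_comp[OF q(1) h])
  obtain l where l: "linear_map R (free R (carrier P)) A l"
    "\<And>x. x \<in> carrier (free R (carrier P)) \<Longrightarrow> g (l x) = h (q x)"
    by (rule free_lift[OF R assms(2,3) g hq]) (use im q(2) in auto)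
  show thesis
    using s l linear_map_closed[OF s(1)] by (intro that[OF linear_map_comp[OF s(1) l(1)]]) auto
qed

text \<open>Schanuel's argument: a resolution of length one lets the kernel of any epimorphism from a free
  module onto \<open>X\<close> lift along epimorphisms.\<close>

lemma syzygy_lift:
  assumes "ring R" and X: "left_module R X" and pd: "proj_dim_le_one R X"
    and \<pi>: "linear_map R (free R I) X \<pi>" and surj: "\<pi> ` carrier (free R I) = carrier X"
    and AB: "left_module R A" "left_module R B" and g: "linear_map R A B g"
    and K: "K = {x \<in> carrier (free R I). \<pi> x = \<zero>\<^bsub>X\<^esub>}"
    and \<theta>: "linear_map R (sub (free R I) K) B \<theta>" and im: "\<theta> ` K \<subseteq> g ` carrier A"
  obtains \<mu> where "linear_map R (sub (free R I) K) A \<mu>" "\<And>x. x \<in> K \<Longrightarrow> g (\<mu> x) = \<theta> x"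
proof -
  let ?G = "free R I"
  have G: "left_module R ?G" by (rule left_module_free[OF assms(1)])
  interpret G: left_module R ?G by (rule G)
  interpret X: left_module R X by (rule X)
  interpret A: left_module R A by (rule AB)
  interpret B: left_module R B by (rule AB)
  have KG: "submod R ?G K" unfolding K by (rule submod_kernel[OF G X \<pi>])
  obtain P\<^sub>1 :: "('a, 'c \<Rightarrow> 'a) module" and e :: "('a, 'c \<Rightarrow> 'a, 'c \<Rightarrow> 'a, 'c) ses" where
    P: "projective R P\<^sub>1" "projective R (ses_mid e)" and ex: "short_exact R P\<^sub>1 X e"
    using pd unfolding proj_dim_le_one_def by blast
  let ?P = "ses_mid e"
  have P1: "left_module R P\<^sub>1" and P0: "left_module R ?P" and i: "linear_map R P\<^sub>1 ?P (ses_in e)"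
    and o: "linear_map R ?P X (ses_out e)" and inj: "inj_on (ses_in e) (carrier P\<^sub>1)"
    and so: "ses_out e ` carrier ?P = carrier X"
    and ker: "ses_in e ` carrier P\<^sub>1 = {m \<in> carrier ?P. ses_out e m = \<zero>\<^bsub>X\<^esub>}"
    using ex by (auto simp: short_exact_def)
  \<comment> \<open>\<open>a\<close> and \<open>b\<close> compare the two presentations of
    \<open>X\<close>. They need not be inverse to each other, but both lie over \<open>X\<close>, so
    the composite differs from the identity by a map into \<open>K\<close>.\<close>
  obtain a where a: "linear_map R ?P ?G a" "\<And>x. x \<in> carrier ?P \<Longrightarrow> \<pi> (a x) = ses_out e x"
    by (rule projective_lift[OF P(2) G X \<pi> o]) (use so surj in auto)
  obtain b where b: "linear_map R ?G ?P b" "\<And>x. x \<in> carrier ?G \<Longrightarrow> ses_out e (b x) = \<pi> x"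
  proof (rule free_lift[OF assms(1) P0 X o \<pi>])
    show "\<pi> (free_gen R I i) \<in> ses_out e ` carrier ?P" if "i \<in> I" for i
      using linear_map_closed[OF \<pi> free_gen_closed[OF assms(1) that]] so by simp
  qed blast
  have aK: "a (ses_in e p) \<in> K" if "p \<in> carrier P\<^sub>1" for p
  proof -
    have "ses_in e p \<in> carrier ?P" "ses_out e (ses_in e p) = \<zero>\<^bsub>X\<^esub>" using ker that by blast+
    then show ?thesis using a by (simp add: K linear_map_closed[OF a(1)])
  qed
  have "linear_map R P\<^sub>1 (sub ?G K) (\<lambda>p. a (ses_in e p))"
    using linear_map_comp[OF i a(1)] aK by (subst linear_map_to_sub[OF submod_subset[OF KG]]) auto
  then have t1: "linear_map R P\<^sub>1 B (\<lambda>p. \<theta> (a (ses_in e p)))" using \<theta> by (rule linear_map_comp)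
  obtain \<mu>1 where \<mu>1: "linear_map R P\<^sub>1 A \<mu>1" "\<And>p. p \<in> carrier P\<^sub>1 \<Longrightarrow> g (\<mu>1 p) = \<theta> (a (ses_in e p))"
    by (rule projective_lift[OF P(1) AB g t1]) (use im aK in auto)
  have ab: "linear_map R ?G ?G (\<lambda>x. a (b x))" by (rule linear_map_comp[OF b(1) a(1)])
  have dlin: "linear_map R ?G ?G (\<lambda>x. x \<ominus>\<^bsub>?G\<^esub> a (b x))"
    by (rule linear_map_diff[OF G linear_map_ident ab])
  have dK: "x \<ominus>\<^bsub>?G\<^esub> a (b x) \<in> K" if x: "x \<in> carrier ?G" for x
  proof -
    have "\<pi> (x \<ominus>\<^bsub>?G\<^esub> a (b x)) = \<pi> x \<ominus>\<^bsub>X\<^esub> \<pi> (a (b x))"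
      by (rule linear_map_minus[OF G X \<pi> x linear_map_closed[OF ab x]])
    also have "\<dots> = \<zero>\<^bsub>X\<^esub>"
      using x a(2) b(2) linear_map_closed[OF b(1) x] linear_map_closed[OF \<pi> x] X.M.minus_eq_zero_iff by simp
    finally show ?thesis using linear_map_closed[OF dlin x] by (simp add: K)
  qed
  have "linear_map R ?G (sub ?G K) (\<lambda>x. x \<ominus>\<^bsub>?G\<^esub> a (b x))"
    using dlin dK by (subst linear_map_to_sub[OF submod_subset[OF KG]]) auto
  then have t2: "linear_map R ?G B (\<lambda>x. \<theta> (x \<ominus>\<^bsub>?G\<^esub> a (b x)))" using \<theta> by (rule linear_map_comp)
  \<comment> \<open>\<open>x - a (b x)\<close> lies in \<open>K\<close> for every \<open>x\<close>
    of the free module, not only for \<open>x\<close> in \<open>K\<close>. This part of \<theta>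
    therefore comes from a map on a free module and is lifted on generators.\<close>
  obtain \<mu>2 where \<mu>2: "linear_map R ?G A \<mu>2"
    "\<And>x. x \<in> carrier ?G \<Longrightarrow> g (\<mu>2 x) = \<theta> (x \<ominus>\<^bsub>?G\<^esub> a (b x))"
  proof (rule free_lift[OF assms(1) AB g t2])
    show "\<theta> (free_gen R I i \<ominus>\<^bsub>?G\<^esub> a (b (free_gen R I i))) \<in> g ` carrier A" if "i \<in> I" for i
      using dK[OF free_gen_closed[OF assms(1) that]] im by blast
  qed blast
  have sk: "submod R ?P (ses_in e ` carrier P\<^sub>1)"
    by (rule submod_image[OF P1 P0 i submod_carrier[OF P1]])
  have i': "linear_map R P\<^sub>1 (sub ?P (ses_in e ` carrier P\<^sub>1)) (ses_in e)"
    using i by (subst linear_map_to_sub[OF submod_subset[OF sk]]) auto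
  have "bij_betw (ses_in e) (carrier P\<^sub>1) (carrier (sub ?P (ses_in e ` carrier P\<^sub>1)))"
    using inj by (simp add: bij_betw_def)
  then obtain c where c: "linear_map R (sub ?P (ses_in e ` carrier P\<^sub>1)) P\<^sub>1 c"
    and "\<And>y. y \<in> carrier (sub ?P (ses_in e ` carrier P\<^sub>1)) \<Longrightarrow> ses_in e (c y) = y"
    using linear_map_inverse[OF P1 left_module_sub[OF P0 sk] i'] by blast
  then have c2: "ses_in e (c y) = y" if "y \<in> ses_in e ` carrier P\<^sub>1" for y using that by simp
  have bK: "b k \<in> ses_in e ` carrier P\<^sub>1" if "k \<in> K" for k
    using that b by (auto simp: ker K linear_map_closed[OF b(1)])
  have "linear_map R (sub ?G K) (sub ?P (ses_in e ` carrier P\<^sub>1)) b"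
    using linear_map_restrict[OF b(1) KG] bK by (subst linear_map_to_sub[OF submod_subset[OF sk]]) auto
  then have cb: "linear_map R (sub ?G K) P\<^sub>1 (\<lambda>k. c (b k))" using c by (rule linear_map_comp)
  \<comment> \<open>Every \<open>k\<close> in \<open>K\<close> is \<open>a (b k)\<close> plus
    \<open>k - a (b k)\<close>. The first part passes through \<open>P\<^sub>1\<close>, where
    projectivity gave \<open>\<mu>1\<close>; the second is handled by \<open>\<mu>2\<close>.\<close>
  have "linear_map R (sub ?G K) A (\<lambda>k. \<mu>1 (c (b k)) \<oplus>\<^bsub>A\<^esub> \<mu>2 k)"
    by (intro linear_map_plus[OF AB(1)] linear_map_comp[OF cb \<mu>1(1)] linear_map_restrict[OF \<mu>2(1) KG])
  moreover have "g (\<mu>1 (c (b k)) \<oplus>\<^bsub>A\<^esub> \<mu>2 k) = \<theta> k" if k: "k \<in> K" for k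
  proof -
    have kG: "k \<in> carrier ?G" using submod_mem[OF KG k] .
    have cbk: "c (b k) \<in> carrier P\<^sub>1" using linear_map_closed[OF cb] k by simp
    have eq: "ses_in e (c (b k)) = b k" by (rule c2[OF bK[OF k]])
    have abk: "a (b k) \<in> K" using aK[OF cbk] eq by simp
    have "g (\<mu>1 (c (b k)) \<oplus>\<^bsub>A\<^esub> \<mu>2 k) = \<theta> (a (b k)) \<oplus>\<^bsub>B\<^esub> \<theta> (k \<ominus>\<^bsub>?G\<^esub> a (b k))"
      using linear_map_add[OF g] linear_map_closed[OF \<mu>1(1) cbk] linear_map_closed[OF \<mu>2(1) kG]
        \<mu>1(2)[OF cbk] \<mu>2(2)[OF kG] eq by simp
    also have "\<dots> = \<theta> (a (b k) \<oplus>\<^bsub>?G\<^esub> (k \<ominus>\<^bsub>?G\<^esub> a (b k)))"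
      using linear_map_add[OF \<theta>, of "a (b k)" "k \<ominus>\<^bsub>?G\<^esub> a (b k)"] abk dK[OF kG] by simp
    also have "a (b k) \<oplus>\<^bsub>?G\<^esub> (k \<ominus>\<^bsub>?G\<^esub> a (b k)) = (k \<ominus>\<^bsub>?G\<^esub> a (b k)) \<oplus>\<^bsub>?G\<^esub> a (b k)"
      by (rule G.M.a_comm[OF submod_mem[OF KG abk] submod_mem[OF KG dK[OF kG]]])
    also have "\<dots> = k" by (rule G.M.minus_add_cancel[OF kG submod_mem[OF KG abk]])
    finally show ?thesis .
  qed
  ultimately show thesis by (rule that)
qed

section \<open>Constructions with short exact sequences\<close>

lemma short_exactD:
  assumes "short_exact R A B e"
  shows "left_module R A" "left_module R (ses_mid e)" "left_module R B"
    "linear_map R A (ses_mid e) (ses_in e)" "linear_map R (ses_mid e) B (ses_out e)"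
    "inj_on (ses_in e) (carrier A)" "ses_out e ` carrier (ses_mid e) = carrier B"
    "ses_in e ` carrier A = {m \<in> carrier (ses_mid e). ses_out e m = \<zero>\<^bsub>B\<^esub>}"
  using assms by (simp_all add: short_exact_def)

lemma short_exact_in: "short_exact R A B e \<Longrightarrow> a \<in> carrier A \<Longrightarrow> ses_in e a \<in> carrier (ses_mid e)"
  and short_exact_out: "short_exact R A B e \<Longrightarrow> m \<in> carrier (ses_mid e) \<Longrightarrow> ses_out e m \<in> carrier B"
  and short_exact_out_in: "short_exact R A B e \<Longrightarrow> a \<in> carrier A \<Longrightarrow> ses_out e (ses_in e a) = \<zero>\<^bsub>B\<^esub>"
  by (auto simp: short_exact_def linear_map_def)

lemma short_exact_ker:
  assumes "short_exact R A B e" "m \<in> carrier (ses_mid e)" "ses_out e m = \<zero>\<^bsub>B\<^esub>"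
  obtains a where "a \<in> carrier A" "m = ses_in e a"
  using assms unfolding short_exact_def by blast

lemma short_exact_surj:
  assumes "short_exact R A B e" "b \<in> carrier B"
  obtains m where "m \<in> carrier (ses_mid e)" "ses_out e m = b"
proof -
  have "b \<in> ses_out e ` carrier (ses_mid e)" using assms(2) short_exactD(7)[OF assms(1)] by simp
  then show thesis using that by blast
qed

lemma short_exact_in_zero_iff:
  assumes "short_exact R A B e" "a \<in> carrier A"
  shows "ses_in e a = \<zero>\<^bsub>ses_mid e\<^esub> \<longleftrightarrow> a = \<zero>\<^bsub>A\<^esub>"
  using linear_map_inj_on_iff[OF short_exactD(1,2,4)[OF assms(1)]]
    short_exactD(6)[OF assms(1)] linear_map_zero[OF short_exactD(1,2,4)[OF assms(1)]] assms(2)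
  by auto

lemma short_exactI:
  assumes "left_module R A" "left_module R (ses_mid e)" "left_module R B"
    "linear_map R A (ses_mid e) (ses_in e)" "linear_map R (ses_mid e) B (ses_out e)"
    "\<And>a. a \<in> carrier A \<Longrightarrow> ses_in e a = \<zero>\<^bsub>ses_mid e\<^esub> \<Longrightarrow> a = \<zero>\<^bsub>A\<^esub>"
    "\<And>b. b \<in> carrier B \<Longrightarrow> \<exists>m\<in>carrier (ses_mid e). ses_out e m = b"
    "\<And>a. a \<in> carrier A \<Longrightarrow> ses_out e (ses_in e a) = \<zero>\<^bsub>B\<^esub>"
    "\<And>m. m \<in> carrier (ses_mid e) \<Longrightarrow> ses_out e m = \<zero>\<^bsub>B\<^esub> \<Longrightarrow> \<exists>a\<in>carrier A. ses_in e a = m"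
  shows "short_exact R A B e"
  unfolding short_exact_def
proof (intro conjI)
  show "inj_on (ses_in e) (carrier A)"
    using assms(6) linear_map_inj_on_iff[OF assms(1,2,4)] by blast
  show "ses_out e ` carrier (ses_mid e) = carrier B"
    using assms(7) linear_map_closed[OF assms(5)] by blast
  show "ses_in e ` carrier A = {m \<in> carrier (ses_mid e). ses_out e m = \<zero>\<^bsub>B\<^esub>}"
    using assms(8,9) linear_map_closed[OF assms(4)] by blast
qed (fact assms)+

section \<open>Quotients, push-outs, pull-backs and sums of sequences\<close>

lemma quotient_module_props:
  fixes M :: "('r, 'm) module"
  assumes M: "left_module R M" and U: "submod R M U"
  shows left_module_quotient: "left_module R (quotient_module M U)"
    and linear_map_coset: "linear_map R M (quotient_module M U) (\<lambda>x. U +>\<^bsub>M\<^esub> x)"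
    and coset_surj: "(\<lambda>x. U +>\<^bsub>M\<^esub> x) ` carrier M = carrier (quotient_module M U)"
    and coset_zero_iff: "x \<in> carrier M \<Longrightarrow> U +>\<^bsub>M\<^esub> x = \<zero>\<^bsub>quotient_module M U\<^esub> \<longleftrightarrow> x \<in> U"
proof -
  interpret M: left_module R M by fact
  have "subgroup U (add_monoid M)"
    using U submod_uminus[OF M U] by unfold_locales (auto simp: submod_def a_inv_def)
  then interpret U: abelian_subgroup U M
    by (intro abelian_subgroupI3 additive_subgroup.intro M.M.abelian_group_axioms)
  have eq: "U +>\<^bsub>M\<^esub> y = U +>\<^bsub>M\<^esub> x" if "x \<in> carrier M" "y \<in> U +>\<^bsub>M\<^esub> x" for x y
    using U.a_repr_independence'[OF that(2,1)] by simp
  let ?Q = "quotient_module M U"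
  show lin: "linear_map R M ?Q (\<lambda>x. U +>\<^bsub>M\<^esub> x)"
  proof (rule linear_mapI)
    fix x assume "x \<in> carrier M"
    then show "U +>\<^bsub>M\<^esub> x \<in> carrier ?Q"
      by (simp add: quotient_module_def M.M.a_rcosetsI U.a_subset)
  next
    fix x y assume "x \<in> carrier M" "y \<in> carrier M"
    then show "U +>\<^bsub>M\<^esub> (x \<oplus>\<^bsub>M\<^esub> y) = (U +>\<^bsub>M\<^esub> x) \<oplus>\<^bsub>?Q\<^esub> (U +>\<^bsub>M\<^esub> y)"
      by (simp add: quotient_module_def U.a_rcos_sum)
  next
    fix r x assume rx: "r \<in> carrier R" "x \<in> carrier M"
    \<comment> \<open>Scalar multiplication of a coset is a union over its elements, so all of them
      have to yield the same coset.\<close>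
    have "U +>\<^bsub>M\<^esub> (r \<odot>\<^bsub>M\<^esub> y) = U +>\<^bsub>M\<^esub> (r \<odot>\<^bsub>M\<^esub> x)" if y: "y \<in> U +>\<^bsub>M\<^esub> x" for y
    proof (rule eq)
      obtain u where "u \<in> U" "y = u \<oplus>\<^bsub>M\<^esub> x" using y by (auto simp: a_r_coset_def')
      then show "r \<odot>\<^bsub>M\<^esub> y \<in> U +>\<^bsub>M\<^esub> (r \<odot>\<^bsub>M\<^esub> x)"
        using rx submod_mem[OF U] submod_smult[OF U] by (auto simp: a_r_coset_def' M.smult_r_distr)
    qed (use rx in simp)
    moreover have "x \<in> U +>\<^bsub>M\<^esub> x" using rx by (intro U.a_rcos_self)
    ultimately have "(\<Union>y\<in>U +>\<^bsub>M\<^esub> x. U +>\<^bsub>M\<^esub> (r \<odot>\<^bsub>M\<^esub> y)) = U +>\<^bsub>M\<^esub> (r \<odot>\<^bsub>M\<^esub> x)"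
      by blast
    then show "U +>\<^bsub>M\<^esub> (r \<odot>\<^bsub>M\<^esub> x) = r \<odot>\<^bsub>?Q\<^esub> (U +>\<^bsub>M\<^esub> x)"
      by (simp add: quotient_module_def)
  qed
  show surj: "(\<lambda>x. U +>\<^bsub>M\<^esub> x) ` carrier M = carrier ?Q"
    by (auto simp: quotient_module_def A_RCOSETS_def')
  have "U +>\<^bsub>M\<^esub> \<zero>\<^bsub>M\<^esub> = \<zero>\<^bsub>?Q\<^esub>"
    by (simp add: quotient_module_def U.a_subset)
  then show "left_module R ?Q" by (rule left_module_image[OF M lin surj])
  assume x: "x \<in> carrier M"
  show "U +>\<^bsub>M\<^esub> x = \<zero>\<^bsub>?Q\<^esub> \<longleftrightarrow> x \<in> U"
    using x U.a_rcos_self[OF x] U.a_rcos_const[of x] by (auto simp: quotient_module_def)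
qed

text \<open>The projection from the product onto the middle term of the push-out. Maps into a
  push-out are built as maps into the product followed by this one.\<close>

definition push_coset ::
  "('r, 'a) module \<Rightarrow> ('r, 'a') module \<Rightarrow> ('a \<Rightarrow> 'a') \<Rightarrow> ('r, 'a, 'e, 'b) ses \<Rightarrow> 'a' \<times> 'e \<Rightarrow> ('a' \<times> 'e) set" where
  "push_coset A A' g e z = (\<lambda>a. (g a, \<ominus>\<^bsub>ses_mid e\<^esub> ses_in e a)) ` carrier A +>\<^bsub>prod_module A' (ses_mid e)\<^esub> z"

text \<open>One relation drives all four parts: the class of \<open>(g a, - ses_in e a)\<close>
  vanishes, so an element of \<open>A\<close> seen in the middle term of \<open>e\<close> becomes
  its image under \<open>g\<close> seen in \<open>A'\<close>.\<close>

lemma pushout_ses_props: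
  fixes e :: "('r, 'a, 'e, 'b) ses" and A' :: "('r, 'a') module"
  assumes e: "short_exact R A B e" and A': "left_module R A'" and g: "linear_map R A A' g"
  shows short_exact_pushout: "short_exact R A' B (pushout_ses A A' g e)"
    and linear_map_push_coset:
      "linear_map R (prod_module A' (ses_mid e)) (ses_mid (pushout_ses A A' g e)) (push_coset A A' g e)"
    and pushout_out: "\<lbrakk>x \<in> carrier A'; m \<in> carrier (ses_mid e)\<rbrakk> \<Longrightarrow>
      ses_out (pushout_ses A A' g e) (push_coset A A' g e (x, m)) = ses_out e m"
    and push_coset_in: "a \<in> carrier A \<Longrightarrow>
      push_coset A A' g e (\<zero>\<^bsub>A'\<^esub>, ses_in e a) = ses_in (pushout_ses A A' g e) (g a)"
proof -
  note ed = short_exactD[OF e]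
  let ?E = "ses_mid e"
  let ?P = "prod_module A' ?E"
  let ?S = "pushout_ses A A' g e"
  let ?q = "push_coset A A' g e"
  interpret A: left_module R A by (rule ed)
  interpret E: left_module R ?E by (rule ed)
  interpret B: left_module R B by (rule ed)
  interpret A': left_module R A' by (rule A')
  have P: "left_module R ?P" by (rule left_module_prod[OF A' ed(2)])
  interpret P: left_module R ?P by (rule P)
  define U where "U = (\<lambda>a. (g a, \<ominus>\<^bsub>?E\<^esub> ses_in e a)) ` carrier A"
  have U: "submod R ?P U"
    unfolding U_def
    by (rule submod_image[OF ed(1) P linear_map_pair[OF g linear_map_neg[OF ed(2,4)]] submod_carrier[OF ed(1)]])
  have q: "?q = (\<lambda>z. U +>\<^bsub>?P\<^esub> z)" by (simp add: push_coset_def U_def fun_eq_iff)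
  have mid: "ses_mid ?S = quotient_module ?P U" by (simp add: pushout_ses_def Let_def U_def)
  note Q = left_module_quotient[OF P U]
  show qlin: "linear_map R ?P (ses_mid ?S) ?q"
    unfolding mid q by (rule linear_map_coset[OF P U])
  have qsurj: "?q ` carrier ?P = carrier (ses_mid ?S)"
    unfolding mid q by (rule coset_surj[OF P U])
  have qzero: "?q z = \<zero>\<^bsub>ses_mid ?S\<^esub> \<longleftrightarrow> z \<in> U" if "z \<in> carrier ?P" for z
    unfolding mid q by (rule coset_zero_iff[OF P U that])
  have "in": "ses_in ?S a' = ?q (a', \<zero>\<^bsub>?E\<^esub>)" for a'
    by (simp add: pushout_ses_def Let_def push_coset_def)
  show out: "ses_out ?S (?q (x, m)) = ses_out e m" if "x \<in> carrier A'" "m \<in> carrier ?E" for x m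
  proof -
    \<comment> \<open>\<open>ses_out\<close> of the push-out is \<open>the_elem\<close> of the image
      of a coset. The image is a singleton because second components of one coset differ by elements
      of \<open>ses_in e\<close>, which \<open>ses_out e\<close> kills.\<close>
    have c: "ses_out e n = ses_out e m" if n: "(y, n) \<in> ?q (x, m)" for y n
    proof -
      obtain a where a: "a \<in> carrier A" "n = \<ominus>\<^bsub>?E\<^esub> ses_in e a \<oplus>\<^bsub>?E\<^esub> m"
        using n by (auto simp: q a_r_coset_def' U_def)
      then show ?thesis
        using \<open>m \<in> carrier ?E\<close> e
        by (simp add: linear_map_add[OF ed(5)] short_exact_in linear_map_uminus[OF ed(2,3,5)]
            short_exact_out_in B.M.uminus_zero short_exact_out)
    qed
    have mem: "(x, m) \<in> ?q (x, m)"
      unfolding q a_r_coset_def' using that submod_zero[OF U] by force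
    have "(\<lambda>(a', m). ses_out e m) z = ses_out e m" if "z \<in> ?q (x, m)" for z
      using c[of "fst z" "snd z"] that by (simp add: case_prod_beta)
    then have "(\<lambda>(a', m). ses_out e m) ` ?q (x, m) = (\<lambda>_. ses_out e m) ` ?q (x, m)"
      by (rule image_cong[OF refl])
    also have "\<dots> = {ses_out e m}" using mem by (rule image_constant)
    finally have "(\<lambda>(a', m). ses_out e m) ` ?q (x, m) = {ses_out e m}" .
    then show ?thesis by (simp add: pushout_ses_def Let_def)
  qed
  show ina: "?q (\<zero>\<^bsub>A'\<^esub>, ses_in e a) = ses_in ?S (g a)" if a: "a \<in> carrier A" for a
  proof -
    have "?q (g a, \<ominus>\<^bsub>?E\<^esub> ses_in e a) = \<zero>\<^bsub>ses_mid ?S\<^esub>"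
      using a e g by (subst qzero) (auto simp: U_def linear_map_closed short_exact_in)
    moreover have "ses_in ?S (g a) = ?q ((g a, \<ominus>\<^bsub>?E\<^esub> ses_in e a) \<oplus>\<^bsub>?P\<^esub> (\<zero>\<^bsub>A'\<^esub>, ses_in e a))"
      using a e g by (simp add: "in" linear_map_closed short_exact_in E.M.l_neg)
    moreover have "\<dots> = ?q (g a, \<ominus>\<^bsub>?E\<^esub> ses_in e a) \<oplus>\<^bsub>ses_mid ?S\<^esub> ?q (\<zero>\<^bsub>A'\<^esub>, ses_in e a)"
      using a e g by (intro linear_map_add[OF qlin]) (auto simp: linear_map_closed short_exact_in)
    ultimately show ?thesis
      using linear_map_closed[OF qlin, of "(\<zero>\<^bsub>A'\<^esub>, ses_in e a)"] a e Q
      by (simp add: mid short_exact_in abelian_monoid.l_zero[OF abelian_group.axioms(1)[OF left_module_group[OF Q]]])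
  qed
  have ex: "\<exists>x\<in>carrier A'. \<exists>m\<in>carrier ?E. z = ?q (x, m)" if "z \<in> carrier (ses_mid ?S)" for z
    using that unfolding qsurj[symmetric] by auto
  show "short_exact R A' B ?S"
  proof (rule short_exactI)
    show "left_module R A'" "left_module R B" by fact+
    show "left_module R (ses_mid ?S)" unfolding mid by (rule Q)
    have "linear_map R A' ?P (\<lambda>a. (a, \<zero>\<^bsub>?E\<^esub>))"
      by (rule linear_map_pair[OF linear_map_ident linear_map_const_zero[OF ed(2)]])
    then show "linear_map R A' (ses_mid ?S) (ses_in ?S)"
      by (rule linear_map_cong[OF A' linear_map_comp[OF _ qlin]]) (rule "in")
    show "linear_map R (ses_mid ?S) B (ses_out ?S)"
    proof (rule linear_mapI)
      fix z assume "z \<in> carrier (ses_mid ?S)"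
      then show "ses_out ?S z \<in> carrier B" using e by (auto dest!: ex simp: out short_exact_out)
    next
      fix z w assume "z \<in> carrier (ses_mid ?S)" "w \<in> carrier (ses_mid ?S)"
      then obtain x m y n where c: "x \<in> carrier A'" "m \<in> carrier ?E" "z = ?q (x, m)"
        "y \<in> carrier A'" "n \<in> carrier ?E" "w = ?q (y, n)" by (metis ex)
      have "z \<oplus>\<^bsub>ses_mid ?S\<^esub> w = ?q (x \<oplus>\<^bsub>A'\<^esub> y, m \<oplus>\<^bsub>?E\<^esub> n)"
        using c linear_map_add[OF qlin, of "(x, m)" "(y, n)"] by simp
      then show "ses_out ?S (z \<oplus>\<^bsub>ses_mid ?S\<^esub> w) = ses_out ?S z \<oplus>\<^bsub>B\<^esub> ses_out ?S w"
        using c by (simp add: out linear_map_add[OF ed(5)])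
    next
      fix r z assume r: "r \<in> carrier R" and "z \<in> carrier (ses_mid ?S)"
      then obtain x m where c: "x \<in> carrier A'" "m \<in> carrier ?E" "z = ?q (x, m)" by (metis ex)
      have "r \<odot>\<^bsub>ses_mid ?S\<^esub> z = ?q (r \<odot>\<^bsub>A'\<^esub> x, r \<odot>\<^bsub>?E\<^esub> m)"
        using c r linear_map_smult[OF qlin, of r "(x, m)"] by simp
      then show "ses_out ?S (r \<odot>\<^bsub>ses_mid ?S\<^esub> z) = r \<odot>\<^bsub>B\<^esub> ses_out ?S z"
        using c r by (simp add: out linear_map_smult[OF ed(5)])
    qed
    show "a = \<zero>\<^bsub>A'\<^esub>" if a: "a \<in> carrier A'" "ses_in ?S a = \<zero>\<^bsub>ses_mid ?S\<^esub>" for a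
    proof -
      \<comment> \<open>A relation of the form \<open>(a, 0)\<close> comes from some
        \<open>c\<close> with \<open>ses_in e c\<close> zero; injectivity in \<open>e\<close> makes
        \<open>c\<close> zero, hence also \<open>a\<close>, which is \<open>g c\<close>.\<close>
      have "(a, \<zero>\<^bsub>?E\<^esub>) \<in> U" using a by (subst qzero[symmetric]) (auto simp: "in")
      then obtain c where c: "c \<in> carrier A" "a = g c" "\<zero>\<^bsub>?E\<^esub> = \<ominus>\<^bsub>?E\<^esub> ses_in e c" by (auto simp: U_def)
      then have "ses_in e c = \<zero>\<^bsub>?E\<^esub>"
        using E.M.minus_minus[OF short_exact_in[OF e c(1)]] E.M.uminus_zero by simp
      then have "c = \<zero>\<^bsub>A\<^esub>" using short_exact_in_zero_iff[OF e c(1)] by simp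
      then show ?thesis using c(2) linear_map_zero[OF ed(1) A' g] by simp
    qed
    show "\<exists>m\<in>carrier (ses_mid ?S). ses_out ?S m = b" if b: "b \<in> carrier B" for b
    proof -
      obtain m where m: "m \<in> carrier ?E" "ses_out e m = b" by (rule short_exact_surj[OF e b])
      then show ?thesis
        using linear_map_closed[OF qlin, of "(\<zero>\<^bsub>A'\<^esub>, m)"]
        by (intro bexI[of _ "?q (\<zero>\<^bsub>A'\<^esub>, m)"]) (auto simp: out)
    qed
    show "ses_out ?S (ses_in ?S a) = \<zero>\<^bsub>B\<^esub>" if "a \<in> carrier A'" for a
      using that by (simp add: "in" out linear_map_zero[OF ed(2,3,5)])
    show "\<exists>a\<in>carrier A'. ses_in ?S a = z" if z: "z \<in> carrier (ses_mid ?S)" "ses_out ?S z = \<zero>\<^bsub>B\<^esub>" for z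
    proof -
      obtain x m where c: "x \<in> carrier A'" "m \<in> carrier ?E" "z = ?q (x, m)" using ex[OF z(1)] by blast
      then have "ses_out e m = \<zero>\<^bsub>B\<^esub>" using z(2) by (simp add: out)
      then obtain a where a: "a \<in> carrier A" "m = ses_in e a" using short_exact_ker[OF e c(2)] by blast
      have "z = ?q ((x, \<zero>\<^bsub>?E\<^esub>) \<oplus>\<^bsub>?P\<^esub> (\<zero>\<^bsub>A'\<^esub>, ses_in e a))" using c a by simp
      also have "\<dots> = ?q (x, \<zero>\<^bsub>?E\<^esub>) \<oplus>\<^bsub>ses_mid ?S\<^esub> ?q (\<zero>\<^bsub>A'\<^esub>, ses_in e a)"
        using a c by (intro linear_map_add[OF qlin]) auto
      also have "\<dots> = ?q (x, \<zero>\<^bsub>?E\<^esub>) \<oplus>\<^bsub>ses_mid ?S\<^esub> ?q (g a, \<zero>\<^bsub>?E\<^esub>)"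
        by (simp add: ina a(1) "in")
      also have "\<dots> = ?q ((x, \<zero>\<^bsub>?E\<^esub>) \<oplus>\<^bsub>?P\<^esub> (g a, \<zero>\<^bsub>?E\<^esub>))"
        using a c linear_map_closed[OF g] by (intro linear_map_add[OF qlin, symmetric]) auto
      also have "\<dots> = ses_in ?S (x \<oplus>\<^bsub>A'\<^esub> g a)" by (simp add: "in")
      finally show ?thesis using a c linear_map_closed[OF g] by blast
    qed
  qed
qed

lemma short_exact_pullback:
  assumes e: "short_exact R A B e" and B': "left_module R B'" and f: "linear_map R B' B f"
  shows "short_exact R A B' (pullback_ses B' f e)"
proof -
  note ed = short_exactD[OF e]
  let ?E = "ses_mid e"
  let ?P = "prod_module ?E B'"
  let ?S = "pullback_ses B' f e"
  interpret A: left_module R A by (rule ed)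
  interpret E: left_module R ?E by (rule ed)
  interpret B: left_module R B by (rule ed)
  interpret B': left_module R B' by (rule B')
  define H where "H = {(m, b) \<in> carrier ?E \<times> carrier B'. ses_out e m = f b}"
  have P: "left_module R ?P" by (rule left_module_prod[OF ed(2) B'])
  have H: "submod R ?P H"
    by (rule submodI) (auto simp: H_def linear_map_zero[OF ed(2,3,5)] linear_map_zero[OF B' ed(3) f]
        linear_map_add[OF ed(5)] linear_map_add[OF f] linear_map_smult[OF ed(5)] linear_map_smult[OF f])
  have mid: "ses_mid ?S = sub ?P H" and "in": "ses_in ?S a = (ses_in e a, \<zero>\<^bsub>B'\<^esub>)"
    and out: "ses_out ?S = snd" for a
    by (simp_all add: pullback_ses_def H_def)
  have fz: "f \<zero>\<^bsub>B'\<^esub> = \<zero>\<^bsub>B\<^esub>" by (rule linear_map_zero[OF B' ed(3) f])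
  show ?thesis
  proof (rule short_exactI)
    show "left_module R A" "left_module R B'" by fact+
    show "left_module R (ses_mid ?S)" unfolding mid by (rule left_module_sub[OF P H])
    show "linear_map R A (ses_mid ?S) (ses_in ?S)"
      unfolding mid linear_map_to_sub[OF submod_subset[OF H]] "in"
    proof
      show "linear_map R A ?P (\<lambda>a. (ses_in e a, \<zero>\<^bsub>B'\<^esub>))"
        by (rule linear_map_pair[OF ed(4) linear_map_const_zero[OF B']])
      show "(\<lambda>a. (ses_in e a, \<zero>\<^bsub>B'\<^esub>)) ` carrier A \<subseteq> H"
        using e by (auto simp: H_def short_exact_in short_exact_out_in fz)
    qed
    show "linear_map R (ses_mid ?S) B' (ses_out ?S)"
      unfolding mid out by (rule linear_map_restrict[OF linear_map_snd H])
    show "a = \<zero>\<^bsub>A\<^esub>" if "a \<in> carrier A" "ses_in ?S a = \<zero>\<^bsub>ses_mid ?S\<^esub>" for a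
      using that short_exact_in_zero_iff[OF e] by (simp add: mid "in")
    show "\<exists>m\<in>carrier (ses_mid ?S). ses_out ?S m = b" if b: "b \<in> carrier B'" for b
    proof -
      obtain m where "m \<in> carrier ?E" "ses_out e m = f b"
        using short_exact_surj[OF e linear_map_closed[OF f b]] by blast
      then show ?thesis using b by (intro bexI[of _ "(m, b)"]) (auto simp: mid out H_def)
    qed
    show "ses_out ?S (ses_in ?S a) = \<zero>\<^bsub>B'\<^esub>" if "a \<in> carrier A" for a by (simp add: out "in")
    show "\<exists>a\<in>carrier A. ses_in ?S a = z" if z: "z \<in> carrier (ses_mid ?S)" "ses_out ?S z = \<zero>\<^bsub>B'\<^esub>" for z
    proof -
      obtain m where m: "m \<in> carrier ?E" "ses_out e m = \<zero>\<^bsub>B\<^esub>" "z = (m, \<zero>\<^bsub>B'\<^esub>)"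
        using z by (auto simp: mid out H_def fz)
      then show ?thesis using short_exact_ker[OF e m(1,2)] by (auto simp: "in")
    qed
  qed
qed

lemma short_exact_prod:
  assumes e: "short_exact R A B e" and e': "short_exact R A' B' e'"
  shows "short_exact R (prod_module A A') (prod_module B B') (prod_ses e e')"
proof -
  note d = short_exactD[OF e] and d' = short_exactD[OF e']
  have lin: "linear_map R (prod_module M M') (prod_module N N') (map_prod f f')"
    if "linear_map R M N f" "linear_map R M' N' f'"
    for M :: "('r, 'u) module" and M' :: "('r, 'v) module" and N :: "('r, 's) module"
      and N' :: "('r, 't) module" and f f' and R :: "('r, 'k) ring_scheme"
    using that by (intro linear_mapI) (auto simp: linear_map_closed linear_map_add linear_map_smult)
  show ?thesis
  proof (rule short_exactI)
    fix z assume "z \<in> carrier (ses_mid (prod_ses e e'))" "ses_out (prod_ses e e') z = \<zero>\<^bsub>prod_module B B'\<^esub>"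
    then obtain m m' where m: "m \<in> carrier (ses_mid e)" "ses_out e m = \<zero>\<^bsub>B\<^esub>"
      "m' \<in> carrier (ses_mid e')" "ses_out e' m' = \<zero>\<^bsub>B'\<^esub>" "z = (m, m')" by (auto simp: prod_ses_def)
    obtain a where "a \<in> carrier A" "m = ses_in e a" by (rule short_exact_ker[OF e m(1,2)])
    moreover obtain a' where "a' \<in> carrier A'" "m' = ses_in e' a'" by (rule short_exact_ker[OF e' m(3,4)])
    ultimately show "\<exists>a\<in>carrier (prod_module A A'). ses_in (prod_ses e e') a = z"
      using m(5) by (intro bexI[of _ "(a, a')"]) (auto simp: prod_ses_def)
  next
    fix z assume "z \<in> carrier (prod_module B B')"
    then obtain b b' where b: "b \<in> carrier B" "b' \<in> carrier B'" "z = (b, b')" by auto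
    obtain m where "m \<in> carrier (ses_mid e)" "ses_out e m = b" by (rule short_exact_surj[OF e b(1)])
    moreover obtain m' where "m' \<in> carrier (ses_mid e')" "ses_out e' m' = b'" by (rule short_exact_surj[OF e' b(2)])
    ultimately show "\<exists>m\<in>carrier (ses_mid (prod_ses e e')). ses_out (prod_ses e e') m = z"
      using b(3) by (intro bexI[of _ "(m, m')"]) (auto simp: prod_ses_def)
  qed (use d d' short_exact_in_zero_iff[OF e] short_exact_in_zero_iff[OF e'] in
      \<open>auto simp: prod_ses_def left_module_prod lin short_exact_out_in[OF e] short_exact_out_in[OF e']\<close>)
qed

lemma linear_map_direct_sum_map:
  assumes M: "\<And>i. i \<in> I \<Longrightarrow> left_module R (M i)" and N: "\<And>i. i \<in> I \<Longrightarrow> left_module R (N i)"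
    and f: "\<And>i. i \<in> I \<Longrightarrow> linear_map R (M i) (N i) (f i)"
  shows "linear_map R (direct_sum I M) (direct_sum I N) (\<lambda>x. \<lambda>i\<in>I. f i (x i))"
proof (rule linear_mapI)
  fix x assume x: "x \<in> carrier (direct_sum I M)"
  show "(\<lambda>i\<in>I. f i (x i)) \<in> carrier (direct_sum I N)"
    by (rule direct_sum_memI[where F = "{i \<in> I. x i \<noteq> \<zero>\<^bsub>M i\<^esub>}"])
      (use x linear_map_zero[OF M N f] linear_map_closed[OF f] in \<open>auto simp: direct_sum_carrier\<close>)
next
  fix x y assume "x \<in> carrier (direct_sum I M)" "y \<in> carrier (direct_sum I M)"
  then show "(\<lambda>i\<in>I. f i ((x \<oplus>\<^bsub>direct_sum I M\<^esub> y) i)) =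
      (\<lambda>i\<in>I. f i (x i)) \<oplus>\<^bsub>direct_sum I N\<^esub> (\<lambda>i\<in>I. f i (y i))"
    by (auto intro!: restrict_ext simp: direct_sum_proj linear_map_add[OF f])
next
  fix r x assume "r \<in> carrier R" "x \<in> carrier (direct_sum I M)"
  then show "(\<lambda>i\<in>I. f i ((r \<odot>\<^bsub>direct_sum I M\<^esub> x) i)) = r \<odot>\<^bsub>direct_sum I N\<^esub> (\<lambda>i\<in>I. f i (x i))"
    by (auto intro!: restrict_ext simp: direct_sum_proj linear_map_smult[OF f])
qed

lemma short_exact_direct_sum:
  assumes "ring R" and e: "\<And>i. i \<in> I \<Longrightarrow> short_exact R (A i) (B i) (e i)"
  shows "short_exact R (direct_sum I A) (direct_sum I B) (direct_sum_ses I e)"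
proof -
  let ?E = "\<lambda>i. ses_mid (e i)"
  let ?S = "direct_sum_ses I e"
  note d = short_exactD[OF e]
  have mid: "ses_mid ?S = direct_sum I ?E" and "in": "ses_in ?S x = (\<lambda>i\<in>I. ses_in (e i) (x i))"
    and out: "ses_out ?S y = (\<lambda>i\<in>I. ses_out (e i) (y i))" for x y
    by (simp_all add: direct_sum_ses_def)
  have AM: "left_module R (direct_sum I A)" by (rule left_module_direct_sum[OF assms(1) d(1)])
  have EM: "left_module R (direct_sum I ?E)" by (rule left_module_direct_sum[OF assms(1) d(2)])
  have BM: "left_module R (direct_sum I B)" by (rule left_module_direct_sum[OF assms(1) d(3)])
  have zA: "\<zero>\<^bsub>direct_sum I A\<^esub> \<in> carrier (direct_sum I A)"
    using abelian_monoid.zero_closed[OF abelian_group.axioms(1)[OF left_module_group[OF AM]]] .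
  have inz: "ses_in (e i) \<zero>\<^bsub>A i\<^esub> = \<zero>\<^bsub>?E i\<^esub>" if "i \<in> I" for i
    using linear_map_zero[OF d(1,2,4)[OF that]] .
  have oz: "ses_out (e i) \<zero>\<^bsub>?E i\<^esub> = \<zero>\<^bsub>B i\<^esub>" if "i \<in> I" for i
    using linear_map_zero[OF d(2,3,5)[OF that]] .
  have Ez: "\<zero>\<^bsub>?E i\<^esub> \<in> carrier (?E i)" if "i \<in> I" for i
    using abelian_monoid.zero_closed[OF abelian_group.axioms(1)[OF left_module_group[OF d(2)[OF that]]]] .
  show ?thesis
  proof (rule short_exactI)
    show "left_module R (ses_mid ?S)" unfolding mid by (rule EM)
    show "linear_map R (direct_sum I A) (ses_mid ?S) (ses_in ?S)"
      unfolding mid "in" by (rule linear_map_direct_sum_map[OF d(1,2,4)])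
    show "linear_map R (ses_mid ?S) (direct_sum I B) (ses_out ?S)"
      unfolding mid out by (rule linear_map_direct_sum_map[OF d(2,3,5)])
  next
    fix a assume a: "a \<in> carrier (direct_sum I A)" "ses_in ?S a = \<zero>\<^bsub>ses_mid ?S\<^esub>"
    show "a = \<zero>\<^bsub>direct_sum I A\<^esub>"
    proof (rule direct_sum_eqI[OF a(1) zA])
      fix i assume i: "i \<in> I"
      have "ses_in (e i) (a i) = \<zero>\<^bsub>?E i\<^esub>"
        using fun_cong[OF a(2), of i] i by (simp add: mid "in")
      then show "a i = \<zero>\<^bsub>direct_sum I A\<^esub> i"
        using short_exact_in_zero_iff[OF e[OF i] direct_sum_proj[OF a(1) i]] i by simp
    qed
  next
    fix b assume b: "b \<in> carrier (direct_sum I B)"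
    \<comment> \<open>The preimage is taken to be zero wherever \<open>b i\<close> is zero;
      arbitrary preimages could form a family of infinite support.\<close>
    have "\<forall>i\<in>I. \<exists>m. m \<in> carrier (?E i) \<and> ses_out (e i) m = b i \<and> (b i = \<zero>\<^bsub>B i\<^esub> \<longrightarrow> m = \<zero>\<^bsub>?E i\<^esub>)"
    proof
      fix i assume i: "i \<in> I"
      obtain m where "m \<in> carrier (?E i)" "ses_out (e i) m = b i"
        by (rule short_exact_surj[OF e[OF i] direct_sum_proj[OF b i]])
      then show "\<exists>m. m \<in> carrier (?E i) \<and> ses_out (e i) m = b i \<and> (b i = \<zero>\<^bsub>B i\<^esub> \<longrightarrow> m = \<zero>\<^bsub>?E i\<^esub>)"
        using Ez[OF i] oz[OF i] by metis
    qed
    then obtain m where m: "\<forall>i\<in>I. m i \<in> carrier (?E i) \<and> ses_out (e i) (m i) = b i \<and>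
        (b i = \<zero>\<^bsub>B i\<^esub> \<longrightarrow> m i = \<zero>\<^bsub>?E i\<^esub>)" by metis
    have mc: "(\<lambda>i\<in>I. m i) \<in> carrier (direct_sum I ?E)"
      using m b by (intro direct_sum_memI[where F = "{i \<in> I. b i \<noteq> \<zero>\<^bsub>B i\<^esub>}"]) (auto simp: direct_sum_carrier)
    have "ses_out ?S (\<lambda>i\<in>I. m i) = b"
      using m b by (auto simp: out direct_sum_carrier fun_eq_iff PiE_def extensional_def)
    then show "\<exists>m\<in>carrier (ses_mid ?S). ses_out ?S m = b" using mc by (auto simp: mid)
  next
    fix a assume a: "a \<in> carrier (direct_sum I A)"
    show "ses_out ?S (ses_in ?S a) = \<zero>\<^bsub>direct_sum I B\<^esub>"
      using short_exact_out_in[OF e direct_sum_proj[OF a]] by (auto simp: out "in" intro!: restrict_ext)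
  next
    fix m assume m: "m \<in> carrier (ses_mid ?S)" "ses_out ?S m = \<zero>\<^bsub>direct_sum I B\<^esub>"
    have "\<forall>i\<in>I. \<exists>a. a \<in> carrier (A i) \<and> ses_in (e i) a = m i"
    proof
      fix i assume i: "i \<in> I"
      have mi: "m i \<in> carrier (?E i)" using m(1) i unfolding mid by (rule direct_sum_proj)
      have oi: "ses_out (e i) (m i) = \<zero>\<^bsub>B i\<^esub>" using fun_cong[OF m(2), of i] i by (simp add: out)
      show "\<exists>a. a \<in> carrier (A i) \<and> ses_in (e i) a = m i"
        using short_exact_ker[OF e[OF i] mi oi] by metis
    qed
    then obtain a where a: "\<forall>i\<in>I. a i \<in> carrier (A i) \<and> ses_in (e i) (a i) = m i" by metis
    \<comment> \<open>For preimages under \<open>ses_in\<close> the finite support is automatic, by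
      injectivity.\<close>
    have az: "a i = \<zero>\<^bsub>A i\<^esub>" if "i \<in> I" "m i = \<zero>\<^bsub>?E i\<^esub>" for i
      using short_exact_in_zero_iff[OF e[OF that(1)], of "a i"] a that by auto
    have "(\<lambda>i\<in>I. a i) \<in> carrier (direct_sum I A)"
      using a az m(1) by (intro direct_sum_memI[where F = "{i \<in> I. m i \<noteq> \<zero>\<^bsub>?E i\<^esub>}"])
        (auto simp: direct_sum_carrier mid)
    moreover have "ses_in ?S (\<lambda>i\<in>I. a i) = m"
      using a m(1) by (auto simp: "in" mid direct_sum_carrier fun_eq_iff PiE_def extensional_def)
    ultimately show "\<exists>a\<in>carrier (direct_sum I A). ses_in ?S a = m" by blast
  qed (fact AM BM)+
qed

lemma short_exact_split:
  assumes "left_module R A" "left_module R B"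
  shows "short_exact R A B (split_ses A B)"
proof -
  interpret A: left_module R A by fact
  interpret B: left_module R B by fact
  show ?thesis
    by (rule short_exactI)
      (auto simp: split_ses_def assms left_module_prod linear_map_snd intro!: linear_mapI)
qed

text \<open>Classes in \<open>Ext1\<close> see only middle terms on the type of pairs. A
  set-theoretic section \<open>s\<close> of the epimorphism makes every element of the middle term
  uniquely of the form \<open>ses_in e a + s b\<close>, and the module structure is carried along
  this bijection.\<close>

lemma short_exact_transport:
  fixes e :: "('r, 'a, 'e, 'b) ses"
  assumes e: "short_exact R A B e"
  obtains e' :: "('r, 'a, 'a \<times> 'b, 'b) ses" where "short_exact R A B e'" "ses_equiv R A e' e"
proof -
  note d = short_exactD[OF e]
  let ?E = "ses_mid e"
  interpret A: left_module R A by (rule d)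
  interpret E: left_module R ?E by (rule d)
  interpret B: left_module R B by (rule d)
  have "\<forall>b\<in>carrier B. \<exists>m. m \<in> carrier ?E \<and> ses_out e m = b" using short_exact_surj[OF e] by metis
  then obtain s where s: "\<forall>b\<in>carrier B. s b \<in> carrier ?E \<and> ses_out e (s b) = b" by metis
  define f where "f = (\<lambda>z. ses_in e (fst z) \<oplus>\<^bsub>?E\<^esub> s (snd z))"
  let ?C = "carrier A \<times> carrier B"
  have fout: "ses_out e (f z) = snd z" if "z \<in> ?C" for z
    using that s e by (auto simp: f_def linear_map_add[OF d(5)] short_exact_in short_exact_out_in)
  have inj: "inj_on f ?C"
  proof (rule inj_onI)
    fix z w assume zw: "z \<in> ?C" "w \<in> ?C" "f z = f w"
    then have "snd z = snd w" using fout by metis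
    moreover have "ses_in e (fst z) = ses_in e (fst w)"
      using zw s \<open>snd z = snd w\<close> e by (auto simp: f_def short_exact_in)
    then have "fst z = fst w" using d(6) zw by (auto dest: inj_onD)
    ultimately show "z = w" by (simp add: prod_eq_iff)
  qed
  have im: "f ` ?C = carrier ?E"
  proof
    show "f ` ?C \<subseteq> carrier ?E" using s e by (auto simp: f_def short_exact_in)
    show "carrier ?E \<subseteq> f ` ?C"
    proof
      fix m assume m: "m \<in> carrier ?E"
      let ?b = "ses_out e m"
      have b: "?b \<in> carrier B" using e m by (rule short_exact_out)
      have sb: "s ?b \<in> carrier ?E" "ses_out e (s ?b) = ?b" using s b by auto
      have "ses_out e (m \<ominus>\<^bsub>?E\<^esub> s ?b) = \<zero>\<^bsub>B\<^esub>"
        using m sb b by (simp add: linear_map_minus[OF d(2,3,5)] B.M.minus_eq_zero_iff)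
      then obtain a where a: "a \<in> carrier A" "m \<ominus>\<^bsub>?E\<^esub> s ?b = ses_in e a"
        using short_exact_ker[OF e, of "m \<ominus>\<^bsub>?E\<^esub> s ?b"] m sb by auto
      have "f (a, ?b) = m" using a m sb E.M.minus_add_cancel[of m "s ?b"] by (simp add: f_def)
      then show "m \<in> f ` ?C" using a b by force
    qed
  qed
  define g where "g = the_inv_into ?C f"
  have gf: "g (f z) = z" if "z \<in> ?C" for z using that inj by (simp add: g_def the_inv_into_f_f)
  have fg: "f (g m) = m" and gC: "g m \<in> ?C" if "m \<in> carrier ?E" for m
    using that inj im by (auto simp: g_def f_the_inv_into_f intro!: the_inv_into_into)
  \<comment> \<open>The zero is \<open>g\<close> of the zero of the middle term and not the pair of
    zeros, since \<open>s\<close> need not preserve zero.\<close>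
  define T :: "('r, 'a \<times> 'b) module" where
    "T = \<lparr>carrier = ?C, mult = undefined, one = undefined, zero = g \<zero>\<^bsub>?E\<^esub>,
      add = (\<lambda>z w. g (f z \<oplus>\<^bsub>?E\<^esub> f w)), smult = (\<lambda>r z. g (r \<odot>\<^bsub>?E\<^esub> f z))\<rparr>"
  have glin: "linear_map R ?E T g"
    by (rule linear_mapI) (auto simp: T_def fg gC dest: gC)
  have fc: "f z \<in> carrier ?E" if "z \<in> ?C" for z using im that by blast
  have flin: "linear_map R T ?E f"
    by (rule linear_mapI) (auto simp: T_def fg fc simp del: mem_Sigma_iff)
  have gim: "g ` carrier ?E = carrier T"
  proof
    show "g ` carrier ?E \<subseteq> carrier T" using gC by (simp add: T_def image_subset_iff)
    show "carrier T \<subseteq> g ` carrier ?E"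
    proof
      fix z assume "z \<in> carrier T"
      then have "z \<in> ?C" by (simp add: T_def)
      then show "z \<in> g ` carrier ?E" using gf fc by (metis imageI)
    qed
  qed
  have T: "left_module R T"
    by (rule left_module_image[OF d(2) glin gim]) (simp add: T_def)
  define e' where "e' = \<lparr>ses_in = (\<lambda>a. g (ses_in e a)), ses_mid = T, ses_out = (\<lambda>z. ses_out e (f z))\<rparr>"
  have CT: "carrier T = ?C" by (simp add: T_def)
  show thesis
  proof (rule that[of e'])
    show "short_exact R A B e'"
    proof (rule short_exactI)
      show "left_module R (ses_mid e')" by (simp add: e'_def T)
      show "linear_map R A (ses_mid e') (ses_in e')"
        using linear_map_comp[OF d(4) glin] by (simp add: e'_def)
      show "linear_map R (ses_mid e') B (ses_out e')"
        using linear_map_comp[OF flin d(5)] by (simp add: e'_def)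
      show "a = \<zero>\<^bsub>A\<^esub>" if a: "a \<in> carrier A" "ses_in e' a = \<zero>\<^bsub>ses_mid e'\<^esub>" for a
      proof -
        have "g (ses_in e a) = g \<zero>\<^bsub>?E\<^esub>" using a by (simp add: e'_def T_def)
        then have "ses_in e a = \<zero>\<^bsub>?E\<^esub>" using fg short_exact_in[OF e a(1)] E.M.zero_closed by metis
        then show ?thesis using short_exact_in_zero_iff[OF e a(1)] by simp
      qed
      show "\<exists>m\<in>carrier (ses_mid e'). ses_out e' m = b" if b: "b \<in> carrier B" for b
        using fout[of "(\<zero>\<^bsub>A\<^esub>, b)"] b by (intro bexI[of _ "(\<zero>\<^bsub>A\<^esub>, b)"]) (auto simp: e'_def CT)
      show "ses_out e' (ses_in e' a) = \<zero>\<^bsub>B\<^esub>" if "a \<in> carrier A" for a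
        using that e by (simp add: e'_def fg short_exact_in short_exact_out_in)
      show "\<exists>a\<in>carrier A. ses_in e' a = z" if z: "z \<in> carrier (ses_mid e')" "ses_out e' z = \<zero>\<^bsub>B\<^esub>" for z
      proof -
        have zC: "z \<in> ?C" using z(1) by (simp add: e'_def CT)
        obtain a where "a \<in> carrier A" "f z = ses_in e a"
          using short_exact_ker[OF e fc[OF zC]] z(2) by (auto simp: e'_def)
        then show ?thesis using gf[OF zC] by (auto simp: e'_def)
      qed
    qed (fact d)+
    show "ses_equiv R A e' e"
      unfolding ses_equiv_def
      using flin e by (intro exI[of _ f]) (simp add: e'_def fg short_exact_in)
  qed
qed

text \<open>The short five lemma. It makes \<open>ses_equiv\<close>, which asks for a morphism in
  one direction only, symmetric on exact sequences.\<close>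

lemma ses_equiv_inverse:
  assumes e: "short_exact R A B e" and e': "short_exact R A B e'" and eq: "ses_equiv R A e e'"
  shows "ses_equiv R A e' e"
proof -
  note d = short_exactD[OF e] and d' = short_exactD[OF e']
  let ?E = "ses_mid e" and ?E' = "ses_mid e'"
  interpret A: left_module R A by (rule d)
  interpret E: left_module R ?E by (rule d)
  interpret E': left_module R ?E' by (rule d')
  interpret B: left_module R B by (rule d)
  obtain h where h: "linear_map R ?E ?E' h" "\<And>a. a \<in> carrier A \<Longrightarrow> h (ses_in e a) = ses_in e' a"
    "\<And>m. m \<in> carrier ?E \<Longrightarrow> ses_out e' (h m) = ses_out e m"
    using eq unfolding ses_equiv_def by blast
  have "inj_on h (carrier ?E)"
    unfolding linear_map_inj_on_iff[OF d(2) d'(2) h(1)]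
  proof (intro ballI impI)
    fix m assume m: "m \<in> carrier ?E" "h m = \<zero>\<^bsub>?E'\<^esub>"
    then have "ses_out e m = \<zero>\<^bsub>B\<^esub>" using h(3)[OF m(1)] linear_map_zero[OF d'(2,3,5)] by simp
    then obtain a where a: "a \<in> carrier A" "m = ses_in e a" using short_exact_ker[OF e m(1)] by blast
    then have "a = \<zero>\<^bsub>A\<^esub>" using h(2)[OF a(1)] m(2) short_exact_in_zero_iff[OF e' a(1)] by simp
    then show "m = \<zero>\<^bsub>?E\<^esub>" using a linear_map_zero[OF d(1,2,4)] by simp
  qed
  moreover have "h ` carrier ?E = carrier ?E'"
  proof
    show "h ` carrier ?E \<subseteq> carrier ?E'" using linear_map_closed[OF h(1)] by auto
    show "carrier ?E' \<subseteq> h ` carrier ?E"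
    proof
      fix z assume z: "z \<in> carrier ?E'"
      obtain m where m: "m \<in> carrier ?E" "ses_out e m = ses_out e' z"
        by (rule short_exact_surj[OF e short_exact_out[OF e' z]])
      have hm: "h m \<in> carrier ?E'" using h(1) m(1) by (rule linear_map_closed)
      have "ses_out e' (z \<ominus>\<^bsub>?E'\<^esub> h m) = \<zero>\<^bsub>B\<^esub>"
        using z hm m h(3) short_exact_out[OF e m(1)]
        by (simp add: linear_map_minus[OF d'(2,3,5)] B.M.minus_eq_zero_iff short_exact_out[OF e'])
      then obtain a where a: "a \<in> carrier A" "z \<ominus>\<^bsub>?E'\<^esub> h m = ses_in e' a"
        using short_exact_ker[OF e', of "z \<ominus>\<^bsub>?E'\<^esub> h m"] z hm by auto
      have "h (ses_in e a \<oplus>\<^bsub>?E\<^esub> m) = z"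
        using a m hm z h(2) E'.M.minus_add_cancel[OF z hm]
        by (simp add: linear_map_add[OF h(1)] short_exact_in[OF e])
      then show "z \<in> h ` carrier ?E" using a m short_exact_in[OF e a(1)] by (metis E.M.a_closed imageI)
    qed
  qed
  ultimately obtain k where k: "linear_map R ?E' ?E k" "\<And>x. x \<in> carrier ?E \<Longrightarrow> k (h x) = x"
    "\<And>y. y \<in> carrier ?E' \<Longrightarrow> h (k y) = y"
    using linear_map_inverse[OF d(2) d'(2) h(1)] unfolding bij_betw_def by blast
  show ?thesis
    unfolding ses_equiv_def
  proof (intro exI conjI ballI)
    show "linear_map R ?E' ?E k" by fact
    show "k (ses_in e' a) = ses_in e a" if "a \<in> carrier A" for a
      using that k(2)[OF short_exact_in[OF e that]] h(2) by simp
    show "ses_out e (k m) = ses_out e' m" if "m \<in> carrier ?E'" for m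
      using k(3)[OF that] h(3)[OF linear_map_closed[OF k(1) that]] by simp
  qed
qed

section \<open>Extensions and presentations\<close>

text \<open>The universal property of \<open>A\<close> as kernel of the epimorphism, obtained by
  inverting \<open>ses_in e\<close> on its image.\<close>

lemma short_exact_lift_in:
  assumes e: "short_exact R A B e" and L: "left_module R L" and l: "linear_map R L (ses_mid e) l"
    and z: "\<And>x. x \<in> carrier L \<Longrightarrow> ses_out e (l x) = \<zero>\<^bsub>B\<^esub>"
  obtains t where "linear_map R L A t" "\<And>x. x \<in> carrier L \<Longrightarrow> ses_in e (t x) = l x"
proof -
  note d = short_exactD[OF e]
  let ?H = "ses_in e ` carrier A"
  have sk: "submod R (ses_mid e) ?H" by (rule submod_image[OF d(1,2,4) submod_carrier[OF d(1)]])
  have i': "linear_map R A (sub (ses_mid e) ?H) (ses_in e)"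
    using d(4) by (subst linear_map_to_sub[OF submod_subset[OF sk]]) auto
  have bij: "bij_betw (ses_in e) (carrier A) (carrier (sub (ses_mid e) ?H))"
    using d(6) by (simp add: bij_betw_def)
  obtain c where c: "linear_map R (sub (ses_mid e) ?H) A c"
    and c2: "\<And>y. y \<in> carrier (sub (ses_mid e) ?H) \<Longrightarrow> ses_in e (c y) = y"
    using linear_map_inverse[OF d(1) left_module_sub[OF d(2) sk] i' bij] by blast
  have lH: "l x \<in> ?H" if "x \<in> carrier L" for x
    using that z linear_map_closed[OF l] by (simp add: d(8))
  have l': "linear_map R L (sub (ses_mid e) ?H) l"
    using l lH by (subst linear_map_to_sub[OF submod_subset[OF sk]]) auto
  show thesis
  proof (rule that[OF linear_map_comp[OF l' c]])
    show "ses_in e (c (l x)) = l x" if "x \<in> carrier L" for x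
      using c2 lH[OF that] by simp
  qed
qed

text \<open>
  Extensions of \<open>Y\<close> by \<open>X\<close> are computed from an epimorphism \<open>\<pi>\<close> from a free module \<open>G\<close> onto \<open>X\<close>
  with kernel \<open>K\<close>: an extension is represented by the linear maps \<open>K \<rightarrow> Y\<close> that arise by lifting
  \<open>\<pi>\<close> to the middle term.  On representatives the Baer sum becomes the pointwise sum.
\<close>

locale presentation =
  fixes R :: "('r, 'k) ring_scheme" and X :: "('r, 'x) module" and n :: nat and \<pi> :: "(nat \<Rightarrow> 'r) \<Rightarrow> 'x"
  assumes X: "left_module R X" and \<pi>: "linear_map R (free R {..<n}) X \<pi>"
    and surj: "\<pi> ` carrier (free R {..<n}) = carrier X"
begin

definition G :: "('r, nat \<Rightarrow> 'r) module" where "G = free R {..<n}"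

definition K :: "(nat \<Rightarrow> 'r) set" where "K = {x \<in> carrier G. \<pi> x = \<zero>\<^bsub>X\<^esub>}"

text \<open>A relation, not a function, because the lift of \<pi> is not unique. Only the values of
  \<alpha> on \<open>K\<close> count.\<close>

definition rep :: "('r, 'y, 'e, 'x) ses \<Rightarrow> ((nat \<Rightarrow> 'r) \<Rightarrow> 'y) \<Rightarrow> bool" where
  "rep e \<alpha> \<longleftrightarrow> (\<exists>l. linear_map R G (ses_mid e) l \<and> (\<forall>g\<in>carrier G. ses_out e (l g) = \<pi> g) \<and>
     (\<forall>k\<in>K. l k = ses_in e (\<alpha> k)))"

text \<open>The connecting map Hom(K, Y) -> Ext^1(X, Y), with the class given as the set of its
  members.\<close>

definition cls :: "('r, 'y) module \<Rightarrow> ((nat \<Rightarrow> 'r) \<Rightarrow> 'y) \<Rightarrow> ('r, 'y, 'x) extension set" where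
  "cls Y \<alpha> = {e. short_exact R Y X e \<and> rep e \<alpha>}"

lemma ring: "ring R" by (rule left_module_ring[OF X])

lemma G: "left_module R G" unfolding G_def by (rule left_module_free[OF ring])

lemma \<pi>G: "linear_map R G X \<pi>" using \<pi> by (simp add: G_def)

lemma surjG: "\<pi> ` carrier G = carrier X" using surj by (simp add: G_def)

lemma K: "submod R G K" unfolding K_def by (rule submod_kernel[OF G X \<pi>G])

lemma KM: "left_module R (sub G K)" by (rule left_module_sub[OF G K])

lemma K_mem: "k \<in> K \<Longrightarrow> k \<in> carrier G" and K_\<pi>: "k \<in> K \<Longrightarrow> \<pi> k = \<zero>\<^bsub>X\<^esub>"
  by (simp_all add: K_def)

lemma G_lift:
  assumes "left_module R A" "left_module R B" "linear_map R A B g" "linear_map R G B h"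
    and "h ` carrier G \<subseteq> g ` carrier A"
  obtains l where "linear_map R G A l" "\<And>x. x \<in> carrier G \<Longrightarrow> g (l x) = h x"
proof -
  have im: "h (free_gen R {..<n} i) \<in> g ` carrier A" if "i \<in> {..<n}" for i
    using assms(5) free_gen_closed[OF ring that] by (auto simp: G_def)
  show thesis
    using free_lift[OF ring assms(1,2,3) assms(4)[unfolded G_def] im] that unfolding G_def by blast
qed

lemma G_factor:
  assumes "left_module R N" "linear_map R G N f" "\<And>k. k \<in> K \<Longrightarrow> f k = \<zero>\<^bsub>N\<^esub>"
  obtains w where "linear_map R X N w" "\<And>g. g \<in> carrier G \<Longrightarrow> w (\<pi> g) = f g"
  using linear_map_factor[OF G X assms(1) \<pi>G surjG assms(2)] assms(3) by (auto simp: K_def)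

lemma rep_exists:
  assumes e: "short_exact R Y X e"
  obtains \<alpha> where "linear_map R (sub G K) Y \<alpha>" "rep e \<alpha>"
proof -
  note d = short_exactD[OF e]
  obtain l where l: "linear_map R G (ses_mid e) l" "\<And>x. x \<in> carrier G \<Longrightarrow> ses_out e (l x) = \<pi> x"
    using G_lift[OF d(2,3,5) \<pi>G] d(7) surjG by blast
  obtain \<alpha> where a: "linear_map R (sub G K) Y \<alpha>" "\<And>x. x \<in> carrier (sub G K) \<Longrightarrow> ses_in e (\<alpha> x) = l x"
    by (rule short_exact_lift_in[OF e KM linear_map_restrict[OF l(1) K]]) (simp_all add: l K_mem K_\<pi>)
  have "rep e \<alpha>" unfolding rep_def using l a by auto
  with a(1) show thesis by (rule that)
qed

text \<open>Two lifts of \<pi> differ by a map into the kernel of the epimorphism, that is into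
  \<open>Y\<close>, and this difference is defined on all of \<open>G\<close>.\<close>

lemma rep_diff:
  assumes e: "short_exact R Y X e" and \<alpha>: "linear_map R (sub G K) Y \<alpha>" and \<beta>: "linear_map R (sub G K) Y \<beta>"
    and "rep e \<alpha>" "rep e \<beta>"
  obtains t where "linear_map R G Y t" "\<And>k. k \<in> K \<Longrightarrow> \<alpha> k = \<beta> k \<oplus>\<^bsub>Y\<^esub> t k"
proof -
  note d = short_exactD[OF e]
  interpret Y: left_module R Y by (rule d)
  interpret E: left_module R "ses_mid e" by (rule d)
  interpret X: left_module R X by (rule X)
  obtain l l' where l: "linear_map R G (ses_mid e) l" "\<forall>g\<in>carrier G. ses_out e (l g) = \<pi> g"
     "\<forall>k\<in>K. l k = ses_in e (\<alpha> k)"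
    and l': "linear_map R G (ses_mid e) l'" "\<forall>g\<in>carrier G. ses_out e (l' g) = \<pi> g"
     "\<forall>k\<in>K. l' k = ses_in e (\<beta> k)"
    using assms(4,5) unfolding rep_def by blast
  obtain t where t: "linear_map R G Y t" "\<And>x. x \<in> carrier G \<Longrightarrow> ses_in e (t x) = l x \<ominus>\<^bsub>ses_mid e\<^esub> l' x"
  proof (rule short_exact_lift_in[OF e G linear_map_diff[OF d(2) l(1) l'(1)]])
    fix x assume x: "x \<in> carrier G"
    then show "ses_out e (l x \<ominus>\<^bsub>ses_mid e\<^esub> l' x) = \<zero>\<^bsub>X\<^esub>"
      using l l' linear_map_closed[OF l(1) x] linear_map_closed[OF l'(1) x] linear_map_closed[OF \<pi>G x]
      by (simp add: linear_map_minus[OF d(2,3,5)] X.M.minus_eq_zero_iff)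
  qed blast
  show thesis
  proof (rule that[OF t(1)])
    fix k assume k: "k \<in> K"
    have mem: "\<alpha> k \<in> carrier Y" "\<beta> k \<in> carrier Y" "t k \<in> carrier Y" "l k \<in> carrier (ses_mid e)"
      "l' k \<in> carrier (ses_mid e)"
      using k K_mem[OF k] linear_map_closed[OF \<alpha>, of k] linear_map_closed[OF \<beta>, of k]
        linear_map_closed[OF t(1), of k] linear_map_closed[OF l(1), of k] linear_map_closed[OF l'(1), of k]
      by simp_all
    have "ses_in e (\<beta> k \<oplus>\<^bsub>Y\<^esub> t k) = l' k \<oplus>\<^bsub>ses_mid e\<^esub> (l k \<ominus>\<^bsub>ses_mid e\<^esub> l' k)"
      using k mem t(2)[OF K_mem[OF k]] l'(3) by (simp add: linear_map_add[OF d(4)])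
    also have "\<dots> = l k"
      using E.M.minus_add_cancel[OF mem(4,5)] mem by (simp add: E.M.a_comm)
    also have "\<dots> = ses_in e (\<alpha> k)" using l(3) k by simp
    finally show "\<alpha> k = \<beta> k \<oplus>\<^bsub>Y\<^esub> t k" using d(6) mem by (auto dest: inj_onD)
  qed
qed

text \<open>The converse of \<open>rep_diff\<close>: adding \<open>ses_in e\<close> after
  \<open>t\<close> to a lift of \<pi> gives another lift.\<close>

lemma rep_shift:
  assumes e: "short_exact R Y X e" and \<beta>: "linear_map R (sub G K) Y \<beta>" and "rep e \<beta>"
    and t: "linear_map R G Y t" and eq: "\<And>k. k \<in> K \<Longrightarrow> \<alpha> k = \<beta> k \<oplus>\<^bsub>Y\<^esub> t k"
  shows "rep e \<alpha>"
proof -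
  note d = short_exactD[OF e]
  interpret X: left_module R X by (rule X)
  obtain l where l: "linear_map R G (ses_mid e) l" "\<forall>g\<in>carrier G. ses_out e (l g) = \<pi> g"
     "\<forall>k\<in>K. l k = ses_in e (\<beta> k)"
    using assms(3) unfolding rep_def by blast
  show ?thesis
    unfolding rep_def
  proof (intro exI conjI ballI)
    show "linear_map R G (ses_mid e) (\<lambda>g. l g \<oplus>\<^bsub>ses_mid e\<^esub> ses_in e (t g))"
      by (rule linear_map_plus[OF d(2) l(1) linear_map_comp[OF t d(4)]])
    show "ses_out e (l g \<oplus>\<^bsub>ses_mid e\<^esub> ses_in e (t g)) = \<pi> g" if g: "g \<in> carrier G" for g
      using g l(2) linear_map_closed[OF l(1) g] linear_map_closed[OF t g] linear_map_closed[OF \<pi>G g]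
      by (simp add: linear_map_add[OF d(5)] short_exact_in[OF e] short_exact_out_in[OF e])
    show "l k \<oplus>\<^bsub>ses_mid e\<^esub> ses_in e (t k) = ses_in e (\<alpha> k)" if k: "k \<in> K" for k
      using k l(3) linear_map_closed[OF t K_mem[OF k]] linear_map_closed[OF \<beta>, of k]
      by (simp add: eq linear_map_add[OF d(4)])
  qed
qed

text \<open>Both middle terms are quotients of the product of \<open>Y\<close> and \<open>G\<close>,
  by \<open>p\<close> and by \<open>q\<close>. A pair \<open>(y, k)\<close> is killed exactly if
  \<open>k\<close> is in \<open>K\<close> and \<open>y + \<alpha> k\<close> is zero, a condition
  that no longer mentions the sequence; so \<open>q\<close> factors through
  \<open>p\<close>.\<close>

lemma rep_equiv:
  assumes e: "short_exact R Y X e" and e': "short_exact R Y X e'" and \<alpha>: "linear_map R (sub G K) Y \<alpha>"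
    and "rep e \<alpha>" "rep e' \<alpha>"
  shows "ses_equiv R Y e e'"
proof -
  note d = short_exactD[OF e] and d' = short_exactD[OF e']
  let ?E = "ses_mid e" and ?E' = "ses_mid e'" and ?P = "prod_module Y G"
  interpret X: left_module R X by (rule X)
  interpret Y: left_module R Y by (rule d)
  interpret G: left_module R G by (rule G)
  interpret E: left_module R ?E by (rule d)
  interpret E': left_module R ?E' by (rule d')
  have P: "left_module R ?P" by (rule left_module_prod[OF d(1) G])
  obtain l l' where l: "linear_map R G ?E l" "\<forall>g\<in>carrier G. ses_out e (l g) = \<pi> g"
     "\<forall>k\<in>K. l k = ses_in e (\<alpha> k)"
    and l': "linear_map R G ?E' l'" "\<forall>g\<in>carrier G. ses_out e' (l' g) = \<pi> g"
     "\<forall>k\<in>K. l' k = ses_in e' (\<alpha> k)"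
    using assms(4,5) unfolding rep_def by blast
  define p where "p = (\<lambda>z. ses_in e (fst z) \<oplus>\<^bsub>?E\<^esub> l (snd z))"
  define q where "q = (\<lambda>z. ses_in e' (fst z) \<oplus>\<^bsub>?E'\<^esub> l' (snd z))"
  have p: "linear_map R ?P ?E p" unfolding p_def by (rule linear_map_pairI[OF d(2) d(4) l(1)])
  have q: "linear_map R ?P ?E' q" unfolding q_def by (rule linear_map_pairI[OF d'(2) d'(4) l'(1)])
  have pout: "ses_out e (p z) = \<pi> (snd z)" and qout: "ses_out e' (q z) = \<pi> (snd z)" if "z \<in> carrier ?P" for z
  proof -
    have c: "fst z \<in> carrier Y" "snd z \<in> carrier G" using that by auto
    show "ses_out e (p z) = \<pi> (snd z)"
      using c l(2) linear_map_closed[OF l(1) c(2)] linear_map_closed[OF \<pi>G c(2)]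
      by (simp add: p_def linear_map_add[OF d(5)] short_exact_in[OF e] short_exact_out_in[OF e])
    show "ses_out e' (q z) = \<pi> (snd z)"
      using c l'(2) linear_map_closed[OF l'(1) c(2)] linear_map_closed[OF \<pi>G c(2)]
      by (simp add: q_def linear_map_add[OF d'(5)] short_exact_in[OF e'] short_exact_out_in[OF e'])
  qed
  have psurj: "p ` carrier ?P = carrier ?E"
  proof
    show "p ` carrier ?P \<subseteq> carrier ?E" using linear_map_closed[OF p] by blast
    show "carrier ?E \<subseteq> p ` carrier ?P"
    proof
      fix m assume m: "m \<in> carrier ?E"
      then have "ses_out e m \<in> \<pi> ` carrier G" using surjG short_exact_out[OF e m] by simp
      then obtain g where g: "g \<in> carrier G" "ses_out e m = \<pi> g" by blast
      have lg: "l g \<in> carrier ?E" by (rule linear_map_closed[OF l(1) g(1)])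
      have "ses_out e (m \<ominus>\<^bsub>?E\<^esub> l g) = \<zero>\<^bsub>X\<^esub>"
        using m g l(2) lg linear_map_closed[OF \<pi>G g(1)]
        by (simp add: linear_map_minus[OF d(2,3,5)] X.M.minus_eq_zero_iff)
      then obtain y where y: "y \<in> carrier Y" "m \<ominus>\<^bsub>?E\<^esub> l g = ses_in e y"
        using short_exact_ker[OF e, of "m \<ominus>\<^bsub>?E\<^esub> l g"] m lg by auto
      have "p (y, g) = m" using y E.M.minus_add_cancel[OF m lg] by (simp add: p_def)
      then show "m \<in> p ` carrier ?P" using y g by force
    qed
  qed
  have ker: "q z = \<zero>\<^bsub>?E'\<^esub>" if z: "z \<in> carrier ?P" "p z = \<zero>\<^bsub>?E\<^esub>" for z
  proof -
    have c: "fst z \<in> carrier Y" "snd z \<in> carrier G" using z by auto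
    have "\<pi> (snd z) = \<zero>\<^bsub>X\<^esub>" using pout[OF z(1)] z(2) linear_map_zero[OF d(2,3,5)] by simp
    then have k: "snd z \<in> K" using c by (simp add: K_def)
    have a: "\<alpha> (snd z) \<in> carrier Y" using linear_map_closed[OF \<alpha>, of "snd z"] k by simp
    have "ses_in e (fst z \<oplus>\<^bsub>Y\<^esub> \<alpha> (snd z)) = \<zero>\<^bsub>?E\<^esub>"
      using z(2) k c a l(3) by (simp add: p_def linear_map_add[OF d(4)])
    then have "fst z \<oplus>\<^bsub>Y\<^esub> \<alpha> (snd z) = \<zero>\<^bsub>Y\<^esub>" using short_exact_in_zero_iff[OF e] c a by simp
    then have "ses_in e' (fst z \<oplus>\<^bsub>Y\<^esub> \<alpha> (snd z)) = \<zero>\<^bsub>?E'\<^esub>" using short_exact_in_zero_iff[OF e'] c a by simp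
    then show ?thesis using k c a l'(3) by (simp add: q_def linear_map_add[OF d'(4)])
  qed
  obtain h where h: "linear_map R ?E ?E' h" "\<And>z. z \<in> carrier ?P \<Longrightarrow> h (p z) = q z"
    using linear_map_factor[OF P d(2) d'(2) p psurj q ker] by blast
  show ?thesis
    unfolding ses_equiv_def
  proof (intro exI conjI ballI)
    show "linear_map R ?E ?E' h" by fact
    show "h (ses_in e y) = ses_in e' y" if y: "y \<in> carrier Y" for y
      using h(2)[of "(y, \<zero>\<^bsub>G\<^esub>)"] y short_exact_in[OF e y] short_exact_in[OF e' y]
      by (simp add: p_def q_def linear_map_zero[OF G d(2) l(1)] linear_map_zero[OF G d'(2) l'(1)])
    show "ses_out e' (h m) = ses_out e m" if m: "m \<in> carrier ?E" for m
    proof -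
      obtain z where z: "z \<in> carrier ?P" "m = p z" using m psurj by blast
      then show ?thesis using h(2) pout qout by simp
    qed
  qed
qed

lemma rep_ses_equiv:
  assumes e: "short_exact R Y X e" and "ses_equiv R Y e e'" and \<alpha>: "linear_map R (sub G K) Y \<alpha>" and "rep e \<alpha>"
  shows "rep e' \<alpha>"
proof -
  obtain l where l: "linear_map R G (ses_mid e) l" "\<forall>g\<in>carrier G. ses_out e (l g) = \<pi> g"
     "\<forall>k\<in>K. l k = ses_in e (\<alpha> k)"
    using assms(4) unfolding rep_def by blast
  obtain h where h: "linear_map R (ses_mid e) (ses_mid e') h"
    "\<And>a. a \<in> carrier Y \<Longrightarrow> h (ses_in e a) = ses_in e' a"
    "\<And>m. m \<in> carrier (ses_mid e) \<Longrightarrow> ses_out e' (h m) = ses_out e m"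
    using assms(2) unfolding ses_equiv_def by blast
  show ?thesis
    unfolding rep_def
  proof (intro exI conjI ballI)
    show "linear_map R G (ses_mid e') (\<lambda>g. h (l g))" by (rule linear_map_comp[OF l(1) h(1)])
    show "ses_out e' (h (l g)) = \<pi> g" if "g \<in> carrier G" for g
      using that l(2) h(3) linear_map_closed[OF l(1) that] by simp
    show "h (l k) = ses_in e' (\<alpha> k)" if "k \<in> K" for k
      using that l(3) h(2) linear_map_closed[OF \<alpha>, of k] by simp
  qed
qed

text \<open>Equivalence preserves representatives, and a common representative forces equivalence.
  One representative therefore determines the whole class.\<close>

lemma ext_class_rep:
  assumes e: "short_exact R Y X e" and \<alpha>: "linear_map R (sub G K) Y \<alpha>" and "rep e \<alpha>"
  shows "ext_class R X Y e = cls Y \<alpha>"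
proof
  show "ext_class R X Y e \<subseteq> cls Y \<alpha>"
    unfolding ext_class_def cls_def
    using rep_ses_equiv[OF e ses_equiv_inverse[OF _ e] \<alpha> assms(3)] by blast
  show "cls Y \<alpha> \<subseteq> ext_class R X Y e"
    unfolding ext_class_def cls_def
    using rep_equiv[OF _ e \<alpha> _ assms(3)] by blast
qed

lemma cls_cong: "(\<And>k. k \<in> K \<Longrightarrow> \<alpha> k = \<beta> k) \<Longrightarrow> cls Y \<alpha> = cls Y \<beta>"
  by (simp add: cls_def rep_def)

lemma cls_nonempty:
  assumes Y: "left_module R Y" and \<alpha>: "linear_map R (sub G K) Y \<alpha>"
  obtains e where "e \<in> cls Y \<alpha>"
proof -
  interpret Y: left_module R Y by (rule Y)
  \<comment> \<open>The sequence of the presentation itself. Its push-out along \<alpha> is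
    represented by \<alpha>, and is then moved to the type required by \<open>cls\<close>.\<close>
  define e0 where "e0 = \<lparr>ses_in = (\<lambda>k. k), ses_mid = G, ses_out = \<pi>\<rparr>"
  have s: "ses_in e0 k = k" "ses_mid e0 = G" "ses_out e0 = \<pi>" for k by (simp_all add: e0_def)
  have e0: "short_exact R (sub G K) X e0"
  proof (rule short_exactI)
    show "linear_map R (sub G K) (ses_mid e0) (ses_in e0)"
      using linear_map_restrict[OF linear_map_ident K] by (simp add: e0_def)
    show "\<exists>m\<in>carrier (ses_mid e0). ses_out e0 m = b" if "b \<in> carrier X" for b
      using that unfolding s surjG[symmetric] by blast
  qed (use X G \<pi>G KM in \<open>auto simp: s K_def\<close>)
  let ?S = "pushout_ses (sub G K) Y \<alpha> e0"
  note S = short_exact_pushout[OF e0 Y \<alpha>]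
  have rS: "rep ?S \<alpha>"
    unfolding rep_def
  proof (intro exI conjI ballI)
    have "linear_map R G (prod_module Y G) (\<lambda>g. (\<zero>\<^bsub>Y\<^esub>, g))"
      by (rule linear_map_pair[OF linear_map_const_zero[OF Y] linear_map_ident])
    then show "linear_map R G (ses_mid ?S) (\<lambda>g. push_coset (sub G K) Y \<alpha> e0 (\<zero>\<^bsub>Y\<^esub>, g))"
      using linear_map_comp[OF _ linear_map_push_coset[OF e0 Y \<alpha>]] by (simp add: s)
    show "ses_out ?S (push_coset (sub G K) Y \<alpha> e0 (\<zero>\<^bsub>Y\<^esub>, g)) = \<pi> g" if "g \<in> carrier G" for g
      using pushout_out[OF e0 Y \<alpha>, of "\<zero>\<^bsub>Y\<^esub>" g] that by (simp add: s)
    show "push_coset (sub G K) Y \<alpha> e0 (\<zero>\<^bsub>Y\<^esub>, k) = ses_in ?S (\<alpha> k)" if "k \<in> K" for k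
      using push_coset_in[OF e0 Y \<alpha>, of k] that by (simp add: s)
  qed
  obtain e :: "('r, 'a, 'x) extension" where e: "short_exact R Y X e" "ses_equiv R Y e ?S"
    using short_exact_transport[OF S] by blast
  have "rep e \<alpha>" by (rule rep_ses_equiv[OF S ses_equiv_inverse[OF e(1) S e(2)] \<alpha> rS])
  then show thesis using e(1) that by (simp add: cls_def)
qed

text \<open>Together with \<open>cls_eqI\<close>: the fibres of the connecting map are the cosets of
  the restrictions of maps defined on \<open>G\<close>.\<close>

lemma cls_eqD:
  assumes Y: "left_module R Y" and \<alpha>: "linear_map R (sub G K) Y \<alpha>" and \<beta>: "linear_map R (sub G K) Y \<beta>"
    and eq: "cls Y \<alpha> = cls Y \<beta>"
  obtains t where "linear_map R G Y t" "\<And>k. k \<in> K \<Longrightarrow> \<alpha> k = \<beta> k \<oplus>\<^bsub>Y\<^esub> t k"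
proof -
  obtain e where "e \<in> cls Y \<alpha>" by (rule cls_nonempty[OF Y \<alpha>])
  with eq show thesis using rep_diff[OF _ \<alpha> \<beta>] that unfolding cls_def by blast
qed

lemma cls_eqI:
  assumes Y: "left_module R Y" and \<alpha>: "linear_map R (sub G K) Y \<alpha>" and \<beta>: "linear_map R (sub G K) Y \<beta>"
    and t: "linear_map R G Y t" "\<And>k. k \<in> K \<Longrightarrow> \<alpha> k = \<beta> k \<oplus>\<^bsub>Y\<^esub> t k"
  shows "cls Y \<alpha> = cls Y \<beta>"
proof -
  obtain e where e: "e \<in> cls Y \<beta>" by (rule cls_nonempty[OF Y \<beta>])
  then have e': "short_exact R Y X e" "rep e \<beta>" by (simp_all add: cls_def)
  have "rep e \<alpha>" using rep_shift[OF e'(1) \<beta> e'(2) t(1), of \<alpha>] t(2) by blast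
  then show ?thesis using ext_class_rep[OF e'(1) \<alpha>] ext_class_rep[OF e'(1) \<beta> e'(2)] by simp
qed

section \<open>The operations of \<open>Ext1\<close> on representatives\<close>

lemma Ext1_carrier:
  assumes Y: "left_module R Y"
  shows "carrier (Ext1 R X Y) = {cls Y \<alpha> | \<alpha>. linear_map R (sub G K) Y \<alpha>}"
proof -
  have "\<exists>\<alpha>. ext_class R X Y e = cls Y \<alpha> \<and> linear_map R (sub G K) Y \<alpha>"
    if "short_exact R Y X e" for e :: "('r, 'a, 'x) extension"
    using rep_exists[OF that] ext_class_rep[OF that] by metis
  moreover have "\<exists>e :: ('r, 'a, 'x) extension. cls Y \<alpha> = ext_class R X Y e \<and> short_exact R Y X e"
    if a: "linear_map R (sub G K) Y \<alpha>" for \<alpha>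
  proof -
    obtain e where e: "e \<in> cls Y \<alpha>" by (rule cls_nonempty[OF Y a])
    then have "short_exact R Y X e" "rep e \<alpha>" by (simp_all add: cls_def)
    then show ?thesis using ext_class_rep[OF _ a, of e] by (intro exI[of _ e]) simp
  qed
  ultimately show ?thesis by (auto simp: Ext1_def)
qed

lemma Ext1_zero:
  assumes Y: "left_module R Y"
  shows "\<zero>\<^bsub>Ext1 R X Y\<^esub> = cls Y (\<lambda>k. \<zero>\<^bsub>Y\<^esub>)"
proof -
  have "rep (split_ses Y X) (\<lambda>k. \<zero>\<^bsub>Y\<^esub>)"
    unfolding rep_def
  proof (intro exI conjI ballI)
    show "linear_map R G (ses_mid (split_ses Y X)) (\<lambda>g. (\<zero>\<^bsub>Y\<^esub>, \<pi> g))"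
      using linear_map_pair[OF linear_map_const_zero[OF Y] \<pi>G] by (simp add: split_ses_def)
  qed (simp_all add: split_ses_def K_\<pi>)
  then show ?thesis
    using ext_class_rep[OF short_exact_split[OF Y X] linear_map_const_zero[OF Y]]
    by (simp add: Ext1_def)
qed

lemma short_exact_baer_sum:
  assumes e: "short_exact R Y X e" and e': "short_exact R Y X e'"
  shows "short_exact R Y X (baer_sum X Y e e')"
    and "rep e \<alpha> \<Longrightarrow> rep e' \<beta> \<Longrightarrow> linear_map R (sub G K) Y \<alpha> \<Longrightarrow> linear_map R (sub G K) Y \<beta> \<Longrightarrow>
      rep (baer_sum X Y e e') (\<lambda>k. \<alpha> k \<oplus>\<^bsub>Y\<^esub> \<beta> k)"
proof -
  note d = short_exactD[OF e] and d' = short_exactD[OF e']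
  interpret Y: left_module R Y by (rule d)
  let ?pb = "pullback_ses X (\<lambda>x. (x, x)) (prod_ses e e')"
  let ?s = "\<lambda>(y, y'). y \<oplus>\<^bsub>Y\<^esub> y'"
  let ?q = "push_coset (prod_module Y Y) Y ?s ?pb"
  have pb: "short_exact R (prod_module Y Y) X ?pb"
    by (rule short_exact_pullback[OF short_exact_prod[OF e e'] X linear_map_pair[OF linear_map_ident linear_map_ident]])
  have s: "linear_map R (prod_module Y Y) Y ?s"
    using linear_map_pairI[OF d(1) linear_map_ident linear_map_ident] by (simp add: case_prod_unfold)
  note b = short_exact_pushout[OF pb d(1) s]
  show "short_exact R Y X (baer_sum X Y e e')" unfolding baer_sum_def by (rule b)
  assume "rep e \<alpha>" "rep e' \<beta>" and a: "linear_map R (sub G K) Y \<alpha>" "linear_map R (sub G K) Y \<beta>"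
  then obtain l l' where l: "linear_map R G (ses_mid e) l" "\<forall>g\<in>carrier G. ses_out e (l g) = \<pi> g"
     "\<forall>k\<in>K. l k = ses_in e (\<alpha> k)"
    and l': "linear_map R G (ses_mid e') l'" "\<forall>g\<in>carrier G. ses_out e' (l' g) = \<pi> g"
     "\<forall>k\<in>K. l' k = ses_in e' (\<beta> k)"
    unfolding rep_def by blast
  \<comment> \<open>Lifts of \<pi> for both sequences, paired with \<pi> itself, form a lift into
    the pull-back along the diagonal. On \<open>K\<close> it is the pair of the two representatives,
    which the codiagonal adds.\<close>
  define m where "m = (\<lambda>g. ((l g, l' g), \<pi> g))"
  have mid: "ses_mid ?pb = sub (prod_module (prod_module (ses_mid e) (ses_mid e')) X)
      {(z, x) \<in> (carrier (ses_mid e) \<times> carrier (ses_mid e')) \<times> carrier X.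
        map_prod (ses_out e) (ses_out e') z = (x, x)}"
    by (simp add: pullback_ses_def prod_ses_def)
  have m: "linear_map R G (ses_mid ?pb) m"
    unfolding mid m_def
    using linear_map_pair[OF linear_map_pair[OF l(1) l'(1)] \<pi>G] l(2) l'(2)
      linear_map_closed[OF l(1)] linear_map_closed[OF l'(1)] linear_map_closed[OF \<pi>G]
    by (subst linear_map_to_sub) auto
  have qm: "linear_map R G (ses_mid (baer_sum X Y e e')) (\<lambda>g. ?q (\<zero>\<^bsub>Y\<^esub>, m g))"
    unfolding baer_sum_def
    by (rule linear_map_comp[OF linear_map_pair[OF linear_map_const_zero[OF d(1)] m] linear_map_push_coset[OF pb d(1) s]])
  show "rep (baer_sum X Y e e') (\<lambda>k. \<alpha> k \<oplus>\<^bsub>Y\<^esub> \<beta> k)"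
    unfolding rep_def
  proof (intro exI conjI ballI)
    show "linear_map R G (ses_mid (baer_sum X Y e e')) (\<lambda>g. ?q (\<zero>\<^bsub>Y\<^esub>, m g))" by (rule qm)
    show "ses_out (baer_sum X Y e e') (?q (\<zero>\<^bsub>Y\<^esub>, m g)) = \<pi> g" if g: "g \<in> carrier G" for g
      unfolding baer_sum_def
      using pushout_out[OF pb d(1) s Y.M.zero_closed linear_map_closed[OF m g]]
      by (simp add: pullback_ses_def m_def)
    show "?q (\<zero>\<^bsub>Y\<^esub>, m k) = ses_in (baer_sum X Y e e') (\<alpha> k \<oplus>\<^bsub>Y\<^esub> \<beta> k)" if k: "k \<in> K" for k
    proof -
      have "m k = ses_in ?pb (\<alpha> k, \<beta> k)"
        using k l(3) l'(3) by (simp add: m_def pullback_ses_def prod_ses_def K_\<pi>)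
      then show ?thesis
        unfolding baer_sum_def
        using push_coset_in[OF pb d(1) s, of "(\<alpha> k, \<beta> k)"] linear_map_closed[OF a(1), of k]
          linear_map_closed[OF a(2), of k] k by simp
    qed
  qed
qed

lemma Ext1_add:
  assumes Y: "left_module R Y" and \<alpha>: "linear_map R (sub G K) Y \<alpha>" and \<beta>: "linear_map R (sub G K) Y \<beta>"
  shows "cls Y \<alpha> \<oplus>\<^bsub>Ext1 R X Y\<^esub> cls Y \<beta> = cls Y (\<lambda>k. \<alpha> k \<oplus>\<^bsub>Y\<^esub> \<beta> k)"
proof -
  have "ext_class R X Y (baer_sum X Y e e') = cls Y (\<lambda>k. \<alpha> k \<oplus>\<^bsub>Y\<^esub> \<beta> k)"
    if "e \<in> cls Y \<alpha>" "e' \<in> cls Y \<beta>" for e e'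
    using that short_exact_baer_sum[of Y e e'] \<alpha> \<beta>
    by (intro ext_class_rep linear_map_plus[OF Y]) (auto simp: cls_def)
  moreover obtain e where "e \<in> cls Y \<alpha>" by (rule cls_nonempty[OF Y \<alpha>])
  moreover obtain e' where "e' \<in> cls Y \<beta>" by (rule cls_nonempty[OF Y \<beta>])
  ultimately have "(\<Union>e\<in>cls Y \<alpha>. \<Union>e'\<in>cls Y \<beta>. ext_class R X Y (baer_sum X Y e e')) =
      cls Y (\<lambda>k. \<alpha> k \<oplus>\<^bsub>Y\<^esub> \<beta> k)"
    by blast
  then show ?thesis by (simp add: Ext1_def)
qed

text \<open>If \<open>l\<close> lifts \<pi> for \<open>e\<close>, then
  \<open>g \<mapsto> (l (f0 g), \<pi> g)\<close> lifts \<pi> for the pull-back along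
  \<open>f\<close>. So the action of \<open>f\<close> is composition of representatives with the
  lift \<open>f0\<close> of \<open>f\<close> to the free module.\<close>

lemma Ext1_smult:
  assumes Y: "left_module R Y" and \<alpha>: "linear_map R (sub G K) Y \<alpha>" and f: "linear_map R X X f"
    and f0: "linear_map R G G f0" "\<And>g. g \<in> carrier G \<Longrightarrow> \<pi> (f0 g) = f (\<pi> g)"
  shows "linear_map R (sub G K) Y (\<lambda>k. \<alpha> (f0 k))"
    and "f \<odot>\<^bsub>Ext1 R X Y\<^esub> cls Y \<alpha> = cls Y (\<lambda>k. \<alpha> (f0 k))"
proof -
  have f0K: "f0 k \<in> K" if "k \<in> K" for k
    using that f0(2)[OF K_mem[OF that]] linear_map_closed[OF f0(1) K_mem[OF that]] linear_map_zero[OF X X f]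
    by (simp add: K_def)
  have "linear_map R (sub G K) (sub G K) f0"
    using linear_map_restrict[OF f0(1) K] f0K by (subst linear_map_to_sub[OF submod_subset[OF K]]) auto
  then show af: "linear_map R (sub G K) Y (\<lambda>k. \<alpha> (f0 k))" using \<alpha> by (rule linear_map_comp)
  have "ext_class R X Y (pullback_ses X f e) = cls Y (\<lambda>k. \<alpha> (f0 k))" if "e \<in> cls Y \<alpha>" for e
  proof (rule ext_class_rep[OF _ af])
    have e: "short_exact R Y X e" "rep e \<alpha>" using that by (simp_all add: cls_def)
    show "short_exact R Y X (pullback_ses X f e)" by (rule short_exact_pullback[OF e(1) X f])
    obtain l where l: "linear_map R G (ses_mid e) l" "\<forall>g\<in>carrier G. ses_out e (l g) = \<pi> g"
      "\<forall>k\<in>K. l k = ses_in e (\<alpha> k)"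
      using e(2) unfolding rep_def by blast
    show "rep (pullback_ses X f e) (\<lambda>k. \<alpha> (f0 k))"
      unfolding rep_def
    proof (intro exI conjI ballI)
      show "linear_map R G (ses_mid (pullback_ses X f e)) (\<lambda>g. (l (f0 g), \<pi> g))"
        using linear_map_pair[OF linear_map_comp[OF f0(1) l(1)] \<pi>G] l(2) f0(2)
          linear_map_closed[OF linear_map_comp[OF f0(1) l(1)]] linear_map_closed[OF f0(1)] linear_map_closed[OF \<pi>G]
        by (simp add: pullback_ses_def, subst linear_map_to_sub) auto
    qed (use f0K l(3) in \<open>simp_all add: pullback_ses_def K_\<pi>\<close>)
  qed
  moreover obtain e where "e \<in> cls Y \<alpha>" by (rule cls_nonempty[OF Y \<alpha>])
  ultimately have "(\<Union>e\<in>cls Y \<alpha>. ext_class R X Y (pullback_ses X f e)) = cls Y (\<lambda>k. \<alpha> (f0 k))"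
    by blast
  then show "f \<odot>\<^bsub>Ext1 R X Y\<^esub> cls Y \<alpha> = cls Y (\<lambda>k. \<alpha> (f0 k))" by (simp add: Ext1_def)
qed

text \<open>The structure under which the finite sums occurring in \<open>module_basis\<close> can
  be computed. Each law reduces to the same law in \<open>Y\<close> for representatives.\<close>

lemma abelian_monoid_Ext1:
  assumes Y: "left_module R Y"
  shows "abelian_monoid (Ext1 R X Y)"
proof -
  interpret Y: left_module R Y by (rule Y)
  note add = Ext1_add[OF Y]
  have ex: "\<exists>\<alpha>. linear_map R (sub G K) Y \<alpha> \<and> c = cls Y \<alpha>" if "c \<in> carrier (Ext1 R X Y)" for c
    using that unfolding Ext1_carrier[OF Y] by blast
  have mem: "cls Y \<alpha> \<in> carrier (Ext1 R X Y)" if "linear_map R (sub G K) Y \<alpha>" for \<alpha>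
    using that unfolding Ext1_carrier[OF Y] by blast
  have cl: "\<alpha> k \<in> carrier Y" if "linear_map R (sub G K) Y \<alpha>" "k \<in> K" for \<alpha> k
    using linear_map_closed[OF that(1), of k] that(2) by simp
  note plus = linear_map_plus[OF Y]
  show ?thesis
  proof (rule abelian_monoidI)
    show "\<zero>\<^bsub>Ext1 R X Y\<^esub> \<in> carrier (Ext1 R X Y)"
      unfolding Ext1_zero[OF Y] by (rule mem[OF linear_map_const_zero[OF Y]])
  next
    fix a b assume "a \<in> carrier (Ext1 R X Y)" "b \<in> carrier (Ext1 R X Y)"
    then obtain \<alpha> \<beta> where c: "linear_map R (sub G K) Y \<alpha>" "a = cls Y \<alpha>" "linear_map R (sub G K) Y \<beta>" "b = cls Y \<beta>"
      by (metis ex)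
    show "a \<oplus>\<^bsub>Ext1 R X Y\<^esub> b \<in> carrier (Ext1 R X Y)"
      unfolding c add[OF c(1,3)] by (rule mem[OF plus[OF c(1,3)]])
    show "a \<oplus>\<^bsub>Ext1 R X Y\<^esub> b = b \<oplus>\<^bsub>Ext1 R X Y\<^esub> a"
      unfolding c add[OF c(1,3)] add[OF c(3,1)] by (rule cls_cong) (simp add: cl c Y.M.a_comm)
  next
    fix a b d assume "a \<in> carrier (Ext1 R X Y)" "b \<in> carrier (Ext1 R X Y)" "d \<in> carrier (Ext1 R X Y)"
    then obtain \<alpha> \<beta> \<delta> where c: "linear_map R (sub G K) Y \<alpha>" "a = cls Y \<alpha>" "linear_map R (sub G K) Y \<beta>" "b = cls Y \<beta>"
      "linear_map R (sub G K) Y \<delta>" "d = cls Y \<delta>"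
      by (metis ex)
    show "a \<oplus>\<^bsub>Ext1 R X Y\<^esub> b \<oplus>\<^bsub>Ext1 R X Y\<^esub> d = a \<oplus>\<^bsub>Ext1 R X Y\<^esub> (b \<oplus>\<^bsub>Ext1 R X Y\<^esub> d)"
      unfolding c add[OF c(1,3)] add[OF c(3,5)] add[OF plus[OF c(1,3)] c(5)] add[OF c(1) plus[OF c(3,5)]]
      by (rule cls_cong) (simp add: cl c Y.M.a_assoc)
  next
    fix a assume "a \<in> carrier (Ext1 R X Y)"
    then obtain \<alpha> where c: "linear_map R (sub G K) Y \<alpha>" "a = cls Y \<alpha>" by (metis ex)
    show "\<zero>\<^bsub>Ext1 R X Y\<^esub> \<oplus>\<^bsub>Ext1 R X Y\<^esub> a = a"
      unfolding c Ext1_zero[OF Y] add[OF linear_map_const_zero[OF Y] c(1)]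
      by (rule cls_cong) (simp add: cl c)
  qed
qed

lemma Ext1_finsum:
  assumes Y: "left_module R Y" and "finite F" and \<alpha>: "\<And>b. b \<in> F \<Longrightarrow> linear_map R (sub G K) Y (\<alpha> b)"
  shows "(\<Oplus>\<^bsub>Ext1 R X Y\<^esub>b\<in>F. cls Y (\<alpha> b)) = cls Y (\<lambda>k. \<Oplus>\<^bsub>Y\<^esub>b\<in>F. \<alpha> b k)"
  using assms(2,3)
proof (induction F rule: finite_induct)
  interpret Y: left_module R Y by (rule Y)
  interpret X: abelian_monoid "Ext1 R X Y" by (rule abelian_monoid_Ext1[OF Y])
  {
    case empty
    show ?case by (simp add: Ext1_zero[OF Y])
  next
    case (insert b F)
    have mem: "cls Y (\<alpha> c) \<in> carrier (Ext1 R X Y)" if "c \<in> insert b F" for c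
      using insert.prems[OF that] unfolding Ext1_carrier[OF Y] by blast
    have cl: "\<alpha> c k \<in> carrier Y" if "c \<in> insert b F" "k \<in> K" for c k
      using linear_map_closed[OF insert.prems[OF that(1)], of k] that(2) by simp
    have "(\<Oplus>\<^bsub>Ext1 R X Y\<^esub>b\<in>insert b F. cls Y (\<alpha> b)) = cls Y (\<alpha> b) \<oplus>\<^bsub>Ext1 R X Y\<^esub> (\<Oplus>\<^bsub>Ext1 R X Y\<^esub>b\<in>F. cls Y (\<alpha> b))"
      using insert.hyps mem by (intro X.finsum_insert) auto
    also have "\<dots> = cls Y (\<alpha> b) \<oplus>\<^bsub>Ext1 R X Y\<^esub> cls Y (\<lambda>k. \<Oplus>\<^bsub>Y\<^esub>b\<in>F. \<alpha> b k)"
      using insert.IH insert.prems by simp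
    also have "\<dots> = cls Y (\<lambda>k. \<alpha> b k \<oplus>\<^bsub>Y\<^esub> (\<Oplus>\<^bsub>Y\<^esub>b\<in>F. \<alpha> b k))"
      by (rule Ext1_add[OF Y insert.prems linear_map_finsum_fun[OF KM Y insert.prems]]) auto
    also have "\<dots> = cls Y (\<lambda>k. \<Oplus>\<^bsub>Y\<^esub>b\<in>insert b F. \<alpha> b k)"
    proof (rule cls_cong)
      fix k assume k: "k \<in> K"
      show "\<alpha> b k \<oplus>\<^bsub>Y\<^esub> (\<Oplus>\<^bsub>Y\<^esub>b\<in>F. \<alpha> b k) = (\<Oplus>\<^bsub>Y\<^esub>b\<in>insert b F. \<alpha> b k)"
        using insert.hyps cl[OF _ k] by (intro Y.M.finsum_insert[symmetric]) auto
    qed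
    finally show ?case .
  }
qed

end

section \<open>Universal sequences\<close>

text \<open>Maps into finitely many middle terms are put side by side, with zero at all other
  indices; push-out along the summation map then adds their representatives. The maps
  \<open>l i\<close> need not lift \<pi> itself, which leaves room for coefficients from
  End(X).\<close>

lemma (in presentation) pushout_direct_sum_lift:
  fixes Y :: "('r, 'y) module" and \<xi> :: "'i \<Rightarrow> ('r, 'y, 'e, 'b) ses"
  assumes Y: "left_module R Y" and \<xi>: "\<And>i. i \<in> I \<Longrightarrow> short_exact R Y (B i) (\<xi> i)"
    and F: "finite F" "F \<subseteq> I"
    and l: "\<And>i. i \<in> F \<Longrightarrow> linear_map R G (ses_mid (\<xi> i)) (l i)"
    and \<alpha>: "\<And>i. i \<in> F \<Longrightarrow> linear_map R (sub G K) Y (\<alpha> i)"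
    and eq: "\<And>i k. i \<in> F \<Longrightarrow> k \<in> K \<Longrightarrow> l i k = ses_in (\<xi> i) (\<alpha> i k)"
    and P: "P = pushout_ses (direct_sum I (\<lambda>_. Y)) Y (summation_map I Y) (direct_sum_ses I \<xi>)"
  obtains s where "short_exact R Y (direct_sum I B) P" "linear_map R G (ses_mid P) s"
    "\<And>g. g \<in> carrier G \<Longrightarrow> ses_out P (s g) = (\<lambda>i\<in>I. if i \<in> F then ses_out (\<xi> i) (l i g) else \<zero>\<^bsub>B i\<^esub>)"
    "\<And>k. k \<in> K \<Longrightarrow> s k = ses_in P (\<Oplus>\<^bsub>Y\<^esub>i\<in>F. \<alpha> i k)"
proof -
  interpret Y: left_module R Y by (rule Y)
  let ?D = "direct_sum_ses I \<xi>" and ?E = "\<lambda>i. ses_mid (\<xi> i)"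
  note d = short_exactD[OF \<xi>]
  have D: "short_exact R (direct_sum I (\<lambda>_. Y)) (direct_sum I B) ?D"
    by (rule short_exact_direct_sum[OF ring \<xi>])
  have sum: "linear_map R (direct_sum I (\<lambda>_. Y)) Y (summation_map I Y)"
    using linear_map_direct_sum(1)[OF ring Y Y linear_map_ident, of I]
    by (simp add: summation_map_def[abs_def])
  have Ez: "\<zero>\<^bsub>?E i\<^esub> \<in> carrier (?E i)" "\<zero>\<^bsub>?E i\<^esub> \<oplus>\<^bsub>?E i\<^esub> \<zero>\<^bsub>?E i\<^esub> = \<zero>\<^bsub>?E i\<^esub>" if "i \<in> I" for i
  proof -
    interpret E: left_module R "?E i" by (rule d(2)[OF that])
    show "\<zero>\<^bsub>?E i\<^esub> \<in> carrier (?E i)" "\<zero>\<^bsub>?E i\<^esub> \<oplus>\<^bsub>?E i\<^esub> \<zero>\<^bsub>?E i\<^esub> = \<zero>\<^bsub>?E i\<^esub>" by simp_all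
  qed
  define a where "a = (\<lambda>g. \<lambda>i\<in>I. if i \<in> F then l i g else \<zero>\<^bsub>?E i\<^esub>)"
  have mid: "ses_mid ?D = direct_sum I ?E" by (simp add: direct_sum_ses_def)
  have a: "linear_map R G (ses_mid ?D) a"
    unfolding mid
  proof (rule linear_mapI)
    fix g assume g: "g \<in> carrier G"
    show "a g \<in> carrier (direct_sum I ?E)"
      unfolding a_def using F(1) linear_map_closed[OF l g] Ez
      by (intro direct_sum_memI[where F = F]) auto
  next
    fix g h assume "g \<in> carrier G" "h \<in> carrier G"
    then show "a (g \<oplus>\<^bsub>G\<^esub> h) = a g \<oplus>\<^bsub>direct_sum I ?E\<^esub> a h"
      using linear_map_add[OF l] Ez by (auto simp: a_def intro!: restrict_ext)
  next
    fix r g assume "r \<in> carrier R" "g \<in> carrier G"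
    then show "a (r \<odot>\<^bsub>G\<^esub> g) = r \<odot>\<^bsub>direct_sum I ?E\<^esub> a g"
      using linear_map_smult[OF l] left_module.smult_zero[OF d(2)] by (auto simp: a_def intro!: restrict_ext)
  qed
  let ?q = "push_coset (direct_sum I (\<lambda>_. Y)) Y (summation_map I Y) ?D"
  show thesis
  proof (rule that)
    show "short_exact R Y (direct_sum I B) P" unfolding P by (rule short_exact_pushout[OF D Y sum])
    show "linear_map R G (ses_mid P) (\<lambda>g. ?q (\<zero>\<^bsub>Y\<^esub>, a g))"
      unfolding P
      by (rule linear_map_comp[OF linear_map_pair[OF linear_map_const_zero[OF Y] a] linear_map_push_coset[OF D Y sum]])
    show "ses_out P (?q (\<zero>\<^bsub>Y\<^esub>, a g)) = (\<lambda>i\<in>I. if i \<in> F then ses_out (\<xi> i) (l i g) else \<zero>\<^bsub>B i\<^esub>)"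
      if g: "g \<in> carrier G" for g
    proof -
      have "ses_out P (?q (\<zero>\<^bsub>Y\<^esub>, a g)) = ses_out ?D (a g)"
        unfolding P by (rule pushout_out[OF D Y sum Y.M.zero_closed linear_map_closed[OF a g]])
      also have "\<dots> = (\<lambda>i\<in>I. if i \<in> F then ses_out (\<xi> i) (l i g) else \<zero>\<^bsub>B i\<^esub>)"
        using linear_map_zero[OF d(2,3,5)] by (auto simp: direct_sum_ses_def a_def intro!: restrict_ext)
      finally show ?thesis .
    qed
    show "?q (\<zero>\<^bsub>Y\<^esub>, a k) = ses_in P (\<Oplus>\<^bsub>Y\<^esub>i\<in>F. \<alpha> i k)" if k: "k \<in> K" for k
    proof -
      have \<alpha>k: "\<alpha> i k \<in> carrier Y" if "i \<in> F" for i
        using linear_map_closed[OF \<alpha>[OF that], of k] k by simp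
      define x where "x = (\<lambda>i\<in>I. if i \<in> F then \<alpha> i k else \<zero>\<^bsub>Y\<^esub>)"
      have x: "x \<in> carrier (direct_sum I (\<lambda>_. Y))"
        unfolding x_def using F(1) \<alpha>k by (intro direct_sum_memI[where F = F]) auto
      have supp: "{i \<in> I. x i \<noteq> \<zero>\<^bsub>Y\<^esub>} \<subseteq> F" by (auto simp: x_def split: if_splits)
      \<comment> \<open>On \<open>K\<close> the family comes from a finitely supported family
        \<open>x\<close> in \<open>Y\<close>, so the push-out relation replaces it by the sum of
        \<open>x\<close>.\<close>
      have "a k = ses_in ?D x"
        using eq[OF _ k] linear_map_zero[OF d(1,2,4)] by (auto simp: direct_sum_ses_def a_def x_def intro!: restrict_ext)
      then have "?q (\<zero>\<^bsub>Y\<^esub>, a k) = ses_in P (summation_map I Y x)"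
        unfolding P using push_coset_in[OF D Y sum x] by simp
      also have "summation_map I Y x = (\<Oplus>\<^bsub>Y\<^esub>i\<in>F. x i)"
        unfolding summation_map_def
        by (rule direct_sum_finsum_support[where M = "\<lambda>_. Y" and g = "\<lambda>_ x. x", OF Y _ _ x F supp]) simp_all
      also have "\<dots> = (\<Oplus>\<^bsub>Y\<^esub>i\<in>F. \<alpha> i k)"
        using F(2) \<alpha>k by (intro Y.M.finsum_cong') (auto simp: x_def)
      finally show ?thesis .
    qed
  qed
qed

lemma End_simps [simp]:
  "carrier (End R M) = Hom R M M" "\<zero>\<^bsub>End R M\<^esub> = zero_map M M"
  by (simp_all add: End_def)

locale universal_sequence = presentation R X n \<pi>
  for R :: "('r, 'k) ring_scheme" and X :: "('r, 'x) module" and n :: nat and \<pi> :: "(nat \<Rightarrow> 'r) \<Rightarrow> 'x" +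
  fixes \<X> :: "('r, 'x) module set" and Y :: "('r, 'y) module"
    and B :: "('r, 'x) module \<Rightarrow> ('r, 'y, 'x) extension set set"
    and e :: "('r, 'y, 'e, ('r, 'x) module \<times> ('r, 'y, 'x) extension set \<Rightarrow> 'x) ses"
  assumes univ: "universal_ses R \<X> Y B e" and XX: "X \<in> \<X>"
begin

abbreviation I where "I \<equiv> Sigma \<X> B"

lemma e: "short_exact R Y (direct_sum I fst) e"
  and basis: "module_basis (End R X) (Ext1 R X Y) (B X)"
  using univ XX by (auto simp: universal_ses_def)

lemma Y: "left_module R Y" by (rule short_exactD(1)[OF e])

lemma basis_ex1:
  assumes "v \<in> carrier (Ext1 R X Y)"
  shows "\<exists>!c. c \<in> (\<Pi>\<^sub>E b\<in>B X. Hom R X X) \<and> finite {b \<in> B X. c b \<noteq> zero_map X X} \<and>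
    v = (\<Oplus>\<^bsub>Ext1 R X Y\<^esub>b\<in>{b \<in> B X. c b \<noteq> zero_map X X}. c b \<odot>\<^bsub>Ext1 R X Y\<^esub> b)"
  using assms basis unfolding module_basis_def End_simps by (elim conjE) (rule bspec)

text \<open>In terms of extensions: the universal sequence, pulled back along the map from
  \<open>X\<close> with coordinate \<open>f b\<close> at the index \<open>(X, b)\<close>, represents
  the combination of the \<open>b\<close> with coefficients \<open>f b\<close>. It is a predicate on
  \<alpha> so that one choice of representatives serves all combinations.\<close>

definition lifts_combinations :: "(('r, 'y, 'x) extension set \<Rightarrow> (nat \<Rightarrow> 'r) \<Rightarrow> 'y) \<Rightarrow> bool" where
  "lifts_combinations \<alpha> \<longleftrightarrow>
     (\<forall>F f f0. finite F \<and> F \<subseteq> B X \<and> (\<forall>b\<in>F. linear_map R X X (f b) \<and> linear_map R G G (f0 b) \<and>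
         (\<forall>g\<in>carrier G. \<pi> (f0 b g) = f b (\<pi> g))) \<longrightarrow>
       (\<exists>s. linear_map R G (ses_mid e) s \<and>
         (\<forall>g\<in>carrier G. ses_out e (s g) = (\<lambda>i\<in>I. if i \<in> Pair X ` F then f (snd i) (\<pi> g) else \<zero>\<^bsub>fst i\<^esub>)) \<and>
         (\<forall>k\<in>K. s k = ses_in e (\<Oplus>\<^bsub>Y\<^esub>b\<in>F. \<alpha> b (f0 b k)))))"

lemma universal_lift:
  obtains \<alpha> where "\<And>b. b \<in> B X \<Longrightarrow> linear_map R (sub G K) Y (\<alpha> b)" "\<And>b. b \<in> B X \<Longrightarrow> b = cls Y (\<alpha> b)"
    "lifts_combinations \<alpha>"
proof -
  interpret Y: left_module R Y by (rule Y)
  obtain \<xi> where \<xi>: "\<And>X b. X \<in> \<X> \<Longrightarrow> b \<in> B X \<Longrightarrow> \<xi> (X, b) \<in> b"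
    and eq: "ses_equiv R Y e (pushout_ses (direct_sum I (\<lambda>_. Y)) Y (summation_map I Y) (direct_sum_ses I \<xi>))"
    using univ unfolding universal_ses_def by blast
  \<comment> \<open>The sequence selected by \<xi> is a member of the basis element, which is
    therefore its class. For a member of a class this needs symmetry and transitivity of
    equivalence.\<close>
  have \<xi>se: "short_exact R Y (fst i) (\<xi> i) \<and> snd i = ext_class R (fst i) Y (\<xi> i)" if iI: "i \<in> I" for i
  proof -
    obtain X' b where i: "i = (X', b)" "X' \<in> \<X>" "b \<in> B X'" using iI by (cases i) auto
    have "b \<in> carrier (Ext1 R X' Y)"
      using univ i unfolding universal_ses_def module_basis_def by blast
    then obtain e' :: "('r, 'y, 'x) extension" where e': "short_exact R Y X' e'" "b = ext_class R X' Y e'" by (auto simp: Ext1_def)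
    have x: "short_exact R Y X' (\<xi> i)" "ses_equiv R Y (\<xi> i) e'"
      using \<xi>[OF i(2,3)] i e'(2) by (auto simp: ext_class_def)
    have tr: "ses_equiv R Y u w" if "ses_equiv R Y u v" "ses_equiv R Y v w" for u v w :: "('r, 'y, 'x) extension"
    proof -
      obtain h where h: "linear_map R (ses_mid u) (ses_mid v) h" "\<forall>a\<in>carrier Y. h (ses_in u a) = ses_in v a"
        "\<forall>m\<in>carrier (ses_mid u). ses_out v (h m) = ses_out u m"
        using \<open>ses_equiv R Y u v\<close> unfolding ses_equiv_def by blast
      obtain h' where h': "linear_map R (ses_mid v) (ses_mid w) h'" "\<forall>a\<in>carrier Y. h' (ses_in v a) = ses_in w a"
        "\<forall>m\<in>carrier (ses_mid v). ses_out w (h' m) = ses_out v m"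
        using \<open>ses_equiv R Y v w\<close> unfolding ses_equiv_def by blast
      show ?thesis
        unfolding ses_equiv_def
        by (rule exI[of _ "\<lambda>x. h' (h x)"])
          (use h h' linear_map_comp[OF h(1) h'(1)] linear_map_closed[OF h(1)] in simp)
    qed
    have "ext_class R X' Y e' = ext_class R X' Y (\<xi> i)"
      unfolding ext_class_def
      using tr[OF _ x(2)] tr[OF _ ses_equiv_inverse[OF x(1) e'(1) x(2)]] by blast
    then show ?thesis using x i e' by simp
  qed
  have "\<forall>b\<in>B X. \<exists>\<alpha>. linear_map R (sub G K) Y \<alpha> \<and> rep (\<xi> (X, b)) \<alpha> \<and> b = cls Y \<alpha>"
  proof
    fix b assume b: "b \<in> B X"
    then have x: "short_exact R Y X (\<xi> (X, b))" "b = ext_class R X Y (\<xi> (X, b))"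
      using \<xi>se[of "(X, b)"] XX by auto
    obtain \<alpha> where a: "linear_map R (sub G K) Y \<alpha>" "rep (\<xi> (X, b)) \<alpha>" by (rule rep_exists[OF x(1)])
    show "\<exists>\<alpha>. linear_map R (sub G K) Y \<alpha> \<and> rep (\<xi> (X, b)) \<alpha> \<and> b = cls Y \<alpha>"
      using a x(2) ext_class_rep[OF x(1) a] by auto
  qed
  then obtain \<alpha> where \<alpha>: "\<And>b. b \<in> B X \<Longrightarrow> linear_map R (sub G K) Y (\<alpha> b)"
    "\<And>b. b \<in> B X \<Longrightarrow> rep (\<xi> (X, b)) (\<alpha> b)" "\<And>b. b \<in> B X \<Longrightarrow> b = cls Y (\<alpha> b)" by metis
  show thesis
  proof (rule that)
    fix b assume "b \<in> B X"
    then show "linear_map R (sub G K) Y (\<alpha> b)" "b = cls Y (\<alpha> b)" by (fact \<alpha>)+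
  next
    show "lifts_combinations \<alpha>"
      unfolding lifts_combinations_def
    proof (intro allI impI)
      fix F f f0
      assume "finite F \<and> F \<subseteq> B X \<and> (\<forall>b\<in>F. linear_map R X X (f b) \<and> linear_map R G G (f0 b) \<and>
           (\<forall>g\<in>carrier G. \<pi> (f0 b g) = f b (\<pi> g)))"
      then have F: "finite F" "F \<subseteq> B X" and f: "\<And>b. b \<in> F \<Longrightarrow> linear_map R X X (f b)"
        and f0: "\<And>b. b \<in> F \<Longrightarrow> linear_map R G G (f0 b)"
          "\<And>b g. b \<in> F \<Longrightarrow> g \<in> carrier G \<Longrightarrow> \<pi> (f0 b g) = f b (\<pi> g)" by blast+
      have \<alpha>f: "linear_map R (sub G K) Y (\<lambda>k. \<alpha> b (f0 b k))" if "b \<in> F" for b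
        using that F by (intro Ext1_smult(1)[OF Y \<alpha>(1) f f0]) auto
      have f0K: "f0 b k \<in> K" if "b \<in> F" "k \<in> K" for b k
        using f0(2)[OF that(1) K_mem[OF that(2)]] linear_map_closed[OF f0(1)[OF that(1)] K_mem[OF that(2)]]
          linear_map_zero[OF X X f[OF that(1)]] that(2)
        by (simp add: K_def)
      have "\<forall>b\<in>B X. \<exists>l. linear_map R G (ses_mid (\<xi> (X, b))) l \<and> (\<forall>g\<in>carrier G. ses_out (\<xi> (X, b)) (l g) = \<pi> g) \<and>
          (\<forall>k\<in>K. l k = ses_in (\<xi> (X, b)) (\<alpha> b k))"
        using \<alpha>(2) unfolding rep_def by blast
      then obtain l where l: "\<And>b. b \<in> B X \<Longrightarrow> linear_map R G (ses_mid (\<xi> (X, b))) (l b)"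
        "\<And>b g. b \<in> B X \<Longrightarrow> g \<in> carrier G \<Longrightarrow> ses_out (\<xi> (X, b)) (l b g) = \<pi> g"
        "\<And>b k. b \<in> B X \<Longrightarrow> k \<in> K \<Longrightarrow> l b k = ses_in (\<xi> (X, b)) (\<alpha> b k)" by metis
      define P where "P = pushout_ses (direct_sum I (\<lambda>_. Y)) Y (summation_map I Y) (direct_sum_ses I \<xi>)"
      obtain s where P: "short_exact R Y (direct_sum I fst) P" and s: "linear_map R G (ses_mid P) s"
        and so: "\<And>g. g \<in> carrier G \<Longrightarrow> ses_out P (s g) =
          (\<lambda>i\<in>I. if i \<in> Pair X ` F then ses_out (\<xi> i) (l (snd i) (f0 (snd i) g)) else \<zero>\<^bsub>fst i\<^esub>)"
        and sk: "\<And>k. k \<in> K \<Longrightarrow> s k = ses_in P (\<Oplus>\<^bsub>Y\<^esub>i\<in>Pair X ` F. \<alpha> (snd i) (f0 (snd i) k))"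
      proof (rule pushout_direct_sum_lift[where I = I and B = fst and \<xi> = \<xi> and F = "Pair X ` F" and P = P
            and l = "\<lambda>i g. l (snd i) (f0 (snd i) g)" and \<alpha> = "\<lambda>i k. \<alpha> (snd i) (f0 (snd i) k)", OF Y])
        show "short_exact R Y (fst i) (\<xi> i)" if "i \<in> I" for i using \<xi>se[OF that] by simp
        show "finite (Pair X ` F)" "Pair X ` F \<subseteq> I" using F XX by auto
        show "linear_map R G (ses_mid (\<xi> i)) (\<lambda>g. l (snd i) (f0 (snd i) g))" if "i \<in> Pair X ` F" for i
          using that F linear_map_comp[OF f0(1) l(1)] by auto
        show "linear_map R (sub G K) Y (\<lambda>k. \<alpha> (snd i) (f0 (snd i) k))" if "i \<in> Pair X ` F" for i
          using that \<alpha>f by auto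
        show "l (snd i) (f0 (snd i) k) = ses_in (\<xi> i) (\<alpha> (snd i) (f0 (snd i) k))"
          if "i \<in> Pair X ` F" "k \<in> K" for i k
          using that F f0K l(3) by auto
      qed (simp_all add: P_def)
      \<comment> \<open>The universal sequence is only equivalent to the push-out, by a morphism
        pointing towards the push-out. The lift \<open>s\<close> lives in the push-out, so the
        inverse morphism is taken.\<close>
      obtain h where h: "linear_map R (ses_mid P) (ses_mid e) h" "\<And>a. a \<in> carrier Y \<Longrightarrow> h (ses_in P a) = ses_in e a"
        "\<And>m. m \<in> carrier (ses_mid P) \<Longrightarrow> ses_out e (h m) = ses_out P m"
        using ses_equiv_inverse[OF e P] eq unfolding ses_equiv_def P_def by blast
      show "\<exists>s. linear_map R G (ses_mid e) s \<and>
           (\<forall>g\<in>carrier G. ses_out e (s g) = (\<lambda>i\<in>I. if i \<in> Pair X ` F then f (snd i) (\<pi> g) else \<zero>\<^bsub>fst i\<^esub>)) \<and>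
           (\<forall>k\<in>K. s k = ses_in e (\<Oplus>\<^bsub>Y\<^esub>b\<in>F. \<alpha> b (f0 b k)))"
      proof (intro exI conjI ballI)
        show "linear_map R G (ses_mid e) (\<lambda>g. h (s g))" by (rule linear_map_comp[OF s h(1)])
        show "ses_out e (h (s g)) = (\<lambda>i\<in>I. if i \<in> Pair X ` F then f (snd i) (\<pi> g) else \<zero>\<^bsub>fst i\<^esub>)"
          if g: "g \<in> carrier G" for g
          using F l(2) linear_map_closed[OF f0(1) g] f0(2)[OF _ g]
          by (auto simp: h(3)[OF linear_map_closed[OF s g]] so[OF g] intro!: restrict_ext)
        show "h (s k) = ses_in e (\<Oplus>\<^bsub>Y\<^esub>b\<in>F. \<alpha> b (f0 b k))" if k: "k \<in> K" for k
        proof -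
          have c: "\<alpha> b (f0 b k) \<in> carrier Y" if "b \<in> F" for b
            using linear_map_closed[OF \<alpha>f[OF that], of k] k by simp
          have "(\<Oplus>\<^bsub>Y\<^esub>i\<in>Pair X ` F. \<alpha> (snd i) (f0 (snd i) k)) = (\<Oplus>\<^bsub>Y\<^esub>b\<in>F. \<alpha> b (f0 b k))"
            using c by (subst Y.M.finsum_reindex) (auto simp: inj_on_def)
          then show ?thesis using sk[OF k] h(2) c by (simp add: Y.M.finsum_closed)
        qed
      qed
    qed
  qed
qed

lemma endo_lift:
  assumes "linear_map R X X f"
  shows "\<exists>f0. linear_map R G G f0 \<and> (\<forall>g\<in>carrier G. \<pi> (f0 g) = f (\<pi> g))"
proof -
  have im: "(\<lambda>g. f (\<pi> g)) ` carrier G \<subseteq> \<pi> ` carrier G"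
    using linear_map_closed[OF linear_map_comp[OF \<pi>G assms]] surjG by auto
  show ?thesis using G_lift[OF G X \<pi>G linear_map_comp[OF \<pi>G assms] im] by metis
qed

lemma Ext1_combination:
  assumes \<alpha>: "\<And>b. b \<in> B X \<Longrightarrow> linear_map R (sub G K) Y (\<alpha> b)" "\<And>b. b \<in> B X \<Longrightarrow> b = cls Y (\<alpha> b)"
    and F: "finite F" "F \<subseteq> B X" and f: "\<And>b. b \<in> F \<Longrightarrow> linear_map R X X (f b)"
    and f0: "\<And>b. b \<in> F \<Longrightarrow> linear_map R G G (f0 b)"
      "\<And>b g. b \<in> F \<Longrightarrow> g \<in> carrier G \<Longrightarrow> \<pi> (f0 b g) = f b (\<pi> g)"
  shows "(\<Oplus>\<^bsub>Ext1 R X Y\<^esub>b\<in>F. f b \<odot>\<^bsub>Ext1 R X Y\<^esub> b) = cls Y (\<lambda>k. \<Oplus>\<^bsub>Y\<^esub>b\<in>F. \<alpha> b (f0 b k))"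
    and "linear_map R (sub G K) Y (\<lambda>k. \<Oplus>\<^bsub>Y\<^esub>b\<in>F. \<alpha> b (f0 b k))"
proof -
  interpret M: abelian_monoid "Ext1 R X Y" by (rule abelian_monoid_Ext1[OF Y])
  have lin: "linear_map R (sub G K) Y (\<lambda>k. \<alpha> b (f0 b k))" if "b \<in> F" for b
    using that F by (intro Ext1_smult(1)[OF Y \<alpha>(1) f f0]) auto
  show "linear_map R (sub G K) Y (\<lambda>k. \<Oplus>\<^bsub>Y\<^esub>b\<in>F. \<alpha> b (f0 b k))"
    by (rule linear_map_finsum_fun[OF KM Y lin])
  have "f b \<odot>\<^bsub>Ext1 R X Y\<^esub> b = cls Y (\<lambda>k. \<alpha> b (f0 b k))" if b: "b \<in> F" for b
  proof -
    have bX: "b \<in> B X" using b F by blast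
    have "f b \<odot>\<^bsub>Ext1 R X Y\<^esub> cls Y (\<alpha> b) = cls Y (\<lambda>k. \<alpha> b (f0 b k))"
      by (rule Ext1_smult(2)[OF Y \<alpha>(1)[OF bX] f[OF b] f0(1)[OF b] f0(2)[OF b]])
    then show ?thesis using \<alpha>(2)[OF bX] by simp
  qed
  moreover have "cls Y (\<lambda>k. \<alpha> b (f0 b k)) \<in> carrier (Ext1 R X Y)" if "b \<in> F" for b
    using lin[OF that] unfolding Ext1_carrier[OF Y] by blast
  ultimately have "(\<Oplus>\<^bsub>Ext1 R X Y\<^esub>b\<in>F. f b \<odot>\<^bsub>Ext1 R X Y\<^esub> b) = (\<Oplus>\<^bsub>Ext1 R X Y\<^esub>b\<in>F. cls Y (\<lambda>k. \<alpha> b (f0 b k)))"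
    by (intro M.finsum_cong') auto
  also have "\<dots> = cls Y (\<lambda>k. \<Oplus>\<^bsub>Y\<^esub>b\<in>F. \<alpha> b (f0 b k))"
    by (rule Ext1_finsum[OF Y F(1) lin])
  finally show "(\<Oplus>\<^bsub>Ext1 R X Y\<^esub>b\<in>F. f b \<odot>\<^bsub>Ext1 R X Y\<^esub> b) = cls Y (\<lambda>k. \<Oplus>\<^bsub>Y\<^esub>b\<in>F. \<alpha> b (f0 b k))" .
qed

text \<open>Uses existence of coordinates. The class of \<mu> is a combination of basis elements,
  represented by some \<sigma> which \<open>lifts_combinations\<close> extends to \<open>G\<close>;
  the remaining difference of \<mu> and \<sigma> is the restriction of a map from \<open>G\<close>
  to \<open>Y\<close>, so it extends as well.\<close>

lemma universal_extends:
  assumes \<mu>: "linear_map R (sub G K) Y \<mu>"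
  obtains \<nu> where "linear_map R G (ses_mid e) \<nu>" "\<And>k. k \<in> K \<Longrightarrow> \<nu> k = ses_in e (\<mu> k)"
proof -
  note d = short_exactD[OF e]
  interpret Y: left_module R Y by (rule Y)
  obtain \<alpha> where \<alpha>: "\<And>b. b \<in> B X \<Longrightarrow> linear_map R (sub G K) Y (\<alpha> b)" "\<And>b. b \<in> B X \<Longrightarrow> b = cls Y (\<alpha> b)"
    and lift: "lifts_combinations \<alpha>"
    using universal_lift by blast
  have "cls Y \<mu> \<in> carrier (Ext1 R X Y)" using \<mu> unfolding Ext1_carrier[OF Y] by blast
  from ex1_implies_ex[OF basis_ex1[OF this]] obtain c where c: "c \<in> (\<Pi>\<^sub>E b\<in>B X. Hom R X X)" "finite {b \<in> B X. c b \<noteq> zero_map X X}"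
    "cls Y \<mu> = (\<Oplus>\<^bsub>Ext1 R X Y\<^esub>b\<in>{b \<in> B X. c b \<noteq> zero_map X X}. c b \<odot>\<^bsub>Ext1 R X Y\<^esub> b)"
    by (elim exE conjE)
  define F where "F = {b \<in> B X. c b \<noteq> zero_map X X}"
  have F: "finite F" "F \<subseteq> B X" using c(2) by (auto simp: F_def)
  have cl: "linear_map R X X (c b)" if "b \<in> F" for b
    using c(1) that F(2) by (auto simp: Hom_def)
  obtain f0 where f0: "\<And>b. b \<in> F \<Longrightarrow> linear_map R G G (f0 b)"
    "\<And>b g. b \<in> F \<Longrightarrow> g \<in> carrier G \<Longrightarrow> \<pi> (f0 b g) = c b (\<pi> g)"
    using endo_lift[OF cl] by metis
  define \<sigma> where "\<sigma> = (\<lambda>k. \<Oplus>\<^bsub>Y\<^esub>b\<in>F. \<alpha> b (f0 b k))"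
  have \<sigma>: "linear_map R (sub G K) Y \<sigma>"
    unfolding \<sigma>_def by (rule Ext1_combination(2)[where f = c, OF \<alpha> F cl f0])
  have "cls Y \<mu> = cls Y \<sigma>"
    using c(3) unfolding F_def[symmetric] \<sigma>_def by (simp only: Ext1_combination(1)[where f = c, OF \<alpha> F cl f0])
  then obtain t where t: "linear_map R G Y t" "\<And>k. k \<in> K \<Longrightarrow> \<mu> k = \<sigma> k \<oplus>\<^bsub>Y\<^esub> t k"
    using cls_eqD[OF Y \<mu> \<sigma>] by blast
  obtain s where s: "linear_map R G (ses_mid e) s" "\<forall>k\<in>K. s k = ses_in e (\<sigma> k)"
    using lift[unfolded lifts_combinations_def, rule_format, of F c f0] F cl f0 unfolding \<sigma>_def by blast
  show thesis
  proof (rule that)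
    show "linear_map R G (ses_mid e) (\<lambda>g. s g \<oplus>\<^bsub>ses_mid e\<^esub> ses_in e (t g))"
      by (rule linear_map_plus[OF d(2) s(1) linear_map_comp[OF t(1) d(4)]])
    show "s k \<oplus>\<^bsub>ses_mid e\<^esub> ses_in e (t k) = ses_in e (\<mu> k)" if k: "k \<in> K" for k
      using k s(2) t(2)[OF k] linear_map_closed[OF t(1) K_mem[OF k]] linear_map_closed[OF \<sigma>, of k]
      by (simp add: linear_map_add[OF d(4)])
  qed
qed

text \<open>The images of the \<open>n\<close> generators have finite supports, and the union of
  these supports bounds all others.\<close>

lemma finite_support:
  assumes M: "\<And>i. i \<in> J \<Longrightarrow> left_module R (M i)" and v: "linear_map R X (direct_sum J M) v"
  obtains F where "finite F" "\<And>x i. x \<in> carrier X \<Longrightarrow> i \<in> J \<Longrightarrow> i \<notin> F \<Longrightarrow> v x i = \<zero>\<^bsub>M i\<^esub>"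
proof -
  define F where "F = (\<Union>j<n. {i \<in> J. v (\<pi> (free_gen R {..<n} j)) i \<noteq> \<zero>\<^bsub>M i\<^esub>})"
  have \<pi>c: "\<pi> (free_gen R {..<n} j) \<in> carrier X" if "j < n" for j
    using linear_map_closed[OF \<pi> free_gen_closed[OF ring]] that by simp
  have "finite F"
    unfolding F_def using linear_map_closed[OF v \<pi>c] by (auto simp: direct_sum_carrier)
  moreover have "v x i = \<zero>\<^bsub>M i\<^esub>" if x: "x \<in> carrier X" and i: "i \<in> J" "i \<notin> F" for x i
  proof -
    obtain g where g: "g \<in> carrier (free R {..<n})" "x = \<pi> g" using x surj by blast
    have "v (\<pi> g) i = \<zero>\<^bsub>M i\<^esub>"
    proof (rule free_map_ext[OF ring M[OF i(1)] _ linear_map_const_zero[OF M[OF i(1)]] _ g(1)])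
      show "linear_map R (free R {..<n}) (M i) (\<lambda>g. v (\<pi> g) i)"
        by (rule linear_map_comp[OF linear_map_comp[OF \<pi> v] linear_map_proj[OF i(1)]])
      show "v (\<pi> (free_gen R {..<n} j)) i = \<zero>\<^bsub>M i\<^esub>" if "j \<in> {..<n}" for j
        using that i by (auto simp: F_def)
    qed
    then show ?thesis using g by simp
  qed
  ultimately show thesis by (rule that)
qed

text \<open>Uses uniqueness of coordinates. The composite \<open>v\<close> of \<open>w\<close> with
  the epimorphism has coordinates in End(X) and, by orthogonality, zeros. As \<open>v\<close> lifts
  to the middle term, the combination of basis elements with these coordinates is zero, hence so are
  the coordinates.\<close>

lemma universal_hom:
  assumes \<X>: "\<And>X'. X' \<in> \<X> \<Longrightarrow> left_module R X'"
    and orth: "\<And>X' f x. \<lbrakk>X' \<in> \<X>; X' \<noteq> X; linear_map R X X' f; x \<in> carrier X\<rbrakk> \<Longrightarrow> f x = \<zero>\<^bsub>X'\<^esub>"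
    and w: "linear_map R X (ses_mid e) w" and x: "x \<in> carrier X"
  shows "w x \<in> ses_in e ` carrier Y"
proof -
  note d = short_exactD[OF e]
  interpret X: left_module R X by (rule X)
  interpret Y: left_module R Y by (rule Y)
  interpret E: left_module R "ses_mid e" by (rule d)
  interpret M: abelian_monoid "Ext1 R X Y" by (rule abelian_monoid_Ext1[OF Y])
  have DM: "left_module R (direct_sum I fst)" by (rule d(3))
  interpret DM: left_module R "direct_sum I fst" by (rule DM)
  obtain \<alpha> where \<alpha>: "\<And>b. b \<in> B X \<Longrightarrow> linear_map R (sub G K) Y (\<alpha> b)" "\<And>b. b \<in> B X \<Longrightarrow> b = cls Y (\<alpha> b)"
    and lift: "lifts_combinations \<alpha>"
    using universal_lift by blast
  define v where "v = (\<lambda>x. ses_out e (w x))"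
  have v: "linear_map R X (direct_sum I fst) v" unfolding v_def by (rule linear_map_comp[OF w d(5)])
  have vi: "linear_map R X (fst i) (\<lambda>x. v x i)" if "i \<in> I" for i
    by (rule linear_map_comp[OF v linear_map_proj[OF that]])
  have IM: "left_module R (fst i)" if "i \<in> I" for i using that \<X> by auto
  obtain F' where F': "finite F'" "\<And>x i. x \<in> carrier X \<Longrightarrow> i \<in> I \<Longrightarrow> i \<notin> F' \<Longrightarrow> v x i = \<zero>\<^bsub>fst i\<^esub>"
    by (rule finite_support[OF IM v]) blast+
  \<comment> \<open>The coordinates of \<open>v\<close>, restricted twice so as to be an extensional
    family of elements of \<open>Hom\<close>, the form in which \<open>module_basis\<close> asserts
    uniqueness.\<close>
  define c where "c = (\<lambda>b\<in>B X. \<lambda>x\<in>carrier X. v x (X, b))"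
  have XI: "(X, b) \<in> I" if "b \<in> B X" for b using that XX by simp
  have cH: "linear_map R X X (c b)" if b: "b \<in> B X" for b
    by (rule linear_map_cong[OF X vi[OF XI[OF b], simplified]]) (simp add: c_def b)
  have cPi: "c \<in> (\<Pi>\<^sub>E b\<in>B X. Hom R X X)"
    using cH by (auto simp: Hom_def c_def)
  define F where "F = {b \<in> B X. c b \<noteq> zero_map X X}"
  have FF': "(X, b) \<in> F'" if b: "b \<in> F" for b
  proof (rule ccontr)
    assume "(X, b) \<notin> F'"
    moreover have "b \<in> B X" using b by (simp add: F_def)
    ultimately have "c b = zero_map X X"
      using F'(2)[OF _ XI] by (auto simp: c_def zero_map_def intro!: restrict_ext)
    with b show False by (simp add: F_def)
  qed
  have F: "finite F" "F \<subseteq> B X"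
    using finite_subset[of F "snd ` F'"] F'(1) FF' by (force simp: F_def)+
  have cl: "linear_map R X X (c b)" if "b \<in> F" for b using cH that F(2) by blast
  obtain f0 where f0: "\<And>b. b \<in> F \<Longrightarrow> linear_map R G G (f0 b)"
    "\<And>b g. b \<in> F \<Longrightarrow> g \<in> carrier G \<Longrightarrow> \<pi> (f0 b g) = c b (\<pi> g)"
    using endo_lift[OF cl] by metis
  define \<sigma> where "\<sigma> = (\<lambda>k. \<Oplus>\<^bsub>Y\<^esub>b\<in>F. \<alpha> b (f0 b k))"
  have \<sigma>: "linear_map R (sub G K) Y \<sigma>"
    unfolding \<sigma>_def by (rule Ext1_combination(2)[where f = c, OF \<alpha> F cl f0])
  obtain s where s: "linear_map R G (ses_mid e) s"
    "\<forall>g\<in>carrier G. ses_out e (s g) = (\<lambda>i\<in>I. if i \<in> Pair X ` F then c (snd i) (\<pi> g) else \<zero>\<^bsub>fst i\<^esub>)"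
    "\<forall>k\<in>K. s k = ses_in e (\<sigma> k)"
    using lift[unfolded lifts_combinations_def, rule_format, of F c f0] F cl f0 unfolding \<sigma>_def by blast
  have vs: "v (\<pi> g) = ses_out e (s g)" if g: "g \<in> carrier G" for g
  proof (rule direct_sum_eqI[of _ I fst])
    have \<pi>g: "\<pi> g \<in> carrier X" by (rule linear_map_closed[OF \<pi>G g])
    show "v (\<pi> g) \<in> carrier (direct_sum I fst)" by (rule linear_map_closed[OF v \<pi>g])
    show "ses_out e (s g) \<in> carrier (direct_sum I fst)"
      by (rule short_exact_out[OF e linear_map_closed[OF s(1) g]])
    fix i assume i: "i \<in> I"
    show "v (\<pi> g) i = ses_out e (s g) i"
    proof (cases "fst i = X")
      case False
      then have "v (\<pi> g) i = \<zero>\<^bsub>fst i\<^esub>" using orth[OF _ False vi[OF i] \<pi>g] i by auto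
      moreover have "i \<notin> Pair X ` F" using False by auto
      ultimately show ?thesis using s(2) g i by simp
    next
      case True
      then have i': "i = (X, snd i)" "snd i \<in> B X" using i by (auto simp: prod_eq_iff)
      have cv: "v (\<pi> g) i = c (snd i) (\<pi> g)" using i' \<pi>g by (simp add: c_def)
      show ?thesis
      proof (cases "snd i \<in> F")
        case True
        then have "i \<in> Pair X ` F" using i'(1) by (metis imageI)
        then show ?thesis using s(2) g i cv by simp
      next
        case False
        then have "i \<notin> Pair X ` F" by auto
        moreover have "c (snd i) = zero_map X X" using False i'(2) by (simp add: F_def)
        ultimately show ?thesis using s(2) g i cv True \<pi>g by (simp add: zero_map_def)
      qed
    qed
  qed
  \<comment> \<open>\<open>s\<close> and \<open>w\<close> after \<pi> have the same image in the
    direct sum, so they differ by a map \<open>t\<close> into \<open>Y\<close>. On \<open>K\<close>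
    the second one vanishes, so \<sigma> is the restriction of \<open>t\<close> and has trivial
    class.\<close>
  obtain t where t: "linear_map R G Y t" "\<And>g. g \<in> carrier G \<Longrightarrow> ses_in e (t g) = s g \<ominus>\<^bsub>ses_mid e\<^esub> w (\<pi> g)"
  proof (rule short_exact_lift_in[OF e G linear_map_diff[OF d(2) s(1) linear_map_comp[OF \<pi>G w]]])
    fix g assume g: "g \<in> carrier G"
    have c: "s g \<in> carrier (ses_mid e)" "w (\<pi> g) \<in> carrier (ses_mid e)"
      by (rule linear_map_closed[OF s(1) g], rule linear_map_closed[OF linear_map_comp[OF \<pi>G w] g])
    have "ses_out e (s g) = ses_out e (w (\<pi> g))" using vs[OF g] by (simp add: v_def)
    then show "ses_out e (s g \<ominus>\<^bsub>ses_mid e\<^esub> w (\<pi> g)) = \<zero>\<^bsub>direct_sum I fst\<^esub>"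
      unfolding linear_map_minus[OF d(2,3,5) c]
      using DM.M.minus_eq_zero_iff[OF short_exact_out[OF e c(1)] short_exact_out[OF e c(2)]] by blast
  qed blast
  have \<sigma>t: "\<sigma> k = \<zero>\<^bsub>Y\<^esub> \<oplus>\<^bsub>Y\<^esub> t k" if k: "k \<in> K" for k
  proof -
    have "s k \<in> carrier (ses_mid e)" by (rule linear_map_closed[OF s(1) K_mem[OF k]])
    then have "s k \<ominus>\<^bsub>ses_mid e\<^esub> \<zero>\<^bsub>ses_mid e\<^esub> = s k" by (simp add: a_minus_def E.M.uminus_zero)
    then have "ses_in e (t k) = ses_in e (\<sigma> k)"
      using t(2)[OF K_mem[OF k]] s(3) k by (simp add: K_\<pi> linear_map_zero[OF X d(2) w])
    then have "t k = \<sigma> k"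
      using d(6) linear_map_closed[OF t(1) K_mem[OF k]] linear_map_closed[OF \<sigma>, of k] k by (auto dest: inj_onD)
    then show ?thesis using linear_map_closed[OF t(1) K_mem[OF k]] by simp
  qed
  have comb: "(\<Oplus>\<^bsub>Ext1 R X Y\<^esub>b\<in>F. c b \<odot>\<^bsub>Ext1 R X Y\<^esub> b) = cls Y \<sigma>"
    unfolding \<sigma>_def by (rule Ext1_combination(1)[where f = c, OF \<alpha> F cl f0])
  have sum0: "(\<Oplus>\<^bsub>Ext1 R X Y\<^esub>b\<in>F. c b \<odot>\<^bsub>Ext1 R X Y\<^esub> b) = \<zero>\<^bsub>Ext1 R X Y\<^esub>"
    unfolding comb Ext1_zero[OF Y]
    by (rule cls_eqI[OF Y \<sigma> linear_map_const_zero[OF Y] t(1) \<sigma>t])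
  define z where "z = (\<lambda>b\<in>B X. zero_map X X)"
  have zl: "zero_map X X \<in> Hom R X X"
    unfolding Hom_def zero_map_def
    using linear_map_cong[OF X linear_map_const_zero[OF X], of "\<lambda>x\<in>carrier X. \<zero>\<^bsub>X\<^esub>"] by simp
  have ex1: "\<exists>!c. c \<in> (\<Pi>\<^sub>E b\<in>B X. Hom R X X) \<and> finite {b \<in> B X. c b \<noteq> zero_map X X} \<and>
        \<zero>\<^bsub>Ext1 R X Y\<^esub> = (\<Oplus>\<^bsub>Ext1 R X Y\<^esub>b\<in>{b \<in> B X. c b \<noteq> zero_map X X}. c b \<odot>\<^bsub>Ext1 R X Y\<^esub> b)"
    by (rule basis_ex1[OF M.zero_closed])
  let ?P = "\<lambda>c. c \<in> (\<Pi>\<^sub>E b\<in>B X. Hom R X X) \<and> finite {b \<in> B X. c b \<noteq> zero_map X X} \<and>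
        \<zero>\<^bsub>Ext1 R X Y\<^esub> = (\<Oplus>\<^bsub>Ext1 R X Y\<^esub>b\<in>{b \<in> B X. c b \<noteq> zero_map X X}. c b \<odot>\<^bsub>Ext1 R X Y\<^esub> b)"
  have Pc: "?P c" using cPi F(1) sum0 unfolding F_def by simp
  have "{b \<in> B X. z b \<noteq> zero_map X X} = {}" by (auto simp: z_def)
  then have Pz: "?P z" using zl by (auto simp: z_def M.finsum_empty)
  \<comment> \<open>Both \<open>c\<close> and the zero family expand the zero class.\<close>
  have "c = z" by (rule trans[OF the1_equality[of ?P, OF ex1 Pc, symmetric] the1_equality[of ?P, OF ex1 Pz]])
  have "v x = \<zero>\<^bsub>direct_sum I fst\<^esub>"
  proof (rule direct_sum_eqI[OF linear_map_closed[OF v x] DM.M.zero_closed])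
    fix i assume i: "i \<in> I"
    show "v x i = \<zero>\<^bsub>direct_sum I fst\<^esub> i"
    proof (cases "fst i = X")
      case False
      then show ?thesis using orth[OF _ False vi[OF i] x] i by auto
    next
      case True
      then have i': "i = (X, snd i)" "snd i \<in> B X" using i by (auto simp: prod_eq_iff)
      have "v x i = c (snd i) x" using i' x by (simp add: c_def)
      also have "\<dots> = \<zero>\<^bsub>fst i\<^esub>" using \<open>c = z\<close> i' x True by (simp add: z_def zero_map_def)
      finally show ?thesis using i by simp
    qed
  qed
  then show ?thesis
    using d(8) linear_map_closed[OF w x] by (simp add: v_def)
qed

end

section \<open>Direct limits of chains\<close>

locale module_chain =
  fixes R :: "('r, 'k) ring_scheme" and N :: "nat \<Rightarrow> ('r, 'm) module" and \<phi> :: "nat \<Rightarrow> 'm \<Rightarrow> 'm"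
  assumes N: "left_module R (N n)" and \<phi>: "linear_map R (N n) (N (Suc n)) (\<phi> n)"
    and \<phi>_inj: "inj_on (\<phi> n) (carrier (N n))"
begin

abbreviation "V \<equiv> direct_limit N \<phi>"
abbreviation "j \<equiv> limit_elem N \<phi>"

lemma chain_map_linear: "linear_map R (N n) (N (n + k)) (chain_map \<phi> n k)"
proof (induction k)
  case 0
  show ?case using linear_map_ident[of R "N n"] by (simp add: linear_map_def)
next
  case (Suc k)
  show ?case using linear_map_comp[OF Suc \<phi>] by (simp add: linear_map_def)
qed

lemma chain_map_closed: "x \<in> carrier (N n) \<Longrightarrow> chain_map \<phi> n k x \<in> carrier (N (n + k))"
  by (rule linear_map_closed[OF chain_map_linear])

lemma chain_map_inj: "\<lbrakk>x \<in> carrier (N n); y \<in> carrier (N n); chain_map \<phi> n k x = chain_map \<phi> n k y\<rbrakk> \<Longrightarrow> x = y"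
proof (induction k)
  case (Suc k)
  then show ?case using inj_onD[OF \<phi>_inj] chain_map_closed by simp
qed simp

lemma chain_map_add: "chain_map \<phi> n (k + k') x = chain_map \<phi> (n + k) k' (chain_map \<phi> n k x)"
  by (induction k') (simp_all add: add.assoc)

text \<open>Two elements that become equal at some stage stay equal after \<open>k\<close> further
  steps, so membership may be tested from any later stage.\<close>

lemma limit_elem_shift: "j (n + k) (chain_map \<phi> n k x) = j n x"
proof -
  have "(m, y) \<in> j (n + k) (chain_map \<phi> n k x) \<longleftrightarrow> (m, y) \<in> j n x" for m y
  proof
    assume "(m, y) \<in> j (n + k) (chain_map \<phi> n k x)"
    then obtain k' l where "y \<in> carrier (N m)" "n + (k + k') = m + l"
      "chain_map \<phi> n (k + k') x = chain_map \<phi> m l y"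
      by (auto simp: limit_elem_def chain_map_add add.assoc)
    then show "(m, y) \<in> j n x" unfolding limit_elem_def by blast
  next
    assume "(m, y) \<in> j n x"
    then obtain k' l where *: "y \<in> carrier (N m)" "n + k' = m + l" "chain_map \<phi> n k' x = chain_map \<phi> m l y"
      by (auto simp: limit_elem_def)
    have "chain_map \<phi> (n + k) k' (chain_map \<phi> n k x) = chain_map \<phi> n (k' + k) x"
      by (simp only: chain_map_add[symmetric] add.commute[of k k'])
    also have "\<dots> = chain_map \<phi> m (l + k) y" using * by (simp add: chain_map_add)
    finally have "chain_map \<phi> (n + k) k' (chain_map \<phi> n k x) = chain_map \<phi> m (l + k) y" .
    moreover have "(n + k) + k' = m + (l + k)" using * by simp
    ultimately show "(m, y) \<in> j (n + k) (chain_map \<phi> n k x)"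
      using *(1) unfolding limit_elem_def by blast
  qed
  then show ?thesis by auto
qed

lemma limit_elem_Suc: "j (Suc n) (\<phi> n x) = j n x"
  using limit_elem_shift[of n 1 x] by simp

lemma limit_elem_self: "x \<in> carrier (N n) \<Longrightarrow> (n, x) \<in> j n x"
  by (auto simp: limit_elem_def)

lemma limit_elem_memD:
  assumes "(m, y) \<in> j n x" shows "y \<in> carrier (N m)" "j m y = j n x"
proof -
  obtain k l where *: "y \<in> carrier (N m)" "n + k = m + l" "chain_map \<phi> n k x = chain_map \<phi> m l y"
    using assms by (auto simp: limit_elem_def)
  then show "y \<in> carrier (N m)" by simp
  show "j m y = j n x" using limit_elem_shift[of m l y] limit_elem_shift[of n k x] * by simp
qed

text \<open>Injectivity of the maps of the chain enters here: elements with the same class agree at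
  a later stage, hence already at stage \<open>n\<close>.\<close>

lemma limit_elem_inj:
  assumes "x \<in> carrier (N n)" "y \<in> carrier (N n)" "j n x = j n y" shows "x = y"
proof -
  have "(n, y) \<in> j n x" using limit_elem_self[OF assms(2)] assms(3) by simp
  then obtain k where "chain_map \<phi> n k x = chain_map \<phi> n k y" by (auto simp: limit_elem_def)
  then show ?thesis using chain_map_inj assms by blast
qed

lemma limit_carrier: "carrier V = (\<Union>n. j n ` carrier (N n))"
  by (auto simp: direct_limit_def)

lemma limit_represent:
  assumes "C \<in> carrier V"
  obtains n where "\<And>m. m \<ge> n \<Longrightarrow> \<exists>x\<in>carrier (N m). C = j m x"
proof -
  obtain n x where x: "x \<in> carrier (N n)" "C = j n x" using assms by (auto simp: limit_carrier)
  have "\<exists>y\<in>carrier (N m). C = j m y" if "m \<ge> n" for m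
    using x chain_map_closed[OF x(1), of "m - n"] limit_elem_shift[of n "m - n" x] that by auto
  then show thesis by (rule that)
qed

lemma limit_common:
  assumes "n + k = m + l" "j n x = j m x'" "x \<in> carrier (N n)" "x' \<in> carrier (N m)"
  shows "chain_map \<phi> n k x = chain_map \<phi> m l x'"
proof (rule limit_elem_inj)
  show "chain_map \<phi> n k x \<in> carrier (N (n + k))" by (rule chain_map_closed[OF assms(3)])
  show "chain_map \<phi> m l x' \<in> carrier (N (n + k))" using chain_map_closed[OF assms(4), of l] assms(1) by simp
  show "j (n + k) (chain_map \<phi> n k x) = j (n + k) (chain_map \<phi> m l x')"
    using limit_elem_shift[of n k x] limit_elem_shift[of m l x'] assms(1,2) by simp
qed

lemma limit_add:
  assumes x: "x \<in> carrier (N n)" and y: "y \<in> carrier (N n)"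
  shows "j n x \<oplus>\<^bsub>V\<^esub> j n y = j n (x \<oplus>\<^bsub>N n\<^esub> y)"
proof -
  \<comment> \<open>The sum in the limit is a union over all pairs of representatives at a common
    stage; it is well defined once this family has a single member.\<close>
  let ?S = "{j m (x' \<oplus>\<^bsub>N m\<^esub> y') | m x' y'. (m, x') \<in> j n x \<and> (m, y') \<in> j n y}"
  have eq: "j m (x' \<oplus>\<^bsub>N m\<^esub> y') = j n (x \<oplus>\<^bsub>N n\<^esub> y)" if "(m, x') \<in> j n x" "(m, y') \<in> j n y" for m x' y'
  proof -
    note x' = limit_elem_memD[OF that(1)] and y' = limit_elem_memD[OF that(2)]
    \<comment> \<open>Representatives from stages \<open>m\<close> and \<open>n\<close> are compared
      at stage \<open>m + n\<close>, reached by \<open>n\<close> steps from the one and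
      \<open>m\<close> steps from the other.\<close>
    have cx: "chain_map \<phi> m n x' = chain_map \<phi> n m x" by (rule limit_common) (use x' x in auto)
    have cy: "chain_map \<phi> m n y' = chain_map \<phi> n m y" by (rule limit_common) (use y' y in auto)
    have "j m (x' \<oplus>\<^bsub>N m\<^esub> y') = j (m + n) (chain_map \<phi> m n (x' \<oplus>\<^bsub>N m\<^esub> y'))"
      by (simp add: limit_elem_shift)
    also have "chain_map \<phi> m n (x' \<oplus>\<^bsub>N m\<^esub> y') = chain_map \<phi> n m x \<oplus>\<^bsub>N (n + m)\<^esub> chain_map \<phi> n m y"
      using linear_map_add[OF chain_map_linear[of m n] x'(1) y'(1)] by (simp add: cx cy add.commute)
    also have "\<dots> = chain_map \<phi> n m (x \<oplus>\<^bsub>N n\<^esub> y)"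
      using linear_map_add[OF chain_map_linear[of n m] x y] by simp
    also have "j (m + n) \<dots> = j n (x \<oplus>\<^bsub>N n\<^esub> y)"
      using limit_elem_shift[of n m "x \<oplus>\<^bsub>N n\<^esub> y"] by (simp add: add.commute)
    finally show ?thesis .
  qed
  have "?S = {j n (x \<oplus>\<^bsub>N n\<^esub> y)}"
  proof
    show "?S \<subseteq> {j n (x \<oplus>\<^bsub>N n\<^esub> y)}" using eq by blast
    show "{j n (x \<oplus>\<^bsub>N n\<^esub> y)} \<subseteq> ?S" using limit_elem_self[OF x] limit_elem_self[OF y] by blast
  qed
  then show ?thesis by (simp add: direct_limit_def)
qed

lemma limit_smult:
  assumes r: "r \<in> carrier R" and x: "x \<in> carrier (N n)"
  shows "r \<odot>\<^bsub>V\<^esub> j n x = j n (r \<odot>\<^bsub>N n\<^esub> x)"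
proof -
  have eq: "j m (r \<odot>\<^bsub>N m\<^esub> x') = j n (r \<odot>\<^bsub>N n\<^esub> x)" if "(m, x') \<in> j n x" for m x'
  proof -
    note x' = limit_elem_memD[OF that]
    have cx: "chain_map \<phi> m n x' = chain_map \<phi> n m x" by (rule limit_common) (use x' x in auto)
    have "j m (r \<odot>\<^bsub>N m\<^esub> x') = j (m + n) (chain_map \<phi> m n (r \<odot>\<^bsub>N m\<^esub> x'))"
      by (simp add: limit_elem_shift)
    also have "chain_map \<phi> m n (r \<odot>\<^bsub>N m\<^esub> x') = r \<odot>\<^bsub>N (n + m)\<^esub> chain_map \<phi> n m x"
      using linear_map_smult[OF chain_map_linear[of m n] r x'(1)] by (simp add: cx add.commute)
    also have "\<dots> = chain_map \<phi> n m (r \<odot>\<^bsub>N n\<^esub> x)"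
      using linear_map_smult[OF chain_map_linear[of n m] r x] by simp
    also have "j (m + n) \<dots> = j n (r \<odot>\<^bsub>N n\<^esub> x)"
      using limit_elem_shift[of n m "r \<odot>\<^bsub>N n\<^esub> x"] by (simp add: add.commute)
    finally show ?thesis .
  qed
  have "(\<Union>(m, x')\<in>j n x. j m (r \<odot>\<^bsub>N m\<^esub> x')) = j n (r \<odot>\<^bsub>N n\<^esub> x)"
    using eq limit_elem_self[OF x] by blast
  then show ?thesis by (simp add: direct_limit_def)
qed

lemma limit_zero: "j n \<zero>\<^bsub>N n\<^esub> = \<zero>\<^bsub>V\<^esub>"
proof -
  have "chain_map \<phi> 0 n \<zero>\<^bsub>N 0\<^esub> = \<zero>\<^bsub>N n\<^esub>"
    using linear_map_zero[OF N N chain_map_linear[of 0 n]] by simp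
  then show ?thesis using limit_elem_shift[of 0 n "\<zero>\<^bsub>N 0\<^esub>"] by (simp add: direct_limit_def)
qed

lemma V: "left_module R V"
proof -
  have ring: "ring R" by (rule left_module_ring[OF N[of 0]])
  have N1: "abelian_monoid (N n)" for n
    using left_module_group[OF N] by (rule abelian_group.axioms)
  have N0: "\<zero>\<^bsub>N n\<^esub> \<in> carrier (N n)" for n using N1 by (rule abelian_monoid.zero_closed)
  have jV: "j n x \<in> carrier V" if "x \<in> carrier (N n)" for n x
    using that by (auto simp: limit_carrier)
  have ex2: "\<exists>n x y. x \<in> carrier (N n) \<and> y \<in> carrier (N n) \<and> C = j n x \<and> D = j n y"
    if CD: "C \<in> carrier V" "D \<in> carrier V" for C D
  proof -
    obtain n where n: "\<And>k. k \<ge> n \<Longrightarrow> \<exists>x\<in>carrier (N k). C = j k x"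
      using limit_represent[OF CD(1)] by blast
    obtain m where m: "\<And>k. k \<ge> m \<Longrightarrow> \<exists>x\<in>carrier (N k). D = j k x"
      using limit_represent[OF CD(2)] by blast
    show ?thesis using n[of "n + m"] m[of "n + m"] by auto
  qed
  have ex3: "\<exists>n x y z. x \<in> carrier (N n) \<and> y \<in> carrier (N n) \<and> z \<in> carrier (N n) \<and> C = j n x \<and> D = j n y \<and> E = j n z"
    if CDE: "C \<in> carrier V" "D \<in> carrier V" "E \<in> carrier V" for C D E
  proof -
    obtain n where n: "\<And>k. k \<ge> n \<Longrightarrow> \<exists>x\<in>carrier (N k). C = j k x"
      using limit_represent[OF CDE(1)] by blast
    obtain m where m: "\<And>k. k \<ge> m \<Longrightarrow> \<exists>x\<in>carrier (N k). D = j k x"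
      using limit_represent[OF CDE(2)] by blast
    obtain p where p: "\<And>k. k \<ge> p \<Longrightarrow> \<exists>x\<in>carrier (N k). E = j k x"
      using limit_represent[OF CDE(3)] by blast
    show ?thesis using n[of "n + m + p"] m[of "n + m + p"] p[of "n + m + p"] by auto
  qed
  show ?thesis
  proof (rule left_moduleI[OF ring])
    show "abelian_group V"
    proof (rule abelian_groupI)
      show "\<zero>\<^bsub>V\<^esub> \<in> carrier V" using jV[OF N0[of 0]] by (simp add: limit_zero)
    next
      fix C D assume "C \<in> carrier V" "D \<in> carrier V"
      then obtain n x y where c: "x \<in> carrier (N n)" "y \<in> carrier (N n)" "C = j n x" "D = j n y" using ex2 by meson
      show "C \<oplus>\<^bsub>V\<^esub> D \<in> carrier V"
        using c jV abelian_monoid.a_closed[OF N1] by (simp add: limit_add)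
      show "C \<oplus>\<^bsub>V\<^esub> D = D \<oplus>\<^bsub>V\<^esub> C"
        using c abelian_monoid.a_comm[OF N1] by (simp add: limit_add)
    next
      fix C D E assume "C \<in> carrier V" "D \<in> carrier V" "E \<in> carrier V"
      then obtain n x y z where c: "x \<in> carrier (N n)" "y \<in> carrier (N n)" "z \<in> carrier (N n)"
        "C = j n x" "D = j n y" "E = j n z" using ex3 by meson
      show "C \<oplus>\<^bsub>V\<^esub> D \<oplus>\<^bsub>V\<^esub> E = C \<oplus>\<^bsub>V\<^esub> (D \<oplus>\<^bsub>V\<^esub> E)"
        using c abelian_monoid.a_closed[OF N1] abelian_monoid.a_assoc[OF N1] by (simp add: limit_add)
    next
      fix C assume "C \<in> carrier V"
      then obtain n x where c: "x \<in> carrier (N n)" "C = j n x" by (auto simp: limit_carrier)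
      interpret Nn: left_module R "N n" by (rule N)
      have "j n \<zero>\<^bsub>N n\<^esub> \<oplus>\<^bsub>V\<^esub> C = C" using c by (simp add: limit_add)
      then show "\<zero>\<^bsub>V\<^esub> \<oplus>\<^bsub>V\<^esub> C = C" by (simp add: limit_zero)
      have "j n (\<ominus>\<^bsub>N n\<^esub> x) \<oplus>\<^bsub>V\<^esub> C = \<zero>\<^bsub>V\<^esub>" using c by (simp add: limit_add Nn.M.l_neg limit_zero)
      then show "\<exists>D\<in>carrier V. D \<oplus>\<^bsub>V\<^esub> C = \<zero>\<^bsub>V\<^esub>" using jV[of "\<ominus>\<^bsub>N n\<^esub> x" n] c by auto
    qed
  next
    fix a C assume a: "a \<in> carrier R" and "C \<in> carrier V"
    then obtain n x where c: "x \<in> carrier (N n)" "C = j n x" by (auto simp: limit_carrier)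
    show "a \<odot>\<^bsub>V\<^esub> C \<in> carrier V" using a c jV left_module.smult_closed[OF N] by (simp add: limit_smult)
  next
    fix a b C assume a: "a \<in> carrier R" "b \<in> carrier R" and "C \<in> carrier V"
    then obtain n x where c: "x \<in> carrier (N n)" "C = j n x" by (auto simp: limit_carrier)
    interpret Nn: left_module R "N n" by (rule N)
    show "(a \<oplus>\<^bsub>R\<^esub> b) \<odot>\<^bsub>V\<^esub> C = a \<odot>\<^bsub>V\<^esub> C \<oplus>\<^bsub>V\<^esub> b \<odot>\<^bsub>V\<^esub> C"
      using a c by (simp add: limit_smult limit_add Nn.smult_l_distr)
    show "(a \<otimes>\<^bsub>R\<^esub> b) \<odot>\<^bsub>V\<^esub> C = a \<odot>\<^bsub>V\<^esub> (b \<odot>\<^bsub>V\<^esub> C)"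
      using a c by (simp add: limit_smult Nn.smult_assoc1)
  next
    fix a C D assume a: "a \<in> carrier R" and "C \<in> carrier V" "D \<in> carrier V"
    then obtain n x y where c: "x \<in> carrier (N n)" "y \<in> carrier (N n)" "C = j n x" "D = j n y" using ex2 by meson
    interpret Nn: left_module R "N n" by (rule N)
    show "a \<odot>\<^bsub>V\<^esub> (C \<oplus>\<^bsub>V\<^esub> D) = a \<odot>\<^bsub>V\<^esub> C \<oplus>\<^bsub>V\<^esub> a \<odot>\<^bsub>V\<^esub> D"
      using a c by (simp add: limit_smult limit_add Nn.smult_r_distr)
  next
    fix C assume "C \<in> carrier V"
    then obtain n x where c: "x \<in> carrier (N n)" "C = j n x" by (auto simp: limit_carrier)
    interpret Nn: left_module R "N n" by (rule N)
    show "\<one>\<^bsub>R\<^esub> \<odot>\<^bsub>V\<^esub> C = C" using c by (simp add: limit_smult)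
  qed
qed

lemma j: "linear_map R (N n) V (j n)"
  by (rule linear_mapI) (auto simp: limit_add limit_smult limit_carrier)

text \<open>The copy of Y(n + 1) inside the limit. Indices start at zero, so \<open>W 0\<close> is
  the submodule Y itself.\<close>

definition W :: "nat \<Rightarrow> (nat \<times> 'm) set set" where "W n = j n ` carrier (N n)"

lemma W: "submod R V (W n)"
  unfolding W_def by (rule submod_image[OF N V j submod_carrier[OF N]])

lemma WM: "left_module R (sub V (W n))" by (rule left_module_sub[OF V W])

lemma W_Suc: "W n \<subseteq> W (Suc n)"
  unfolding W_def using limit_elem_Suc linear_map_closed[OF \<phi>] by (metis image_subsetI imageI)

lemma W_mono: "n \<le> m \<Longrightarrow> W n \<subseteq> W m"
  using lift_Suc_mono_le[of W, OF W_Suc] by blast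

lemma W_union: "carrier V = (\<Union>n. W n)"
  by (simp add: W_def limit_carrier)

text \<open>Translates maps into \<open>W n\<close> back into maps into \<open>N n\<close>, where
  the universal sequences live.\<close>

lemma W_inverse:
  obtains r where "linear_map R (sub V (W n)) (N n) r" "\<And>z. z \<in> W n \<Longrightarrow> j n (r z) = z"
    "\<And>x. x \<in> carrier (N n) \<Longrightarrow> r (j n x) = x"
proof -
  have lin: "linear_map R (N n) (sub V (W n)) (j n)"
    using j by (subst linear_map_to_sub[OF submod_subset[OF W]]) (auto simp: W_def)
  have bij: "bij_betw (j n) (carrier (N n)) (carrier (sub V (W n)))"
    by (auto simp: bij_betw_def W_def inj_on_def intro: limit_elem_inj)
  obtain r where r: "linear_map R (sub V (W n)) (N n) r" "\<And>x. x \<in> carrier (N n) \<Longrightarrow> r (j n x) = x"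
    and "\<And>z. z \<in> carrier (sub V (W n)) \<Longrightarrow> j n (r z) = z"
    using linear_map_inverse[OF N WM lin bij] by blast
  then show thesis using that by simp
qed

text \<open>Each of the \<open>k\<close> generators is sent into some term of an increasing chain,
  so one term receives them all.\<close>

lemma free_map_bounded:
  fixes k :: nat
  assumes f: "linear_map R (free R {..<k}) V f"
  obtains m where "\<And>x. x \<in> carrier (free R {..<k}) \<Longrightarrow> f x \<in> W m"
proof -
  have ring: "ring R" by (rule left_module_ring[OF V])
  have "\<exists>m. \<forall>i<l. f (free_gen R {..<k} i) \<in> W m" if "l \<le> k" for l
    using that
  proof (induction l)
    case (Suc l)
    then obtain m where m: "\<forall>i<l. f (free_gen R {..<k} i) \<in> W m" by auto
    have "f (free_gen R {..<k} l) \<in> carrier V"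
      using Suc.prems by (intro linear_map_closed[OF f free_gen_closed[OF ring]]) auto
    then obtain m' where "f (free_gen R {..<k} l) \<in> W m'" by (auto simp: W_union)
    with m have "\<forall>i<Suc l. f (free_gen R {..<k} i) \<in> W (m + m')"
      using W_mono[of m "m + m'"] W_mono[of m' "m + m'"] by (auto simp: less_Suc_eq)
    then show ?case by blast
  qed simp
  then obtain m where "\<forall>i<k. f (free_gen R {..<k} i) \<in> W m" by blast
  then show thesis using free_map_image[OF ring V f W[of m]] that by auto
qed

end

section \<open>The Pruefer module\<close>

lemma HomD: "f \<in> Hom R M N \<Longrightarrow> linear_map R M N f" "f \<in> Hom R M N \<Longrightarrow> f \<in> extensional (carrier M)"
  by (simp_all add: Hom_def)

lemma Hom_restrictI:
  assumes "left_module R M" "linear_map R M N f"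
  shows "(\<lambda>x\<in>carrier M. f x) \<in> Hom R M N"
  using linear_map_cong[OF assms, of "\<lambda>x\<in>carrier M. f x"] by (simp add: Hom_def)

lemma Hom_eqI:
  "\<lbrakk>f \<in> Hom R M N; g \<in> Hom R M N; \<And>x. x \<in> carrier M \<Longrightarrow> f x = g x\<rbrakk> \<Longrightarrow> f = g"
  by (auto simp: Hom_def intro: extensionalityI)

lemma End_ops:
  "f \<otimes>\<^bsub>End R M\<^esub> g = (\<lambda>x\<in>carrier M. g (f x))" "\<one>\<^bsub>End R M\<^esub> = (\<lambda>x\<in>carrier M. x)"
  "f \<oplus>\<^bsub>End R M\<^esub> g = (\<lambda>x\<in>carrier M. f x \<oplus>\<^bsub>M\<^esub> g x)" "\<zero>\<^bsub>End R M\<^esub> = (\<lambda>x\<in>carrier M. \<zero>\<^bsub>M\<^esub>)"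
  by (simp_all add: End_def compose_def zero_map_def)

lemma ring_End:
  assumes M: "left_module R M"
  shows "ring (End R M)"
proof -
  interpret M: left_module R M by (rule M)
  have mult: "f \<otimes>\<^bsub>End R M\<^esub> g \<in> Hom R M M" if "f \<in> Hom R M M" "g \<in> Hom R M M" for f g
    unfolding End_ops by (rule Hom_restrictI[OF M linear_map_comp[OF HomD(1)[OF that(1)] HomD(1)[OF that(2)]]])
  have one: "\<one>\<^bsub>End R M\<^esub> \<in> Hom R M M"
    unfolding End_ops by (rule Hom_restrictI[OF M linear_map_ident])
  have add: "f \<oplus>\<^bsub>End R M\<^esub> g \<in> Hom R M M" if "f \<in> Hom R M M" "g \<in> Hom R M M" for f g
    unfolding End_ops by (rule Hom_restrictI[OF M linear_map_plus[OF M HomD(1)[OF that(1)] HomD(1)[OF that(2)]]])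
  have zero: "\<zero>\<^bsub>End R M\<^esub> \<in> Hom R M M"
    unfolding End_ops by (rule Hom_restrictI[OF M linear_map_const_zero[OF M]])
  have cl: "f x \<in> carrier M" if "f \<in> Hom R M M" "x \<in> carrier M" for f x
    using linear_map_closed[OF HomD(1)[OF that(1)] that(2)] .
  show ?thesis
  proof (rule ringI)
    show "abelian_group (End R M)"
    proof (rule abelian_groupI)
      fix f assume f: "f \<in> carrier (End R M)"
      then have n: "(\<lambda>x\<in>carrier M. \<ominus>\<^bsub>M\<^esub> f x) \<in> Hom R M M"
        by (intro Hom_restrictI[OF M linear_map_neg[OF M]]) (auto dest: HomD)
      have "(\<lambda>x\<in>carrier M. \<ominus>\<^bsub>M\<^esub> f x) \<oplus>\<^bsub>End R M\<^esub> f = \<zero>\<^bsub>End R M\<^esub>"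
        using f by (auto simp: End_ops(3,4) cl M.M.l_neg simp del: End_simps(2) intro!: restrict_ext)
      then show "\<exists>g\<in>carrier (End R M). g \<oplus>\<^bsub>End R M\<^esub> f = \<zero>\<^bsub>End R M\<^esub>" using n by auto
      show "\<zero>\<^bsub>End R M\<^esub> \<oplus>\<^bsub>End R M\<^esub> f = f"
        by (rule Hom_eqI[OF add[OF zero]]) (use f in \<open>auto simp: End_ops(3,4) cl simp del: End_simps(2)\<close>)
    next
      fix f g assume "f \<in> carrier (End R M)" "g \<in> carrier (End R M)"
      then show "f \<oplus>\<^bsub>End R M\<^esub> g \<in> carrier (End R M)" "f \<oplus>\<^bsub>End R M\<^esub> g = g \<oplus>\<^bsub>End R M\<^esub> f"
        using add[of f g] by (auto simp: End_ops(3) cl M.M.a_comm intro!: restrict_ext)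
    next
      fix f g h assume "f \<in> carrier (End R M)" "g \<in> carrier (End R M)" "h \<in> carrier (End R M)"
      then show "f \<oplus>\<^bsub>End R M\<^esub> g \<oplus>\<^bsub>End R M\<^esub> h = f \<oplus>\<^bsub>End R M\<^esub> (g \<oplus>\<^bsub>End R M\<^esub> h)"
        by (auto simp: End_ops(3) cl M.M.a_assoc intro!: restrict_ext)
    qed (use zero in simp)
    show "monoid (End R M)"
    proof (rule monoidI)
      fix f g h assume "f \<in> carrier (End R M)" "g \<in> carrier (End R M)" "h \<in> carrier (End R M)"
      then show "f \<otimes>\<^bsub>End R M\<^esub> g \<otimes>\<^bsub>End R M\<^esub> h = f \<otimes>\<^bsub>End R M\<^esub> (g \<otimes>\<^bsub>End R M\<^esub> h)"
        by (auto simp: End_ops(1) cl intro!: restrict_ext)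
    next
      fix f assume f: "f \<in> carrier (End R M)"
      show "\<one>\<^bsub>End R M\<^esub> \<otimes>\<^bsub>End R M\<^esub> f = f"
        by (rule Hom_eqI[OF mult[OF one]]) (use f in \<open>auto simp: End_ops(1,2)\<close>)
      show "f \<otimes>\<^bsub>End R M\<^esub> \<one>\<^bsub>End R M\<^esub> = f"
        by (rule Hom_eqI[OF mult[OF _ one]]) (use f in \<open>auto simp: End_ops(1,2) cl\<close>)
    qed (use mult one in simp_all)
    fix f g h assume fgh: "f \<in> carrier (End R M)" "g \<in> carrier (End R M)" "h \<in> carrier (End R M)"
    then show "(f \<oplus>\<^bsub>End R M\<^esub> g) \<otimes>\<^bsub>End R M\<^esub> h = f \<otimes>\<^bsub>End R M\<^esub> h \<oplus>\<^bsub>End R M\<^esub> g \<otimes>\<^bsub>End R M\<^esub> h"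
      using linear_map_add[OF HomD(1), of h R M M] by (auto simp: End_ops(1,3) cl intro!: restrict_ext)
    show "h \<otimes>\<^bsub>End R M\<^esub> (f \<oplus>\<^bsub>End R M\<^esub> g) = h \<otimes>\<^bsub>End R M\<^esub> f \<oplus>\<^bsub>End R M\<^esub> h \<otimes>\<^bsub>End R M\<^esub> g"
      using fgh by (auto simp: End_ops(1,3) cl intro!: restrict_ext)
  qed
qed

lemma Unit_End_bij:
  assumes "f \<in> Units (End R M)"
  shows "bij_betw f (carrier M) (carrier M)"
proof -
  obtain g where fg: "f \<in> Hom R M M" "g \<in> Hom R M M" "g \<otimes>\<^bsub>End R M\<^esub> f = \<one>\<^bsub>End R M\<^esub>" "f \<otimes>\<^bsub>End R M\<^esub> g = \<one>\<^bsub>End R M\<^esub>"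
    using assms by (auto simp: Units_def)
  have 1: "f (g x) = x" and 2: "g (f x) = x" if "x \<in> carrier M" for x
    using fun_cong[OF fg(3), of x] fun_cong[OF fg(4), of x] that by (simp_all add: End_ops(1,2))
  show ?thesis
    by (rule bij_betw_byWitness[where f' = g])
      (use 1 2 linear_map_closed[OF HomD(1)[OF fg(1)]] linear_map_closed[OF HomD(1)[OF fg(2)]] in auto)
qed

lemma bij_Unit_End:
  assumes M: "left_module R M" and f: "f \<in> Hom R M M" and bij: "bij_betw f (carrier M) (carrier M)"
  shows "f \<in> Units (End R M)"
proof -
  obtain g where g: "linear_map R M M g" "\<And>x. x \<in> carrier M \<Longrightarrow> g (f x) = x" "\<And>x. x \<in> carrier M \<Longrightarrow> f (g x) = x"
    using linear_map_inverse[OF M M HomD(1)[OF f] bij] by blast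
  let ?g = "\<lambda>x\<in>carrier M. g x"
  have "?g \<in> carrier (End R M)" using Hom_restrictI[OF M g(1)] by simp
  moreover have "?g \<otimes>\<^bsub>End R M\<^esub> f = \<one>\<^bsub>End R M\<^esub>" "f \<otimes>\<^bsub>End R M\<^esub> ?g = \<one>\<^bsub>End R M\<^esub>"
    using g linear_map_closed[OF HomD(1)[OF f]] by (auto simp: End_ops(1,2) intro!: restrict_ext)
  ultimately show ?thesis using f unfolding Units_def by auto
qed

section \<open>The filtration of the limit and its layers\<close>

locale pruefer =
  fixes R :: "('r, 'k) ring_scheme" and \<X> :: "('r, 'x) module set" and Y :: "('r, 'x) module"
    and \<iota> :: "'x \<Rightarrow> 'm" and N :: "nat \<Rightarrow> ('r, 'm) module" and \<phi> :: "nat \<Rightarrow> 'm \<Rightarrow> 'm"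
  assumes R: "ring R" and sb: "semibrick R \<X>" and pd: "\<And>X. X \<in> \<X> \<Longrightarrow> proj_dim_le_one R X"
    and Y\<X>: "Y \<in> \<X>" and chain: "universal_chain R \<X> Y \<iota> N \<phi>"
begin

lemma brick_mem: "X \<in> \<X> \<Longrightarrow> brick R X"
  using sb by (simp add: semibrick_def)

lemma \<X>_module: "X \<in> \<X> \<Longrightarrow> left_module R X"
  using brick_mem by (simp add: brick_def finitely_presented_def)

lemma orthogonal:
  assumes "X \<in> \<X>" "X' \<in> \<X>" "X' \<noteq> X" "linear_map R X X' f" "x \<in> carrier X"
  shows "f x = \<zero>\<^bsub>X'\<^esub>"
proof -
  have "Hom R X X' = {zero_map X X'}" using sb assms(1-3) unfolding semibrick_def by metis
  then have "(\<lambda>x\<in>carrier X. f x) = zero_map X X'"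
    using Hom_restrictI[OF \<X>_module[OF assms(1)] assms(4)] by simp
  from fun_cong[OF this, of x] show ?thesis using assms(5) by (simp add: zero_map_def)
qed

lemma universal:
  obtains B :: "('r, 'x) module \<Rightarrow> ('r, 'm, 'x) extension set set" and p
  where "universal_ses R \<X> (N n) B \<lparr>ses_in = \<phi> n, ses_mid = N (Suc n), ses_out = p\<rparr>"
proof -
  have "\<exists>B p. universal_ses R \<X> (N n) B \<lparr>ses_in = \<phi> n, ses_mid = N (Suc n), ses_out = p\<rparr>"
    using chain by (simp add: universal_chain_def)
  then show thesis by (elim exE) (rule that)
qed

lemma step_exact:
  obtains B :: "('r, 'x) module \<Rightarrow> ('r, 'm, 'x) extension set set" and p
  where "short_exact R (N n) (direct_sum (Sigma \<X> B) fst)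
      \<lparr>ses_in = \<phi> n, ses_mid = N (Suc n), ses_out = p\<rparr>"
proof -
  obtain B p where "universal_ses R \<X> (N n) B \<lparr>ses_in = \<phi> n, ses_mid = N (Suc n), ses_out = p\<rparr>"
    by (rule universal[of n])
  then have "short_exact R (N n) (direct_sum (Sigma \<X> B) fst)
      \<lparr>ses_in = \<phi> n, ses_mid = N (Suc n), ses_out = p\<rparr>"
    unfolding universal_ses_def by (elim conjE)
  then show thesis by (rule that)
qed

lemma chain_step:
  "left_module R (N n) \<and> linear_map R (N n) (N (Suc n)) (\<phi> n) \<and> inj_on (\<phi> n) (carrier (N n))"
proof -
  obtain B :: "('r, 'x) module \<Rightarrow> ('r, 'm, 'x) extension set set" and p where "short_exact R (N n) (direct_sum (Sigma \<X> B) fst)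
      \<lparr>ses_in = \<phi> n, ses_mid = N (Suc n), ses_out = p\<rparr>" by (rule step_exact[of n])
  from short_exactD(1,4,6)[OF this] show ?thesis by simp
qed

sublocale module_chain R N \<phi>
  by (rule module_chain.intro) (simp_all add: chain_step)

interpretation V: left_module R V by (rule V)

text \<open>One universal sequence moved into the limit, as a map \<open>q\<close> with kernel
  \<open>W n\<close> onto a direct sum of members of \<X>. Nothing about bases is recorded: what
  they yield is carried by \<open>extend\<close> and \<open>hom_limit\<close>.\<close>

definition layer ::
  "nat \<Rightarrow> (('r, 'x) module \<times> ('r, 'm, 'x) extension set) set \<Rightarrow>
   ((nat \<times> 'm) set \<Rightarrow> ('r, 'x) module \<times> ('r, 'm, 'x) extension set \<Rightarrow> 'x) \<Rightarrow> bool" where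
  "layer n I q \<longleftrightarrow> linear_map R (sub V (W (Suc n))) (direct_sum I fst) q \<and>
     q ` W (Suc n) = carrier (direct_sum I fst) \<and>
     (\<forall>z\<in>W (Suc n). q z = \<zero>\<^bsub>direct_sum I fst\<^esub> \<longleftrightarrow> z \<in> W n) \<and> (\<forall>i\<in>I. fst i \<in> \<X>)"

lemma layer_exists: obtains I q where "layer n I q"
proof -
  obtain B :: "('r, 'x) module \<Rightarrow> ('r, 'm, 'x) extension set set" and p where e: "short_exact R (N n) (direct_sum (Sigma \<X> B) fst)
      \<lparr>ses_in = \<phi> n, ses_mid = N (Suc n), ses_out = p\<rparr>" by (rule step_exact[of n])
  note d = short_exactD[OF e, simplified]
  let ?I = "Sigma \<X> B"
  obtain r where r: "linear_map R (sub V (W (Suc n))) (N (Suc n)) r" "\<And>z. z \<in> W (Suc n) \<Longrightarrow> j (Suc n) (r z) = z"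
    "\<And>x. x \<in> carrier (N (Suc n)) \<Longrightarrow> r (j (Suc n) x) = x"
    using W_inverse[of "Suc n"] by blast
  have rc: "r z \<in> carrier (N (Suc n))" if "z \<in> W (Suc n)" for z
    using linear_map_closed[OF r(1), of z] that by simp
  have rim: "r ` W (Suc n) = carrier (N (Suc n))"
  proof
    show "r ` W (Suc n) \<subseteq> carrier (N (Suc n))" using rc by blast
    show "carrier (N (Suc n)) \<subseteq> r ` W (Suc n)"
    proof
      fix x assume x: "x \<in> carrier (N (Suc n))"
      then have "j (Suc n) x \<in> W (Suc n)" by (simp add: W_def)
      then show "x \<in> r ` W (Suc n)" using r(3)[OF x] by (metis imageI)
    qed
  qed
  have ker: "p (r z) = \<zero>\<^bsub>direct_sum ?I fst\<^esub> \<longleftrightarrow> z \<in> W n" if z: "z \<in> W (Suc n)" for z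
  proof
    assume "p (r z) = \<zero>\<^bsub>direct_sum ?I fst\<^esub>"
    then have "r z \<in> \<phi> n ` carrier (N n)" using d(8) rc[OF z] by simp
    then obtain y where y: "y \<in> carrier (N n)" "r z = \<phi> n y" by blast
    then have "z = j n y" using r(2)[OF z] limit_elem_Suc by simp
    then show "z \<in> W n" using y by (simp add: W_def)
  next
    assume "z \<in> W n"
    then obtain y where y: "y \<in> carrier (N n)" "z = j n y" by (auto simp: W_def)
    then have "z = j (Suc n) (\<phi> n y)" by (simp add: limit_elem_Suc)
    then have "r z = \<phi> n y" using r(3) linear_map_closed[OF \<phi> y(1)] by simp
    then have "r z \<in> \<phi> n ` carrier (N n)" using y by simp
    then show "p (r z) = \<zero>\<^bsub>direct_sum ?I fst\<^esub>" using d(8) by simp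
  qed
  have "layer n ?I (\<lambda>z. p (r z))"
    unfolding layer_def
  proof (intro conjI ballI)
    show "linear_map R (sub V (W (Suc n))) (direct_sum ?I fst) (\<lambda>z. p (r z))"
      by (rule linear_map_comp[OF r(1) d(5)])
    show "(\<lambda>z. p (r z)) ` W (Suc n) = carrier (direct_sum ?I fst)"
      using d(7) rim by (simp add: image_image[symmetric])
  qed (use ker in auto)
  then show thesis by (rule that)
qed

lemma layer_modules: "layer n I q \<Longrightarrow> i \<in> I \<Longrightarrow> left_module R (fst i)"
  using \<X>_module by (simp add: layer_def)

lemma layer_diff:
  assumes L: "layer n I q" and z: "z \<in> W (Suc n)" "z' \<in> W (Suc n)" "q z = q z'"
  shows "z \<ominus>\<^bsub>V\<^esub> z' \<in> W n"
proof -
  have lin: "linear_map R (sub V (W (Suc n))) (direct_sum I fst) q" using L by (simp add: layer_def)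
  have D: "left_module R (direct_sum I fst)" by (rule left_module_direct_sum[OF R layer_modules[OF L]])
  interpret D: left_module R "direct_sum I fst" by (rule D)
  have c: "z \<in> carrier V" "z' \<in> carrier V" using z submod_mem[OF W] by auto
  have d: "z \<ominus>\<^bsub>V\<^esub> z' \<in> W (Suc n)" using z by (intro submod_minus[OF V W])
  have "q z = q ((z \<ominus>\<^bsub>V\<^esub> z') \<oplus>\<^bsub>V\<^esub> z')" using V.M.minus_add_cancel[OF c] by simp
  also have "\<dots> = q (z \<ominus>\<^bsub>V\<^esub> z') \<oplus>\<^bsub>direct_sum I fst\<^esub> q z'"
    using linear_map_add[OF lin, of "z \<ominus>\<^bsub>V\<^esub> z'" z'] z d by (simp del: direct_sum_simps)
  finally have "q (z \<ominus>\<^bsub>V\<^esub> z') \<oplus>\<^bsub>direct_sum I fst\<^esub> q z' = q z'" using z(3) by simp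
  moreover have "q z' \<in> carrier (direct_sum I fst)" "q (z \<ominus>\<^bsub>V\<^esub> z') \<in> carrier (direct_sum I fst)"
    using linear_map_closed[OF lin] z d by simp_all
  ultimately have "q (z \<ominus>\<^bsub>V\<^esub> z') = \<zero>\<^bsub>direct_sum I fst\<^esub>"
    using D.M.add.r_cancel_one' by metis
  then show ?thesis using L d unfolding layer_def by blast
qed

text \<open>The induction step along the filtration. If \<open>q\<close> maps the part of
  \<open>H\<close> inside \<open>W (Suc n)\<close> onto each summand, it maps it onto the whole
  direct sum, and the remaining error lies in the kernel \<open>W n\<close>, which is contained in
  \<open>H\<close>.\<close>

lemma layer_generate:
  assumes L: "layer n I q" and H: "submod R V H" and WH: "W n \<subseteq> H"
    and gen: "\<And>i x. i \<in> I \<Longrightarrow> x \<in> carrier (fst i) \<Longrightarrow> \<exists>z\<in>H \<inter> W (Suc n). q z = ds_in I fst i x"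
  shows "W (Suc n) \<subseteq> H"
proof
  fix z assume z: "z \<in> W (Suc n)"
  have lin: "linear_map R (sub V (W (Suc n))) (direct_sum I fst) q"
    and surj: "q ` W (Suc n) = carrier (direct_sum I fst)" using L by (simp_all add: layer_def)
  have D: "left_module R (direct_sum I fst)" by (rule left_module_direct_sum[OF R layer_modules[OF L]])
  have "submod R (sub V (W (Suc n))) (H \<inter> W (Suc n))"
    using H W[of "Suc n"] by (auto simp: submod_def)
  then have "submod R (direct_sum I fst) (q ` (H \<inter> W (Suc n)))"
    by (rule submod_image[OF WM D lin])
  then have "q z \<in> q ` (H \<inter> W (Suc n))"
  proof (rule direct_sum_induct[OF R layer_modules[OF L], rotated 2])
    show "q z \<in> carrier (direct_sum I fst)" using z surj by blast
    show "ds_in I fst i y \<in> q ` (H \<inter> W (Suc n))" if "i \<in> I" "y \<in> carrier (fst i)" for i y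
      using gen[OF that] by (metis imageI)
  qed
  then obtain z' where z': "z' \<in> H" "z' \<in> W (Suc n)" "q z = q z'" by blast
  have "z \<ominus>\<^bsub>V\<^esub> z' \<in> H" using layer_diff[OF L z z'(2,3)] WH by blast
  then have "(z \<ominus>\<^bsub>V\<^esub> z') \<oplus>\<^bsub>V\<^esub> z' \<in> H" using z'(1) by (rule submod_add[OF H])
  then show "z \<in> H" using V.M.minus_add_cancel[of z z'] submod_mem[OF W] z z'(2) by simp
qed

definition u :: "'x \<Rightarrow> (nat \<times> 'm) set" where "u y = j 0 (\<iota> y)"

lemma u: "linear_map R Y V u" and u_inj: "inj_on u (carrier Y)" and u_image: "u ` carrier Y = W 0"
proof -
  have i: "linear_map R Y (N 0) \<iota>" "bij_betw \<iota> (carrier Y) (carrier (N 0))"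
    using chain by (simp_all add: universal_chain_def module_iso_def)
  show "linear_map R Y V u" unfolding u_def[abs_def] by (rule linear_map_comp[OF i(1) j])
  show "inj_on u (carrier Y)"
    using i(2) unfolding u_def inj_on_def bij_betw_def
    by (metis imageI limit_elem_inj)
  show "u ` carrier Y = W 0"
    using i(2) unfolding u_def W_def bij_betw_def by (metis image_image)
qed

end

text \<open>The kernel \<open>K\<close> of the presentation of \<open>X\<close> is finitely generated; this makes every linear map from
  \<open>K\<close> to the direct limit factor through a term of the chain.\<close>

locale pruefer_brick = pruefer R \<X> Y \<iota> N \<phi> + presentation R X n \<pi>
  for R :: "('r, 'k) ring_scheme" and \<X> :: "('r, 'x) module set" and Y :: "('r, 'x) module"
    and \<iota> :: "'x \<Rightarrow> 'm" and N :: "nat \<Rightarrow> ('r, 'm) module" and \<phi> :: "nat \<Rightarrow> 'm \<Rightarrow> 'm"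
    and X :: "('r, 'x) module" and n :: nat and \<pi> :: "(nat \<Rightarrow> 'r) \<Rightarrow> 'x" +
  fixes k :: nat and \<kappa> :: "(nat \<Rightarrow> 'r) \<Rightarrow> nat \<Rightarrow> 'r"
  assumes X\<X>: "X \<in> \<X>" and \<kappa>: "linear_map R (free R {..<k}) G \<kappa>" and \<kappa>_image: "\<kappa> ` carrier (free R {..<k}) = K"
begin

interpretation V: left_module R V by (rule V)

lemma K_map_bounded:
  assumes "linear_map R (sub G K) V \<mu>"
  obtains m where "\<mu> ` K \<subseteq> W m"
proof -
  have "linear_map R (free R {..<k}) (sub G K) \<kappa>"
    using \<kappa> \<kappa>_image by (subst linear_map_to_sub[OF submod_subset[OF K]]) auto
  then have lin: "linear_map R (free R {..<k}) V (\<lambda>x. \<mu> (\<kappa> x))" using assms by (rule linear_map_comp)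
  obtain m where m: "\<And>x. x \<in> carrier (free R {..<k}) \<Longrightarrow> \<mu> (\<kappa> x) \<in> W m"
    using free_map_bounded[OF lin] by blast
  show thesis
    by (rule that[of m]) (use m in \<open>auto simp: \<kappa>_image[symmetric]\<close>)
qed

text \<open>\<open>universal_extends\<close> applied in \<open>N m\<close>, then carried back to the
  limit. The target grows by exactly one step of the filtration.\<close>

lemma extend:
  assumes \<mu>: "linear_map R (sub G K) V \<mu>" and im: "\<mu> ` K \<subseteq> W m"
  obtains \<nu> where "linear_map R G V \<nu>" "\<nu> ` carrier G \<subseteq> W (Suc m)" "\<And>k. k \<in> K \<Longrightarrow> \<nu> k = \<mu> k"
proof -
  obtain B p where un: "universal_ses R \<X> (N m) B \<lparr>ses_in = \<phi> m, ses_mid = N (Suc m), ses_out = p\<rparr>"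
    by (rule universal[of m])
  have U: "universal_sequence R X n \<pi> \<X> (N m) B \<lparr>ses_in = \<phi> m, ses_mid = N (Suc m), ses_out = p\<rparr>"
    by (rule universal_sequence.intro[OF presentation_axioms universal_sequence_axioms.intro[OF un X\<X>]])
  obtain r where r: "linear_map R (sub V (W m)) (N m) r" "\<And>z. z \<in> W m \<Longrightarrow> j m (r z) = z"
  proof (rule W_inverse[of m])
  qed (rule that)
  have "linear_map R (sub G K) (sub V (W m)) \<mu>"
    using \<mu> im by (subst linear_map_to_sub[OF submod_subset[OF W]]) auto
  then have r\<mu>: "linear_map R (sub G K) (N m) (\<lambda>x. r (\<mu> x))" using r(1) by (rule linear_map_comp)
  obtain \<nu> where \<nu>: "linear_map R G (N (Suc m)) \<nu>" "\<And>k. k \<in> K \<Longrightarrow> \<nu> k = \<phi> m (r (\<mu> k))"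
    using universal_sequence.universal_extends[OF U r\<mu>] by auto
  show thesis
  proof (rule that)
    show "linear_map R G V (\<lambda>g. j (Suc m) (\<nu> g))" by (rule linear_map_comp[OF \<nu>(1) j])
    show "(\<lambda>g. j (Suc m) (\<nu> g)) ` carrier G \<subseteq> W (Suc m)"
      using linear_map_closed[OF \<nu>(1)] by (auto simp: W_def)
    show "j (Suc m) (\<nu> k) = \<mu> k" if "k \<in> K" for k
      using that \<nu>(2) r(2) im by (auto simp: limit_elem_Suc)
  qed
qed

text \<open>As \<open>X\<close> is finitely generated, its image lies in some \<open>W m\<close>;
  \<open>universal_hom\<close> then lowers \<open>m\<close> one step at a time.\<close>

lemma hom_limit:
  assumes w: "linear_map R X V w" and x: "x \<in> carrier X"
  shows "w x \<in> W 0"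
proof -
  have lin: "linear_map R (free R {..<n}) V (\<lambda>g. w (\<pi> g))" by (rule linear_map_comp[OF \<pi> w])
  obtain m where m: "\<And>x. x \<in> carrier (free R {..<n}) \<Longrightarrow> w (\<pi> x) \<in> W m"
    using free_map_bounded[OF lin] by blast
  have "w x \<in> W m" if "x \<in> carrier X" for x
    using m that unfolding surj[symmetric] by blast
  \<comment> \<open>The inclusion of the image in \<open>W m\<close> is part of the induction, so
    each step only has to pass from \<open>W (Suc m)\<close> to \<open>W m\<close>.\<close>
  then have "\<forall>x\<in>carrier X. w x \<in> W 0"
  proof (induction m)
    case (Suc m)
    obtain B p where un: "universal_ses R \<X> (N m) B \<lparr>ses_in = \<phi> m, ses_mid = N (Suc m), ses_out = p\<rparr>"
      by (rule universal[of m])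
    have U: "universal_sequence R X n \<pi> \<X> (N m) B \<lparr>ses_in = \<phi> m, ses_mid = N (Suc m), ses_out = p\<rparr>"
      by (rule universal_sequence.intro[OF presentation_axioms universal_sequence_axioms.intro[OF un X\<X>]])
    obtain r where r: "linear_map R (sub V (W (Suc m))) (N (Suc m)) r" "\<And>z. z \<in> W (Suc m) \<Longrightarrow> j (Suc m) (r z) = z"
    proof (rule W_inverse[of "Suc m"])
    qed (rule that)
    have "linear_map R X (sub V (W (Suc m))) w"
      using w Suc.prems by (subst linear_map_to_sub[OF submod_subset[OF W]]) auto
    then have rw: "linear_map R X (N (Suc m)) (\<lambda>x. r (w x))" using r(1) by (rule linear_map_comp)
    have "w x \<in> W m" if x: "x \<in> carrier X" for x
    proof -
      have "(\<lambda>x. r (w x)) x \<in> ses_in \<lparr>ses_in = \<phi> m, ses_mid = N (Suc m), ses_out = p\<rparr> ` carrier (N m)"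
      proof (rule universal_sequence.universal_hom[OF U])
        show "left_module R X'" if "X' \<in> \<X>" for X' using that by (rule \<X>_module)
        show "f x = \<zero>\<^bsub>X'\<^esub>" if "X' \<in> \<X>" "X' \<noteq> X" "linear_map R X X' f" "x \<in> carrier X" for X' f x
          using X\<X> that by (rule orthogonal)
      qed (use rw x in simp_all)
      then have "r (w x) \<in> \<phi> m ` carrier (N m)" by simp
      then obtain y where y: "y \<in> carrier (N m)" "r (w x) = \<phi> m y" by blast
      then have "w x = j m y" using r(2)[OF Suc.prems[OF x]] limit_elem_Suc by simp
      then show ?thesis using y by (simp add: W_def)
    qed
    then show ?case by (rule Suc.IH)
  qed blast
  then show ?thesis using x by blast
qed

text \<open>The difference vanishes on \<open>K\<close>, so it factors through \<open>X\<close>, and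
  maps from \<open>X\<close> to the limit have image in \<open>W 0\<close>.\<close>

lemma agree_on_K:
  assumes l: "linear_map R G V l" "linear_map R G V l'" and eq: "\<And>k. k \<in> K \<Longrightarrow> l k = l' k"
    and g: "g \<in> carrier G"
  shows "l g \<ominus>\<^bsub>V\<^esub> l' g \<in> W 0"
proof -
  have z: "l k \<ominus>\<^bsub>V\<^esub> l' k = \<zero>\<^bsub>V\<^esub>" if "k \<in> K" for k
    using eq[OF that] linear_map_closed[OF l(2) K_mem[OF that]] V.M.minus_eq_zero_iff by simp
  obtain w where w: "linear_map R X V w" "\<And>g. g \<in> carrier G \<Longrightarrow> w (\<pi> g) = l g \<ominus>\<^bsub>V\<^esub> l' g"
    using G_factor[OF V linear_map_diff[OF V l] z] by blast
  show ?thesis using hom_limit[OF w(1) linear_map_closed[OF \<pi>G g]] w(2)[OF g] by simp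
qed

text \<open>The form in which the comparison is used: an error in \<open>W 0\<close> is invisible to
  a submodule containing \<open>W 0\<close>.\<close>

lemma agree_on_K_mem:
  assumes l: "linear_map R G V l" "linear_map R G V l'" and eq: "\<And>k. k \<in> K \<Longrightarrow> l k = l' k"
    and g: "g \<in> carrier G" and H: "submod R V H" "W 0 \<subseteq> H" "l' g \<in> H"
  shows "l g \<in> H"
proof -
  have "(l g \<ominus>\<^bsub>V\<^esub> l' g) \<oplus>\<^bsub>V\<^esub> l' g \<in> H"
    using agree_on_K[OF l eq g] H by (blast intro: submod_add)
  then show ?thesis
    using V.M.minus_add_cancel[OF linear_map_closed[OF l(1) g] linear_map_closed[OF l(2) g]] by simp
qed

lemma K_lift:
  assumes f: "linear_map R V V f" and \<theta>: "linear_map R (sub G K) V \<theta>" and im: "\<theta> ` K \<subseteq> f ` carrier V"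
  obtains \<mu> where "linear_map R (sub G K) V \<mu>" "\<And>k. k \<in> K \<Longrightarrow> f (\<mu> k) = \<theta> k"
  using syzygy_lift[OF ring X pd[OF X\<X>] \<pi> surj V V f K_def[unfolded G_def] \<theta>[unfolded G_def] im] that
  unfolding G_def by blast

text \<open>A map from \<open>X\<close> into a layer need not lift to \<open>W (Suc m)\<close>, but
  its composite with \<pi> does, \<open>G\<close> being free. The failure is confined to
  \<open>K\<close>, which is sent into \<open>W m\<close>.\<close>

lemma layer_lift:
  assumes L: "layer m I q" and v: "linear_map R X (direct_sum I fst) v"
  obtains l where "linear_map R G V l" "l ` carrier G \<subseteq> W (Suc m)" "\<And>g. g \<in> carrier G \<Longrightarrow> q (l g) = v (\<pi> g)"
    "l ` K \<subseteq> W m"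
proof -
  have D: "left_module R (direct_sum I fst)" by (rule left_module_direct_sum[OF R layer_modules[OF L]])
  have lin: "linear_map R (sub V (W (Suc m))) (direct_sum I fst) q"
    and surj: "q ` W (Suc m) = carrier (direct_sum I fst)" using L by (simp_all add: layer_def)
  have v\<pi>: "linear_map R G (direct_sum I fst) (\<lambda>g. v (\<pi> g))" by (rule linear_map_comp[OF \<pi>G v])
  have im: "(\<lambda>g. v (\<pi> g)) ` carrier G \<subseteq> q ` carrier (sub V (W (Suc m)))"
    using linear_map_closed[OF v\<pi>] surj by auto
  obtain l where l: "linear_map R G (sub V (W (Suc m))) l" "\<And>g. g \<in> carrier G \<Longrightarrow> q (l g) = v (\<pi> g)"
    using G_lift[OF WM D lin v\<pi> im] by blast
  have l': "linear_map R G V l" "l ` carrier G \<subseteq> W (Suc m)"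
    using l(1) unfolding linear_map_to_sub[OF submod_subset[OF W]] by auto
  have "l k \<in> W m" if k: "k \<in> K" for k
  proof -
    have "q (l k) = \<zero>\<^bsub>direct_sum I fst\<^esub>"
      unfolding l(2)[OF K_mem[OF k]] K_\<pi>[OF k] by (rule linear_map_zero[OF X D v])
    moreover have "l k \<in> W (Suc m)" using l'(2) K_mem[OF k] by blast
    ultimately show ?thesis using L unfolding layer_def by blast
  qed
  then show thesis using l' l(2) by (intro that[of l]) auto
qed

end

section \<open>Endomorphisms of the limit\<close>

context pruefer
begin

interpretation V: left_module R V by (rule V)

lemma brick_presentation:
  assumes X: "X \<in> \<X>"
  obtains n \<pi> k \<kappa> where "pruefer_brick R \<X> Y \<iota> N \<phi> X n \<pi> k \<kappa>"
proof -
  have "finitely_presented R X" using brick_mem[OF X] by (simp add: brick_def)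
  then obtain k n \<kappa> \<pi> where f: "linear_map R (free R {..<k::nat}) (free R {..<n::nat}) \<kappa>"
    "linear_map R (free R {..<n}) X \<pi>" "\<pi> ` carrier (free R {..<n}) = carrier X"
    "\<kappa> ` carrier (free R {..<k}) = {x \<in> carrier (free R {..<n}). \<pi> x = \<zero>\<^bsub>X\<^esub>}"
    unfolding finitely_presented_def Let_def by (elim conjE exE) (rule that)
  have P: "presentation R X n \<pi>" by (rule presentation.intro[OF \<X>_module[OF X] f(2,3)])
  have "pruefer_brick R \<X> Y \<iota> N \<phi> X n \<pi> k \<kappa>"
  proof (intro pruefer_brick.intro pruefer_brick_axioms.intro)
    show "pruefer R \<X> Y \<iota> N \<phi>" by (rule pruefer_axioms)
    show "linear_map R (free R {..<k}) (presentation.G R n) \<kappa>"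
      using f(1) by (simp add: presentation.G_def[OF P])
    show "\<kappa> ` carrier (free R {..<k}) = presentation.K R X n \<pi>"
      using f(4) by (simp add: presentation.G_def[OF P] presentation.K_def[OF P])
  qed (fact P X)+
  then show thesis by (rule that)
qed

lemma hom_into_limit:
  assumes "X \<in> \<X>" "linear_map R X V w" "x \<in> carrier X"
  shows "w x \<in> W 0"
proof -
  obtain n \<pi> k \<kappa> where "pruefer_brick R \<X> Y \<iota> N \<phi> X n \<pi> k \<kappa>" by (rule brick_presentation[OF assms(1)])
  then show ?thesis using assms(2,3) by (rule pruefer_brick.hom_limit)
qed

text \<open>Schur's argument. The map lands in \<open>W 0\<close>, a copy of \<open>Y\<close>; being
  nonzero it forces \<open>X = Y\<close> by orthogonality, and then it is a nonzero element of the
  division ring of \<open>Y\<close>, hence a unit.\<close>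

lemma nonzero_hom:
  assumes X: "X \<in> \<X>" and w: "linear_map R X V w" and x: "x \<in> carrier X" "w x \<noteq> \<zero>\<^bsub>V\<^esub>"
  shows "w ` carrier X = W 0" and "inj_on w (carrier X)"
proof -
  have YM: "left_module R Y" by (rule \<X>_module[OF Y\<X>])
  have ul: "linear_map R Y (sub V (W 0)) u"
    using u u_image by (subst linear_map_to_sub[OF submod_subset[OF W]]) auto
  have ub: "bij_betw u (carrier Y) (carrier (sub V (W 0)))" using u_inj u_image by (simp add: bij_betw_def)
  obtain r where r: "linear_map R (sub V (W 0)) Y r" and r2: "\<And>z. z \<in> carrier (sub V (W 0)) \<Longrightarrow> u (r z) = z"
  proof (rule linear_map_inverse[OF YM WM ul ub])
  qed (rule that)
  have wl: "linear_map R X (sub V (W 0)) w"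
    using w hom_into_limit[OF X w] by (subst linear_map_to_sub[OF submod_subset[OF W]]) auto
  define g where "g = (\<lambda>x. r (w x))"
  have g: "linear_map R X Y g" unfolding g_def by (rule linear_map_comp[OF wl r])
  have ug: "u (g x) = w x" if "x \<in> carrier X" for x
    using r2[of "w x"] hom_into_limit[OF X w that] by (simp add: g_def)
  have gx: "g x \<noteq> \<zero>\<^bsub>Y\<^esub>"
  proof
    assume "g x = \<zero>\<^bsub>Y\<^esub>"
    then have "w x = u \<zero>\<^bsub>Y\<^esub>" using ug[OF x(1)] by simp
    then show False using x(2) linear_map_zero[OF YM V u] by simp
  qed
  have XY: "X = Y"
  proof (rule ccontr)
    assume "X \<noteq> Y"
    then have "g x = \<zero>\<^bsub>Y\<^esub>" using orthogonal[OF X Y\<X> _ g x(1)] by blast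
    with gx show False by simp
  qed
  define g' where "g' = (\<lambda>x\<in>carrier Y. g x)"
  have "g' \<in> Hom R Y Y" unfolding g'_def using Hom_restrictI[OF YM g[unfolded XY]] .
  moreover have "g' \<noteq> zero_map Y Y"
  proof
    assume "g' = zero_map Y Y"
    from fun_cong[OF this, of x] show False using gx x(1) XY by (simp add: g'_def zero_map_def)
  qed
  moreover have "division_ring (End R Y)" using brick_mem[OF Y\<X>] by (simp add: brick_def)
  ultimately have "g' \<in> Units (End R Y)" by (simp add: division_ring_def)
  then have "bij_betw g' (carrier Y) (carrier Y)" by (rule Unit_End_bij)
  then have b: "bij_betw g (carrier X) (carrier Y)"
    using bij_betw_cong[of "carrier Y" g' g "carrier Y"] by (simp add: g'_def XY)
  have "w ` carrier X = u ` g ` carrier X" using ug by (force simp: image_image)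
  then show "w ` carrier X = W 0" using b u_image by (simp add: bij_betw_def)
  have "inj_on (u \<circ> g) (carrier X)"
    using b u_inj by (intro comp_inj_on) (auto simp: bij_betw_def)
  then show "inj_on w (carrier X)" using ug by (simp add: inj_on_def)
qed

lemma endo_W0:
  assumes f: "linear_map R V V f" and z: "z \<in> W 0" "f z \<noteq> \<zero>\<^bsub>V\<^esub>"
  shows "f ` W 0 = W 0" and "inj_on f (W 0)"
proof -
  have fu: "linear_map R Y V (\<lambda>y. f (u y))" by (rule linear_map_comp[OF u f])
  obtain y where y: "y \<in> carrier Y" "z = u y" using z(1) u_image by blast
  have nz: "f (u y) \<noteq> \<zero>\<^bsub>V\<^esub>" using y z by simp
  show "f ` W 0 = W 0"
    using nonzero_hom(1)[OF Y\<X> fu y(1) nz] by (simp add: u_image[symmetric] image_image)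
  show "inj_on f (W 0)"
    using nonzero_hom(2)[OF Y\<X> fu y(1) nz] unfolding u_image[symmetric] by (auto simp: inj_on_def)
qed

lemma W0_in_image:
  assumes f: "linear_map R V V f" and z: "z \<in> carrier V" "f z \<noteq> \<zero>\<^bsub>V\<^esub>"
  shows "W 0 \<subseteq> f ` carrier V"
proof -
  define P where "P = (\<lambda>n. \<exists>z\<in>W n. f z \<noteq> \<zero>\<^bsub>V\<^esub>)"
  have "\<exists>n. P n" using z by (auto simp: W_union P_def)
  define n where "n = (LEAST n. P n)"
  have Pn: "P n" unfolding n_def using \<open>\<exists>n. P n\<close> by (rule LeastI_ex)
  have least: "\<not> P m" if "m < n" for m using not_less_Least that unfolding n_def .
  show ?thesis
  proof (cases n)
    case 0
    then obtain z0 where "z0 \<in> W 0" "f z0 \<noteq> \<zero>\<^bsub>V\<^esub>" using Pn by (auto simp: P_def)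
    then show ?thesis using endo_W0(1)[OF f] submod_subset[OF W] by blast
  next
    case (Suc m)
    have kill: "f z = \<zero>\<^bsub>V\<^esub>" if "z \<in> W m" for z using least[of m] Suc that by (auto simp: P_def)
    obtain I q where L: "layer m I q" by (rule layer_exists)
    have lin: "linear_map R (sub V (W (Suc m))) (direct_sum I fst) q"
      and surj: "q ` carrier (sub V (W (Suc m))) = carrier (direct_sum I fst)"
      and ker: "\<And>z. z \<in> W (Suc m) \<Longrightarrow> q z = \<zero>\<^bsub>direct_sum I fst\<^esub> \<Longrightarrow> z \<in> W m"
      and I\<X>: "\<And>i. i \<in> I \<Longrightarrow> fst i \<in> \<X>" using L by (auto simp: layer_def simp del: direct_sum_simps)
    have D: "left_module R (direct_sum I fst)" by (rule left_module_direct_sum[OF R layer_modules[OF L]])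
    have kq: "f z = \<zero>\<^bsub>V\<^esub>" if "z \<in> carrier (sub V (W (Suc m)))" "q z = \<zero>\<^bsub>direct_sum I fst\<^esub>" for z
      using kill[OF ker] that by (simp del: direct_sum_simps)
    \<comment> \<open>By minimality of \<open>n\<close>, the endomorphism kills the kernel
      \<open>W m\<close> of \<open>q\<close>, so it induces a map on the layer.\<close>
    obtain F where F: "linear_map R (direct_sum I fst) V F"
      and Fq: "\<And>z. z \<in> carrier (sub V (W (Suc m))) \<Longrightarrow> F (q z) = f z"
      using linear_map_factor[OF WM D V lin surj linear_map_restrict[OF f W] kq] by blast
    have Fin: "linear_map R (fst i) V (\<lambda>x. F (ds_in I fst i x))" if "i \<in> I" for i
      by (rule linear_map_comp[OF linear_map_ds_in[where M = fst, OF R layer_modules[OF L] that] F])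
    have "\<exists>i\<in>I. \<exists>x\<in>carrier (fst i). F (ds_in I fst i x) \<noteq> \<zero>\<^bsub>V\<^esub>"
    proof (rule ccontr)
      assume neg: "\<not> ?thesis"
      obtain z1 where z1: "z1 \<in> W (Suc m)" "f z1 \<noteq> \<zero>\<^bsub>V\<^esub>" using Pn Suc by (auto simp: P_def)
      have qz: "q z1 \<in> carrier (direct_sum I fst)" using linear_map_closed[OF lin, of z1] z1 by simp
      have "F (q z1) = \<zero>\<^bsub>V\<^esub>"
      proof (rule direct_sum_map_ext[OF R layer_modules[OF L] V F linear_map_const_zero[OF V] _ qz])
        show "F (ds_in I fst i y) = \<zero>\<^bsub>V\<^esub>" if "i \<in> I" "y \<in> carrier (fst i)" for i y
          using neg that by blast
      qed
      then show False using Fq[of z1] z1 by simp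
    qed
    then obtain i x where ix: "i \<in> I" "x \<in> carrier (fst i)" "F (ds_in I fst i x) \<noteq> \<zero>\<^bsub>V\<^esub>" by blast
    \<comment> \<open>The induced map is nonzero on a single summand and therefore already covers
      \<open>W 0\<close> there. Its values are values of \<open>f\<close> since \<open>q\<close> is
      onto.\<close>
    have "W 0 = (\<lambda>x. F (ds_in I fst i x)) ` carrier (fst i)"
      by (rule nonzero_hom(1)[OF I\<X>[OF ix(1)] Fin[OF ix(1)] ix(2,3), symmetric])
    also have "\<dots> \<subseteq> f ` carrier V"
    proof
      fix v assume "v \<in> (\<lambda>x. F (ds_in I fst i x)) ` carrier (fst i)"
      then obtain x where x: "x \<in> carrier (fst i)" "v = F (ds_in I fst i x)" by blast
      have "ds_in I fst i x \<in> q ` carrier (sub V (W (Suc m)))"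
        unfolding surj by (rule linear_map_closed[OF linear_map_ds_in[where M = fst, OF R layer_modules[OF L] ix(1)] x(1)])
      then obtain z where zz: "z \<in> carrier (sub V (W (Suc m)))" "ds_in I fst i x = q z" by blast
      then have "v = f z" using x Fq by simp
      then show "v \<in> f ` carrier V" using zz submod_mem[OF W] by auto
    qed
    finally show ?thesis .
  qed
qed

lemma endo_surj:
  assumes f: "linear_map R V V f" and z: "z \<in> carrier V" "f z \<noteq> \<zero>\<^bsub>V\<^esub>"
  shows "f ` carrier V = carrier V"
proof -
  note W0 = W0_in_image[OF assms]
  have H: "submod R V (f ` carrier V)" by (rule submod_image[OF V V f submod_carrier[OF V]])
  have "W n \<subseteq> f ` carrier V" for n
  proof (induction n)
    case 0
    show ?case by (rule W0)
  next
    case (Suc n)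
    obtain I q where L: "layer n I q" by (rule layer_exists)
    show ?case
    proof (rule layer_generate[OF L H Suc])
      fix i x assume i: "i \<in> I" and x: "x \<in> carrier (fst i)"
      have iX: "fst i \<in> \<X>" using L i by (simp add: layer_def)
      obtain k \<pi> k' \<kappa> where B: "pruefer_brick R \<X> Y \<iota> N \<phi> (fst i) k \<pi> k' \<kappa>" by (rule brick_presentation[OF iX])
      interpret B: pruefer_brick R \<X> Y \<iota> N \<phi> "fst i" k \<pi> k' \<kappa> by (rule B)
      have din: "linear_map R (fst i) (direct_sum I fst) (ds_in I fst i)"
        by (rule linear_map_ds_in[where M = fst, OF R layer_modules[OF L] i])
      obtain l where l: "linear_map R B.G V l" "l ` carrier B.G \<subseteq> W (Suc n)"
        "\<And>g. g \<in> carrier B.G \<Longrightarrow> q (l g) = ds_in I fst i (\<pi> g)" "l ` B.K \<subseteq> W n"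
        using B.layer_lift[OF L din] by blast
      have lK: "l ` B.K \<subseteq> f ` carrier V" using l(4) Suc by blast
      \<comment> \<open>Lifting along \<open>f\<close> leaves the filtration: \<mu> need not take
        values in \<open>W n\<close>. Finite generation of the kernel supplies a bound
        \<open>m\<close> unrelated to \<open>n\<close>, which is enough to extend \<mu>.\<close>
      obtain \<mu> where \<mu>: "linear_map R (sub B.G B.K) V \<mu>" "\<And>k. k \<in> B.K \<Longrightarrow> f (\<mu> k) = l k"
        using B.K_lift[OF f linear_map_restrict[OF l(1) B.K] lK] by blast
      obtain m where m: "\<mu> ` B.K \<subseteq> W m" by (rule B.K_map_bounded[OF \<mu>(1)])
      obtain \<nu> where \<nu>: "linear_map R B.G V \<nu>" "\<nu> ` carrier B.G \<subseteq> W (Suc m)" "\<And>k. k \<in> B.K \<Longrightarrow> \<nu> k = \<mu> k"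
        using B.extend[OF \<mu>(1) m] by blast
      \<comment> \<open>On the kernel, \<open>l\<close> and \<open>f\<close> after \<nu> agree. The
        discrepancy elsewhere lies in \<open>W 0\<close>, which the image of \<open>f\<close> is
        already known to contain.\<close>
      have lf: "l g \<in> f ` carrier V" if g: "g \<in> carrier B.G" for g
      proof (rule B.agree_on_K_mem[OF l(1) linear_map_comp[OF \<nu>(1) f] _ g H W0])
        show "l k = f (\<nu> k)" if "k \<in> B.K" for k using that \<mu>(2) \<nu>(3) by simp
        show "f (\<nu> g) \<in> f ` carrier V" using linear_map_closed[OF \<nu>(1) g] by blast
      qed
      obtain g where g: "g \<in> carrier B.G" "x = \<pi> g" using x B.surjG by blast
      have "l g \<in> f ` carrier V \<inter> W (Suc n)" using lf[OF g(1)] l(2) g(1) by blast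
      then show "\<exists>z\<in>f ` carrier V \<inter> W (Suc n). q z = ds_in I fst i x" using l(3)[OF g(1)] g(2) by blast
    qed
  qed
  then have "carrier V \<subseteq> f ` carrier V" unfolding W_union by blast
  then show ?thesis using linear_map_closed[OF f] by blast
qed

lemma endo_bij_step:
  assumes f: "linear_map R V V f" and im: "f ` W n = W n" and inj: "inj_on f (W n)"
  shows "f ` W (Suc n) = W (Suc n)" and "inj_on f (W (Suc n))"
proof -
  have W0n: "W 0 \<subseteq> W n" "W 0 \<subseteq> W (Suc n)" using W_mono[of 0 n] W_mono[of 0 "Suc n"] by auto
  have fz: "f \<zero>\<^bsub>V\<^esub> = \<zero>\<^bsub>V\<^esub>" by (rule linear_map_zero[OF V V f])
  have fW: "linear_map R (sub V (W n)) (sub V (W n)) f"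
    using linear_map_restrict[OF f W] im by (subst linear_map_to_sub[OF submod_subset[OF W]]) auto
  have fbij: "bij_betw f (carrier (sub V (W n))) (carrier (sub V (W n)))" using im inj by (simp add: bij_betw_def)
  \<comment> \<open>\<open>a\<close> inverts \<open>f\<close> on \<open>W n\<close>. Lifting through
    \<open>a\<close> instead of through \<open>f\<close> keeps the lifts inside \<open>W n\<close>,
    so that their extensions stay in \<open>W (Suc n)\<close>.\<close>
  obtain a where a: "linear_map R (sub V (W n)) (sub V (W n)) a"
    and a1': "\<And>z. z \<in> carrier (sub V (W n)) \<Longrightarrow> a (f z) = z"
    and a2': "\<And>z. z \<in> carrier (sub V (W n)) \<Longrightarrow> f (a z) = z"
    using linear_map_inverse[OF WM WM fW fbij] by blast
  have a1: "a (f z) = z" and a2: "f (a z) = z" and aW: "a z \<in> W n" if "z \<in> W n" for z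
    using a1'[of z] a2'[of z] linear_map_closed[OF a, of z] that by simp_all
  have fWn: "f z \<in> W n" if "z \<in> W n" for z using im that by blast
  have aV: "linear_map R (sub V (W n)) V a"
    using a unfolding linear_map_to_sub[OF submod_subset[OF W]] by blast
  obtain I q where L: "layer n I q" by (rule layer_exists)
  let ?Q = "direct_sum I fst"
  have lin: "linear_map R (sub V (W (Suc n))) ?Q q"
    and surj: "q ` W (Suc n) = carrier ?Q"
    and ker: "\<And>z. z \<in> W (Suc n) \<Longrightarrow> q z = \<zero>\<^bsub>?Q\<^esub> \<longleftrightarrow> z \<in> W n"
    and I\<X>: "\<And>i. i \<in> I \<Longrightarrow> fst i \<in> \<X>" using L by (auto simp: layer_def simp del: direct_sum_simps)
  have Q: "left_module R ?Q" by (rule left_module_direct_sum[OF R layer_modules[OF L]])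
  interpret Q: left_module R ?Q by (rule Q)
  have din: "linear_map R (fst i) ?Q (ds_in I fst i)" if "i \<in> I" for i
    by (rule linear_map_ds_in[where M = fst, OF R layer_modules[OF L] that])
  \<comment> \<open>Invariance of \<open>W (Suc n)\<close>: on the kernel, \<open>f\<close> after
    \<open>l\<close> lands in \<open>W n\<close> and so extends to a map \<nu> into
    \<open>W (Suc n)\<close>; the two differ by elements of \<open>W 0\<close> only.\<close>
  have into: "W (Suc n) \<subseteq> {z \<in> carrier V. f z \<in> W (Suc n)}"
  proof (rule layer_generate[OF L submod_vimage[OF V V f W]])
    show "W n \<subseteq> {z \<in> carrier V. f z \<in> W (Suc n)}"
      using fWn W_Suc[of n] submod_subset[OF W[of n]] by blast
    fix i x assume i: "i \<in> I" and x: "x \<in> carrier (fst i)"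
    obtain k \<pi> k' \<kappa> where B: "pruefer_brick R \<X> Y \<iota> N \<phi> (fst i) k \<pi> k' \<kappa>" by (rule brick_presentation[OF I\<X>[OF i]])
    interpret B: pruefer_brick R \<X> Y \<iota> N \<phi> "fst i" k \<pi> k' \<kappa> by (rule B)
    obtain l where l: "linear_map R B.G V l" "l ` carrier B.G \<subseteq> W (Suc n)"
      "\<And>g. g \<in> carrier B.G \<Longrightarrow> q (l g) = ds_in I fst i (\<pi> g)" "l ` B.K \<subseteq> W n"
      using B.layer_lift[OF L din[OF i]] by blast
    have fl: "linear_map R B.G V (\<lambda>g. f (l g))" by (rule linear_map_comp[OF l(1) f])
    have flK: "(\<lambda>g. f (l g)) ` B.K \<subseteq> W n" using l(4) fWn by blast
    obtain \<nu> where \<nu>: "linear_map R B.G V \<nu>" "\<nu> ` carrier B.G \<subseteq> W (Suc n)" "\<And>k. k \<in> B.K \<Longrightarrow> \<nu> k = f (l k)"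
      using B.extend[OF linear_map_restrict[OF fl B.K] flK] by blast
    obtain g where g: "g \<in> carrier B.G" "x = \<pi> g" using x B.surjG by blast
    have "f (l g) \<in> W (Suc n)"
    proof (rule B.agree_on_K_mem[OF fl \<nu>(1) _ g(1) W W0n(2)])
      show "f (l k) = \<nu> k" if "k \<in> B.K" for k using \<nu>(3)[OF that] by simp
      show "\<nu> g \<in> W (Suc n)" using \<nu>(2) g(1) by blast
    qed
    then have "l g \<in> {z \<in> carrier V. f z \<in> W (Suc n)} \<inter> W (Suc n)" using l(2) g(1) linear_map_closed[OF l(1) g(1)] by blast
    then show "\<exists>z\<in>{z \<in> carrier V. f z \<in> W (Suc n)} \<inter> W (Suc n). q z = ds_in I fst i x"
      using l(3)[OF g(1)] g(2) by blast
  qed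
  then have fW': "f z \<in> W (Suc n)" if "z \<in> W (Suc n)" for z using that by blast
  \<comment> \<open>Lifting the inclusion of each summand of \<open>?Q\<close> along the map induced by \<open>f\<close>.\<close>
  have pre: "\<exists>h. linear_map R (fst i) ?Q h \<and>
      (\<forall>x\<in>carrier (fst i). \<exists>z\<in>W (Suc n). h x = q z \<and> q (f z) = ds_in I fst i x)" if i: "i \<in> I" for i
  proof -
    obtain k \<pi> k' \<kappa> where B: "pruefer_brick R \<X> Y \<iota> N \<phi> (fst i) k \<pi> k' \<kappa>" by (rule brick_presentation[OF I\<X>[OF i]])
    interpret B: pruefer_brick R \<X> Y \<iota> N \<phi> "fst i" k \<pi> k' \<kappa> by (rule B)
    obtain l where l: "linear_map R B.G V l" "l ` carrier B.G \<subseteq> W (Suc n)"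
      "\<And>g. g \<in> carrier B.G \<Longrightarrow> q (l g) = ds_in I fst i (\<pi> g)" "l ` B.K \<subseteq> W n"
      using B.layer_lift[OF L din[OF i]] by blast
    \<comment> \<open>The inverse \<open>a\<close> is applied to \<open>l\<close> on the kernel
      only, where \<open>l\<close> takes values in \<open>W n\<close>; the extension \<nu> is then a
      candidate for a preimage of \<open>l\<close> under \<open>f\<close>.\<close>
    have "linear_map R (sub B.G B.K) (sub V (W n)) l"
      using linear_map_restrict[OF l(1) B.K] l(4) by (subst linear_map_to_sub[OF submod_subset[OF W]]) auto
    then have al: "linear_map R (sub B.G B.K) V (\<lambda>k. a (l k))" using aV by (rule linear_map_comp)
    have alK: "(\<lambda>k. a (l k)) ` B.K \<subseteq> W n" using l(4) aW by blast
    obtain \<nu> where \<nu>: "linear_map R B.G V \<nu>" "\<nu> ` carrier B.G \<subseteq> W (Suc n)" "\<And>k. k \<in> B.K \<Longrightarrow> \<nu> k = a (l k)"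
      using B.extend[OF al alK] by blast
    have "linear_map R B.G (sub V (W (Suc n))) \<nu>"
      using \<nu>(1,2) by (subst linear_map_to_sub[OF submod_subset[OF W]]) auto
    then have q\<nu>: "linear_map R B.G ?Q (\<lambda>g. q (\<nu> g))" using lin by (rule linear_map_comp)
    have z: "q (\<nu> k) = \<zero>\<^bsub>?Q\<^esub>" if "k \<in> B.K" for k
    proof -
      have "\<nu> k \<in> W n" using \<nu>(3)[OF that] alK that by auto
      moreover have "\<nu> k \<in> W (Suc n)" using \<nu>(2) B.K_mem[OF that] by blast
      ultimately show ?thesis using ker by blast
    qed
    obtain h where h: "linear_map R (fst i) ?Q h" "\<And>g. g \<in> carrier B.G \<Longrightarrow> h (\<pi> g) = q (\<nu> g)"
      using B.G_factor[OF Q q\<nu> z] by blast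
    have "\<exists>z\<in>W (Suc n). h x = q z \<and> q (f z) = ds_in I fst i x" if x: "x \<in> carrier (fst i)" for x
    proof -
      obtain g where g: "g \<in> carrier B.G" "x = \<pi> g" using x B.surjG by blast
      have \<nu>g: "\<nu> g \<in> W (Suc n)" and lg: "l g \<in> W (Suc n)" using \<nu>(2) l(2) g(1) by blast+
      have "f (\<nu> g) \<ominus>\<^bsub>V\<^esub> l g \<in> W 0"
      proof (rule B.agree_on_K[OF linear_map_comp[OF \<nu>(1) f] l(1) _ g(1)])
        show "f (\<nu> k) = l k" if "k \<in> B.K" for k
        proof -
          have "l k \<in> W n" using l(4) that by blast
          then show ?thesis using \<nu>(3)[OF that] a2 by simp
        qed
      qed
      \<comment> \<open>The discrepancy between \<open>f\<close> after \<nu> and \<open>l\<close>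
        lies in \<open>W 0\<close>, hence in \<open>W n\<close>, and disappears under
        \<open>q\<close>.\<close>
      then have dW: "f (\<nu> g) \<ominus>\<^bsub>V\<^esub> l g \<in> W n" "f (\<nu> g) \<ominus>\<^bsub>V\<^esub> l g \<in> W (Suc n)" using W0n by blast+
      have "f (\<nu> g) = (f (\<nu> g) \<ominus>\<^bsub>V\<^esub> l g) \<oplus>\<^bsub>V\<^esub> l g"
        using V.M.minus_add_cancel[OF submod_mem[OF W fW'[OF \<nu>g]] submod_mem[OF W lg]] by simp
      then have "q (f (\<nu> g)) = q (f (\<nu> g) \<ominus>\<^bsub>V\<^esub> l g) \<oplus>\<^bsub>?Q\<^esub> q (l g)"
        using linear_map_add[OF lin, of "f (\<nu> g) \<ominus>\<^bsub>V\<^esub> l g" "l g"] dW(2) lg by (simp del: direct_sum_simps)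
      also have "\<dots> = \<zero>\<^bsub>?Q\<^esub> \<oplus>\<^bsub>?Q\<^esub> q (l g)" using ker[OF dW(2)] dW(1) by (simp del: direct_sum_simps)
      also have "\<dots> = q (l g)"
        using linear_map_closed[OF lin, of "l g"] lg by (intro Q.M.l_zero) simp
      finally have "q (f (\<nu> g)) = ds_in I fst i x" using l(3)[OF g(1)] g(2) by simp
      then show ?thesis using h(2)[OF g(1)] g(2) \<nu>g by blast
    qed
    with h(1) show ?thesis by blast
  qed
  show "f ` W (Suc n) = W (Suc n)"
  proof
    show "f ` W (Suc n) \<subseteq> W (Suc n)" using fW' by blast
    show "W (Suc n) \<subseteq> f ` W (Suc n)"
    proof (rule layer_generate[OF L submod_image[OF V V f W]])
      show "W n \<subseteq> f ` W (Suc n)" using image_mono[OF W_Suc[of n], of f] im by simp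
      fix i x assume "i \<in> I" "x \<in> carrier (fst i)"
      then obtain z where "z \<in> W (Suc n)" "q (f z) = ds_in I fst i x" using pre by blast
      then show "\<exists>z\<in>f ` W (Suc n) \<inter> W (Suc n). q z = ds_in I fst i x" using fW' by blast
    qed
  qed
  have qf: "linear_map R (sub V (W (Suc n))) ?Q (\<lambda>z. q (f z))"
  proof (rule linear_map_comp[OF _ lin])
    show "linear_map R (sub V (W (Suc n))) (sub V (W (Suc n))) f"
      using linear_map_restrict[OF f W] fW' by (subst linear_map_to_sub[OF submod_subset[OF W]]) auto
  qed
  have surj': "q ` carrier (sub V (W (Suc n))) = carrier ?Q" using surj by simp
  have kf: "q (f z) = \<zero>\<^bsub>?Q\<^esub>" if "z \<in> carrier (sub V (W (Suc n)))" "q z = \<zero>\<^bsub>?Q\<^esub>" for z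
  proof -
    have z: "z \<in> W (Suc n)" "z \<in> W n" using that ker[of z] by simp_all
    have "f z \<in> W n" by (rule fWn[OF z(2)])
    then show ?thesis using ker[OF fW'[OF z(1)]] by blast
  qed
  \<comment> \<open>The endomorphism induced by \<open>f\<close> on the layer.\<close>
  obtain F where F: "linear_map R ?Q ?Q F" and Fq': "\<And>z. z \<in> carrier (sub V (W (Suc n))) \<Longrightarrow> F (q z) = q (f z)"
    using linear_map_factor[OF WM Q Q lin surj' qf kf] by blast
  have Fq: "F (q z) = q (f z)" if "z \<in> W (Suc n)" for z using Fq'[of z] that by simp
  \<comment> \<open>\<open>F\<close> is injective on maps from members of \<X>; this is weaker than
    injectivity of \<open>F\<close> and is all that can be reached by lifting presentations.\<close>
  have hom_inj: "v x = \<zero>\<^bsub>?Q\<^esub>" if X: "X \<in> \<X>" and v: "linear_map R X ?Q v"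
    and Fv: "\<And>x. x \<in> carrier X \<Longrightarrow> F (v x) = \<zero>\<^bsub>?Q\<^esub>" and x: "x \<in> carrier X" for X v x
  proof -
    obtain k \<pi> k' \<kappa> where B: "pruefer_brick R \<X> Y \<iota> N \<phi> X k \<pi> k' \<kappa>" by (rule brick_presentation[OF X])
    interpret B: pruefer_brick R \<X> Y \<iota> N \<phi> X k \<pi> k' \<kappa> by (rule B)
    obtain l where l: "linear_map R B.G V l" "l ` carrier B.G \<subseteq> W (Suc n)"
      "\<And>g. g \<in> carrier B.G \<Longrightarrow> q (l g) = v (\<pi> g)" "l ` B.K \<subseteq> W n"
      using B.layer_lift[OF L v] by blast
    have flW: "f (l g) \<in> W n" if g: "g \<in> carrier B.G" for g
    proof -
      have lg: "l g \<in> W (Suc n)" using l(2) g by blast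
      have "q (f (l g)) = \<zero>\<^bsub>?Q\<^esub>"
        using Fq[OF lg] l(3)[OF g] Fv[OF linear_map_closed[OF B.\<pi>G g]] by (simp del: direct_sum_simps)
      then show ?thesis using ker[OF fW'[OF lg]] by blast
    qed
    \<comment> \<open>Since \<open>F\<close> kills the map \<open>v\<close>, its lift
      \<open>l\<close> followed by \<open>f\<close> lands in \<open>W n\<close> on all of
      \<open>G\<close>. So \<open>a\<close> may be applied everywhere, and the result agrees with
      \<open>l\<close> on the kernel; hence \<open>l\<close> itself lands in \<open>W n\<close>,
      which means that \<open>v\<close> is zero.\<close>
    have "linear_map R B.G (sub V (W n)) (\<lambda>g. f (l g))"
      using linear_map_comp[OF l(1) f] flW by (subst linear_map_to_sub[OF submod_subset[OF W]]) auto
    then have afl: "linear_map R B.G V (\<lambda>g. a (f (l g)))" using aV by (rule linear_map_comp)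
    obtain g where g: "g \<in> carrier B.G" "x = \<pi> g" using x B.surjG by blast
    have "l g \<in> W n"
    proof (rule B.agree_on_K_mem[OF l(1) afl _ g(1) W W0n(1)])
      show "l k = a (f (l k))" if "k \<in> B.K" for k using a1[of "l k"] l(4) that by auto
      show "a (f (l g)) \<in> W n" by (rule aW[OF flW[OF g(1)]])
    qed
    moreover have "l g \<in> W (Suc n)" using l(2) g(1) by blast
    ultimately have "q (l g) = \<zero>\<^bsub>?Q\<^esub>" using ker by blast
    then show ?thesis using l(3)[OF g(1)] g(2) by (simp del: direct_sum_simps)
  qed
  obtain h where h: "\<And>i. i \<in> I \<Longrightarrow> linear_map R (fst i) ?Q (h i)"
    "\<And>i x. i \<in> I \<Longrightarrow> x \<in> carrier (fst i) \<Longrightarrow> \<exists>z\<in>W (Suc n). h i x = q z \<and> q (f z) = ds_in I fst i x"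
    using pre by metis
  \<comment> \<open>The layer is a direct sum, so the preimages \<open>h i\<close> of the inclusions
    of the summands assemble to a right inverse of \<open>F\<close>.\<close>
  obtain S where S: "linear_map R ?Q ?Q S"
    and S2: "\<And>i x. i \<in> I \<Longrightarrow> x \<in> carrier (fst i) \<Longrightarrow> S (ds_in I fst i x) = h i x"
  proof (rule direct_sum_universal[where g = h and M = fst and I = I, OF R _ Q])
    show "left_module R (fst i)" "linear_map R (fst i) ?Q (h i)" if "i \<in> I" for i
      using that by (rule layer_modules[OF L], rule h(1))
  qed (rule that)
  have FS: "F (S y) = y" if y: "y \<in> carrier ?Q" for y
  proof (rule direct_sum_map_ext[OF R layer_modules[OF L] Q linear_map_comp[OF S F] linear_map_ident _ y])
    fix i x assume i: "i \<in> I" and x: "x \<in> carrier (fst i)"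
    obtain z where z: "z \<in> W (Suc n)" "h i x = q z" "q (f z) = ds_in I fst i x" using h(2)[OF i x] by blast
    then show "F (S (ds_in I fst i x)) = ds_in I fst i x" using S2[OF i x] Fq by simp
  qed
  have SF: "S (F y) = y" if y: "y \<in> carrier ?Q" for y
  proof (rule direct_sum_map_ext[OF R layer_modules[OF L] Q linear_map_comp[OF F S] linear_map_ident _ y])
    fix i x assume i: "i \<in> I" and x: "x \<in> carrier (fst i)"
    have SFi: "linear_map R (fst i) ?Q (\<lambda>x. S (F (ds_in I fst i x)))"
      by (rule linear_map_comp[OF linear_map_comp[OF din[OF i] F] S])
    \<comment> \<open>On each summand, \<open>S\<close> after \<open>F\<close> minus the identity is
      a map killed by \<open>F\<close>, because \<open>F\<close> after \<open>S\<close> is the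
      identity; \<open>hom_inj\<close> makes it zero. So \<open>S\<close> is a two-sided
      inverse.\<close>
    have "S (F (ds_in I fst i x)) \<ominus>\<^bsub>?Q\<^esub> ds_in I fst i x = \<zero>\<^bsub>?Q\<^esub>"
    proof (rule hom_inj[OF I\<X>[OF i] linear_map_diff[OF Q SFi din[OF i]] _ x])
      fix x assume x: "x \<in> carrier (fst i)"
      have d: "ds_in I fst i x \<in> carrier ?Q" by (rule linear_map_closed[OF din[OF i] x])
      have Fd: "F (ds_in I fst i x) \<in> carrier ?Q" by (rule linear_map_closed[OF F d])
      have "F (S (F (ds_in I fst i x)) \<ominus>\<^bsub>?Q\<^esub> ds_in I fst i x) = F (S (F (ds_in I fst i x))) \<ominus>\<^bsub>?Q\<^esub> F (ds_in I fst i x)"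
        by (rule linear_map_minus[OF Q Q F linear_map_closed[OF S Fd] d])
      also have "\<dots> = \<zero>\<^bsub>?Q\<^esub>" using FS[OF Fd] Q.M.minus_eq_zero_iff[OF Fd Fd] by (simp del: direct_sum_simps)
      finally show "F (S (F (ds_in I fst i x)) \<ominus>\<^bsub>?Q\<^esub> ds_in I fst i x) = \<zero>\<^bsub>?Q\<^esub>" .
    qed
    then show "S (F (ds_in I fst i x)) = ds_in I fst i x"
      using Q.M.minus_eq_zero_iff[OF linear_map_closed[OF SFi x] linear_map_closed[OF din[OF i] x]] by blast
  qed
  have "inj_on f (carrier (sub V (W (Suc n))))"
    unfolding linear_map_inj_on_iff[OF WM V linear_map_restrict[OF f W]]
  proof (intro ballI impI)
    fix z assume "z \<in> carrier (sub V (W (Suc n)))" and z0: "f z = \<zero>\<^bsub>V\<^esub>"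
    then have z: "z \<in> W (Suc n)" by simp
    have zW: "\<zero>\<^bsub>V\<^esub> \<in> W m" for m by (rule submod_zero[OF W])
    have qz: "q z \<in> carrier ?Q" using z surj by blast
    have "q \<zero>\<^bsub>V\<^esub> = \<zero>\<^bsub>?Q\<^esub>" using ker[OF zW] zW by blast
    then have "F (q z) = \<zero>\<^bsub>?Q\<^esub>" using Fq[OF z] z0 by (simp del: direct_sum_simps)
    then have "q z = \<zero>\<^bsub>?Q\<^esub>" using SF[OF qz] linear_map_zero[OF Q Q S] by (simp del: direct_sum_simps)
    \<comment> \<open>Injectivity on the layer pushes the kernel of \<open>f\<close> down to
      \<open>W n\<close>, where \<open>f\<close> is injective by assumption.\<close>
    then have "z \<in> W n" using ker[OF z] by blast
    then have "z = \<zero>\<^bsub>V\<^esub>" using inj_onD[OF inj, of z "\<zero>\<^bsub>V\<^esub>"] z0 fz zW by simp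
    then show "z = \<zero>\<^bsub>sub V (W (Suc n))\<^esub>" by simp
  qed
  then show "inj_on f (W (Suc n))" by simp
qed

lemma endo_bij:
  assumes f: "linear_map R V V f" and z: "z \<in> W 0" "f z \<noteq> \<zero>\<^bsub>V\<^esub>"
  shows "bij_betw f (carrier V) (carrier V)"
proof -
  have W: "f ` W n = W n \<and> inj_on f (W n)" for n
  proof (induction n)
    case 0
    show ?case using endo_W0[OF assms] by simp
  next
    case (Suc n)
    then show ?case using endo_bij_step[OF f, of n] by simp
  qed
  have "inj_on f (carrier V)"
  proof (rule inj_onI)
    fix x y assume xy: "x \<in> carrier V" "y \<in> carrier V" "f x = f y"
    then obtain n m where "x \<in> W n" "y \<in> W m" by (auto simp: W_union)
    then have "x \<in> W (n + m)" "y \<in> W (n + m)" using W_mono[of n "n + m"] W_mono[of m "n + m"] by auto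
    then show "x = y" using W[of "n + m"] xy(3) by (auto dest: inj_onD)
  qed
  moreover have "f ` carrier V = carrier V" unfolding W_union image_UN using W by simp
  ultimately show ?thesis by (simp add: bij_betw_def)
qed

section \<open>The unique maximal left ideal\<close>

definition J :: "((nat \<times> 'm) set \<Rightarrow> (nat \<times> 'm) set) set" where
  "J = {f \<in> carrier (End R V). \<forall>z\<in>W 0. f z = \<zero>\<^bsub>V\<^esub>}"

text \<open>\<open>W 0\<close> is the image of \<open>Y\<close>, and any map from a member of \<X>
  to the limit lands in \<open>W 0\<close>; so \<open>W 0\<close> is fully invariant.\<close>

lemma endo_W0_closed: "f \<in> Hom R V V \<Longrightarrow> z \<in> W 0 \<Longrightarrow> f z \<in> W 0"
  using hom_into_limit[OF Y\<X> linear_map_comp[OF u HomD(1)]] by (auto simp: u_image[symmetric])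

lemma J_left_ideal: "left_ideal J (End R V)"
proof -
  interpret E: ring "End R V" by (rule ring_End[OF V])
  have Wc: "z \<in> carrier V" if "z \<in> W 0" for z using submod_mem[OF W that] .
  have "subgroup J (add_monoid (End R V))"
  proof (rule group.subgroupI[OF E.add.is_group])
    show "J \<subseteq> carrier (add_monoid (End R V))" by (auto simp: J_def)
    have "\<zero>\<^bsub>End R V\<^esub> \<in> J" using E.zero_closed Wc by (simp add: J_def zero_map_def)
    then show "J \<noteq> {}" by blast
  next
    fix f assume f: "f \<in> J"
    have fE: "f \<in> carrier (End R V)" using f by (simp add: J_def)
    have "(\<ominus>\<^bsub>End R V\<^esub> f) z = \<zero>\<^bsub>V\<^esub>" if z: "z \<in> W 0" for z
    proof -
      have nE: "\<ominus>\<^bsub>End R V\<^esub> f \<in> Hom R V V" using E.a_inv_closed[OF fE] by simp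
      have c: "(\<ominus>\<^bsub>End R V\<^esub> f) z \<in> carrier V" by (rule linear_map_closed[OF HomD(1)[OF nE] Wc[OF z]])
      have "(\<ominus>\<^bsub>End R V\<^esub> f \<oplus>\<^bsub>End R V\<^esub> f) z = \<zero>\<^bsub>End R V\<^esub> z" using E.l_neg[OF fE] by simp
      then have "(\<ominus>\<^bsub>End R V\<^esub> f) z \<oplus>\<^bsub>V\<^esub> f z = \<zero>\<^bsub>V\<^esub>"
        using Wc[OF z] by (simp add: End_ops(3) zero_map_def)
      then show ?thesis using f z c by (simp add: J_def)
    qed
    then have "\<ominus>\<^bsub>End R V\<^esub> f \<in> J" using E.a_inv_closed[OF fE] by (simp add: J_def)
    then show "inv\<^bsub>add_monoid (End R V)\<^esub> f \<in> J" by (simp add: a_inv_def)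
  next
    fix f g assume f: "f \<in> J" and g: "g \<in> J"
    have "f \<oplus>\<^bsub>End R V\<^esub> g \<in> carrier (End R V)" using f g by (intro E.a_closed) (simp_all add: J_def)
    then show "f \<otimes>\<^bsub>add_monoid (End R V)\<^esub> g \<in> J" using f g Wc by (simp add: J_def End_ops(3))
  qed
  moreover have "g \<otimes>\<^bsub>End R V\<^esub> f \<in> J" if g: "g \<in> carrier (End R V)" and f: "f \<in> J" for f g
  proof -
    have "g \<otimes>\<^bsub>End R V\<^esub> f \<in> carrier (End R V)" using f g by (intro E.m_closed) (simp_all add: J_def)
    \<comment> \<open>In the product \<open>g\<close> is applied before \<open>f\<close>, so left
      multiplication preserves \<open>J\<close> because \<open>g\<close> maps \<open>W 0\<close>
      into itself.\<close>
    then show ?thesis using f g Wc endo_W0_closed[of g] by (simp add: J_def End_ops(1))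
  qed
  ultimately show ?thesis unfolding left_ideal_def additive_subgroup_def by blast
qed

lemma Unit_if_notin_J: "f \<in> carrier (End R V) \<Longrightarrow> f \<notin> J \<Longrightarrow> f \<in> Units (End R V)"
proof -
  assume f: "f \<in> carrier (End R V)" "f \<notin> J"
  then obtain z where z: "z \<in> W 0" "f z \<noteq> \<zero>\<^bsub>V\<^esub>" by (auto simp: J_def)
  have fH: "f \<in> Hom R V V" using f by simp
  show ?thesis by (rule bij_Unit_End[OF V fH endo_bij[OF HomD(1)[OF fH] z]])
qed

text \<open>If the identity vanished on \<open>W 0\<close>, the brick \<open>Y\<close> would be
  zero, contrary to \<open>1 \<noteq> 0\<close> in its endomorphism ring.\<close>

lemma J_proper: "J \<noteq> carrier (End R V)"
proof
  assume eq: "J = carrier (End R V)"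
  interpret E: ring "End R V" by (rule ring_End[OF V])
  have YM: "left_module R Y" by (rule \<X>_module[OF Y\<X>])
  have "\<one>\<^bsub>End R V\<^esub> \<in> J" unfolding eq by (rule E.one_closed)
  then have zero: "z = \<zero>\<^bsub>V\<^esub>" if "z \<in> W 0" for z
    using that submod_mem[OF W that] by (auto simp: J_def End_ops(2) dest: bspec[of _ _ z])
  have "y = \<zero>\<^bsub>Y\<^esub>" if y: "y \<in> carrier Y" for y
  proof -
    have "u y = \<zero>\<^bsub>V\<^esub>" using zero y u_image by blast
    then show ?thesis using u_inj y linear_map_inj_on_iff[OF YM V u] by blast
  qed
  then have "\<one>\<^bsub>End R Y\<^esub> = \<zero>\<^bsub>End R Y\<^esub>"
    by (auto simp: End_ops(2) zero_map_def intro!: restrict_ext)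
  moreover have "division_ring (End R Y)" using brick_mem[OF Y\<X>] by (simp add: brick_def)
  ultimately show False unfolding division_ring_def by blast
qed

text \<open>A proper left ideal contains no unit, and everything outside \<open>J\<close> is a unit.
  Hence \<open>J\<close> is the largest proper left ideal, and so the only maximal one.\<close>

lemma left_ideal_subset_J:
  assumes I: "left_ideal I (End R V)" and proper: "I \<noteq> carrier (End R V)"
  shows "I \<subseteq> J"
proof (rule ccontr)
  interpret E: ring "End R V" by (rule ring_End[OF V])
  assume "\<not> I \<subseteq> J"
  then obtain f where f: "f \<in> I" "f \<notin> J" by blast
  have sub: "I \<subseteq> carrier (End R V)"
    using I unfolding left_ideal_def by (blast dest: additive_subgroup.a_subset)
  have mult: "\<And>r x. r \<in> carrier (End R V) \<Longrightarrow> x \<in> I \<Longrightarrow> r \<otimes>\<^bsub>End R V\<^esub> x \<in> I"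
    using I unfolding left_ideal_def by blast
  have fU: "f \<in> Units (End R V)" using f sub Unit_if_notin_J by blast
  then have "inv\<^bsub>End R V\<^esub> f \<otimes>\<^bsub>End R V\<^esub> f \<in> I" using f by (intro mult E.Units_inv_closed)
  then have one: "\<one>\<^bsub>End R V\<^esub> \<in> I" using E.Units_l_inv[OF fU] by simp
  have "r \<in> I" if "r \<in> carrier (End R V)" for r
    using mult[OF that one] E.r_one[OF that] by simp
  then show False using sub proper by blast
qed

lemma maximal_left_ideal_iff: "maximal_left_ideal I (End R V) \<longleftrightarrow> I = J"
proof
  assume m: "maximal_left_ideal I (End R V)"
  then have "I \<subseteq> J" using left_ideal_subset_J unfolding maximal_left_ideal_def by blast
  then show "I = J" using m J_left_ideal J_proper unfolding maximal_left_ideal_def by blast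
next
  assume "I = J"
  then show "maximal_left_ideal I (End R V)"
    unfolding maximal_left_ideal_def using J_left_ideal J_proper left_ideal_subset_J by blast
qed

end

theorem proposition6p3:
  fixes R :: "('r, 'k) ring_scheme"
    and \<X> :: "('r, 'x) module set"
    and Y :: "('r, 'x) module"
    and \<iota> :: "'x \<Rightarrow> 'm"
    and N :: "nat \<Rightarrow> ('r, 'm) module"
    and \<phi> :: "nat \<Rightarrow> 'm \<Rightarrow> 'm"
  assumes "ring R"
    and "semibrick R \<X>"
    and "\<forall>X\<in>\<X>. proj_dim_le_one R X"
    and "\<forall>X\<in>\<X>. \<not> divisible R \<X> X"
    and "Y \<in> \<X>"
    and "universal_chain R \<X> Y \<iota> N \<phi>"
  shows "let Y' = direct_limit N \<phi>; E = End R Y' in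
     local_ring E \<and>
     jacobson_radical E =
       {f \<in> carrier E. \<forall>y\<in>carrier Y. f (limit_elem N \<phi> 0 (\<iota> y)) = \<zero>\<^bsub>Y'\<^esub>} \<and>
     (\<forall>f\<in>carrier E. f \<noteq> \<zero>\<^bsub>E\<^esub> \<longrightarrow> f ` carrier Y' = carrier Y')"
proof -
  interpret pruefer R \<X> Y \<iota> N \<phi>
    by (rule pruefer.intro) (use assms in auto)
  let ?E = "End R (direct_limit N \<phi>)"
  have "local_ring ?E"
    unfolding local_ring_def maximal_left_ideal_iff using ring_End[OF V] by simp
  moreover have "jacobson_radical ?E = {f \<in> carrier ?E. \<forall>y\<in>carrier Y. f (limit_elem N \<phi> 0 (\<iota> y)) = \<zero>\<^bsub>direct_limit N \<phi>\<^esub>}"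
  proof -
    have "jacobson_radical ?E = J"
      unfolding jacobson_radical_def maximal_left_ideal_iff by (auto simp: J_def)
    also have "\<dots> = {f \<in> carrier ?E. \<forall>y\<in>carrier Y. f (u y) = \<zero>\<^bsub>direct_limit N \<phi>\<^esub>}"
      unfolding J_def u_image[symmetric] by blast
    finally show ?thesis by (simp add: u_def)
  qed
  moreover have "f ` carrier (direct_limit N \<phi>) = carrier (direct_limit N \<phi>)"
    if f: "f \<in> carrier ?E" "f \<noteq> \<zero>\<^bsub>?E\<^esub>" for f
  proof -
    have fH: "f \<in> Hom R (direct_limit N \<phi>) (direct_limit N \<phi>)" using f by simp
    \<comment> \<open>Elements of the endomorphism ring are extensional, so one that vanishes at
      every point is equal to \<open>zero_map\<close>.\<close>
    have "\<exists>z\<in>carrier (direct_limit N \<phi>). f z \<noteq> \<zero>\<^bsub>direct_limit N \<phi>\<^esub>"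
    proof (rule ccontr)
      assume "\<not> ?thesis"
      then have "f = zero_map (direct_limit N \<phi>) (direct_limit N \<phi>)"
        using HomD(2)[OF fH] by (auto simp: zero_map_def extensional_def fun_eq_iff)
      then show False using f(2) by simp
    qed
    then show ?thesis using endo_surj[OF HomD(1)[OF fH]] by blast
  qed
  ultimately show ?thesis by (simp add: Let_def)
qed

end
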